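(* Let $k$ be a field and let $A$ be a finite-dimensional $k$-algebra such that $A/J(A)$ is a separable $k$-algebra (e.g. $k$ is a perfect field). If $\mathrm{gldim}(A)<\infty$, then $\mathrm{hh.dim}(A)<\infty$ and $\mathrm{hch.dim}(A)<\infty$.
   Context: Algebras are unital associative algebras over the field $k$, and $\otimes=\otimes_k$. $J(A)$ is the Jacobson radical of $A$ and $A^{op}$ is the opposite algebra. A $k$-algebra $S$ is separable if it is finite-dimensional and $S\otimes \ell$ is semisimple for every field extension $\ell\supseteq k$ (equivalently, $S\otimes S^{op}$ is semisimple). A field $k$ is perfect if every finite extension of $k$ is separable. The projective dimension $\mathrm{pd}_A(M)$ of a left $A$-module $M$ is the minimal length $n$ of a projective resolution $0\to P_n\to\cdots\to P_0\to M\to 0$, or $\infty$ if there is no finite one; the global dimension is $\mathrm{gldim}(A)=\sup\{\mathrm{pd}_A(M)\mid M \text{ a left } A\text{-module}\}$. The Hochschild homology and cohomology groups of $A$ are $HH_n(A)=\mathrm{Tor}_n^{A\otimes A^{op}}(A,A)$ and $HH^n(A)=\mathrm{Ext}^n_{A\otimes A^{op}}(A,A)$ for $n\geq 0$. Put $\mathrm{hh.dim}(A)=\sup\{n\in\mathbb{N}\mid HH_n(A)\neq 0\}$ and $\mathrm{hch.dim}(A)=\sup\{n\in\mathbb{N}\mid HH^n(A)\neq 0\}$ (with $0\in\mathbb{N}$), with the convention that the respective dimension is $0$ if all the groups vanish. *)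

theory Defs
  imports "HOL-Algebra.Module" "HOL-Algebra.QuotRing" "HOL-Algebra.Free_Abelian_Groups"
    "HOL-Library.Extended_Nat"
begin

section \<open>Modules over a not necessarily commutative ring\<close>

text \<open>
  The locale \<^locale>\<open>module\<close> of HOL-Algebra has a commutative ring of scalars; the one below only
  assumes a ring. Its record type is reused, and for a module the fields \<^const>\<open>mult\<close> and
  \<^const>\<open>one\<close> carry no information. A right \<open>R\<close>-module \<open>N\<close> is a left module over \<open>op_ring R\<close>, so
  its \<open>r \<odot>\<^bsub>N\<^esub> n\<close> stands for \<open>n r\<close>.
\<close>

locale lmodule = R?: ring R + M?: abelian_group M
  for R :: "('r, 'x) ring_scheme" and M :: "('r, 'm, 'y) module_scheme" +
  assumes smult_closed: "\<lbrakk>r \<in> carrier R; x \<in> carrier M\<rbrakk> \<Longrightarrow> r \<odot>\<^bsub>M\<^esub> x \<in> carrier M"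
    and smult_l_distr: "\<lbrakk>r \<in> carrier R; s \<in> carrier R; x \<in> carrier M\<rbrakk>
      \<Longrightarrow> (r \<oplus>\<^bsub>R\<^esub> s) \<odot>\<^bsub>M\<^esub> x = r \<odot>\<^bsub>M\<^esub> x \<oplus>\<^bsub>M\<^esub> s \<odot>\<^bsub>M\<^esub> x"
    and smult_r_distr: "\<lbrakk>r \<in> carrier R; x \<in> carrier M; y \<in> carrier M\<rbrakk>
      \<Longrightarrow> r \<odot>\<^bsub>M\<^esub> (x \<oplus>\<^bsub>M\<^esub> y) = r \<odot>\<^bsub>M\<^esub> x \<oplus>\<^bsub>M\<^esub> r \<odot>\<^bsub>M\<^esub> y"
    and smult_assoc: "\<lbrakk>r \<in> carrier R; s \<in> carrier R; x \<in> carrier M\<rbrakk>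
      \<Longrightarrow> (r \<otimes>\<^bsub>R\<^esub> s) \<odot>\<^bsub>M\<^esub> x = r \<odot>\<^bsub>M\<^esub> (s \<odot>\<^bsub>M\<^esub> x)"
    and smult_one: "x \<in> carrier M \<Longrightarrow> \<one>\<^bsub>R\<^esub> \<odot>\<^bsub>M\<^esub> x = x"

definition op_ring :: "('a, 'x) ring_scheme \<Rightarrow> ('a, 'x) ring_scheme" where
  "op_ring R = R\<lparr>monoid.mult := (\<lambda>x y. y \<otimes>\<^bsub>R\<^esub> x)\<rparr>"

definition regular_module :: "('r, 'x) ring_scheme \<Rightarrow> ('r, 'r) module" where
  "regular_module R = \<lparr>carrier = carrier R, monoid.mult = monoid.mult R, one = \<one>\<^bsub>R\<^esub>, ring.zero = \<zero>\<^bsub>R\<^esub>,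
     add = add R, smult = monoid.mult R\<rparr>"

definition mod_hom ::
  "('r, 'x) ring_scheme \<Rightarrow> ('r, 'm, 'y) module_scheme \<Rightarrow> ('r, 'n, 'z) module_scheme \<Rightarrow> ('m \<Rightarrow> 'n) set"
  where
  "mod_hom R M N = {h \<in> hom (add_monoid M) (add_monoid N).
     \<forall>r\<in>carrier R. \<forall>x\<in>carrier M. h (r \<odot>\<^bsub>M\<^esub> x) = r \<odot>\<^bsub>N\<^esub> h x}"

definition free_module :: "('r, 'x) ring_scheme \<Rightarrow> 'g set \<Rightarrow> ('r, 'g \<Rightarrow> 'r) module" where
  "free_module R X = \<lparr>carrier = {f. (\<forall>x\<in>X. f x \<in> carrier R) \<and> (\<forall>x. x \<notin> X \<longrightarrow> f x = \<zero>\<^bsub>R\<^esub>)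
       \<and> finite {x. f x \<noteq> \<zero>\<^bsub>R\<^esub>}},
     monoid.mult = undefined, one = undefined,
     ring.zero = (\<lambda>x. \<zero>\<^bsub>R\<^esub>), add = (\<lambda>f g x. f x \<oplus>\<^bsub>R\<^esub> g x), smult = (\<lambda>r f x. r \<otimes>\<^bsub>R\<^esub> f x)\<rparr>"

text \<open>
  Projective means: a direct summand of a free module. Bases contained in the type \<open>'p\<close> of
  elements of \<open>P\<close> suffice, because \<open>P\<close> is a direct summand of some free module iff the canonical
  surjection from the free module on \<open>carrier P\<close> onto \<open>P\<close> splits.
\<close>

definition projective_module :: "('r, 'x) ring_scheme \<Rightarrow> ('r, 'p, 'y) module_scheme \<Rightarrow> bool" where
  "projective_module R P \<longleftrightarrow> lmodule R P \<and>
     (\<exists>X :: 'p set. \<exists>i \<in> mod_hom R P (free_module R X). \<exists>q \<in> mod_hom R (free_module R X) P.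
        \<forall>x\<in>carrier P. q (i x) = x)"

definition semisimple_module :: "('r, 'x) ring_scheme \<Rightarrow> ('r, 'm, 'y) module_scheme \<Rightarrow> bool" where
  "semisimple_module R M \<longleftrightarrow> lmodule R M \<and>
     (\<forall>U. submodule U R M \<longrightarrow>
        (\<exists>V. submodule V R M \<and> U \<inter> V = {\<zero>\<^bsub>M\<^esub>} \<and> U <+>\<^bsub>M\<^esub> V = carrier M))"

definition semisimple_ring :: "('r, 'x) ring_scheme \<Rightarrow> bool" where
  "semisimple_ring R \<longleftrightarrow> ring R \<and> semisimple_module R (regular_module R)"

definition maximal_left_ideal :: "('r, 'x) ring_scheme \<Rightarrow> 'r set \<Rightarrow> bool" where
  "maximal_left_ideal R I \<longleftrightarrow> submodule I R (regular_module R) \<and> I \<noteq> carrier R \<and>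
     (\<forall>L. submodule L R (regular_module R) \<and> I \<subseteq> L \<longrightarrow> L = I \<or> L = carrier R)"

definition jacobson_radical :: "('r, 'x) ring_scheme \<Rightarrow> 'r set" where
  "jacobson_radical R = carrier R \<inter> \<Inter> {I. maximal_left_ideal R I}"


section \<open>Tensor products\<close>

text \<open>
  \<open>N \<otimes>\<^sub>R M\<close> for a right \<open>R\<close>-module \<open>N\<close> and a left \<open>R\<close>-module \<open>M\<close>: the free abelian group on
  \<open>N \<times> M\<close> modulo biadditivity and \<open>(n r, m) = (n, r m)\<close>. It is a multiplicatively written
  abelian group whose elements are cosets.
\<close>

definition tensor_relations ::
  "('r, 'x) ring_scheme \<Rightarrow> ('r, 'n, 'y) module_scheme \<Rightarrow> ('r, 'm, 'z) module_scheme
     \<Rightarrow> ('n \<times> 'm \<Rightarrow>\<^sub>0 int) set" where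
  "tensor_relations R N M =
     {frag_of (n \<oplus>\<^bsub>N\<^esub> n', m) - frag_of (n, m) - frag_of (n', m) | n n' m.
        n \<in> carrier N \<and> n' \<in> carrier N \<and> m \<in> carrier M} \<union>
     {frag_of (n, m \<oplus>\<^bsub>M\<^esub> m') - frag_of (n, m) - frag_of (n, m') | n m m'.
        n \<in> carrier N \<and> m \<in> carrier M \<and> m' \<in> carrier M} \<union>
     {frag_of (r \<odot>\<^bsub>N\<^esub> n, m) - frag_of (n, r \<odot>\<^bsub>M\<^esub> m) | r n m.
        r \<in> carrier R \<and> n \<in> carrier N \<and> m \<in> carrier M}"

definition tensor_subgroup ::
  "('r, 'x) ring_scheme \<Rightarrow> ('r, 'n, 'y) module_scheme \<Rightarrow> ('r, 'm, 'z) module_scheme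
     \<Rightarrow> ('n \<times> 'm \<Rightarrow>\<^sub>0 int) set" where
  "tensor_subgroup R N M =
     generate (free_Abelian_group (carrier N \<times> carrier M)) (tensor_relations R N M)"

definition tensor_group ::
  "('r, 'x) ring_scheme \<Rightarrow> ('r, 'n, 'y) module_scheme \<Rightarrow> ('r, 'm, 'z) module_scheme
     \<Rightarrow> ('n \<times> 'm \<Rightarrow>\<^sub>0 int) set monoid" where
  "tensor_group R N M =
     free_Abelian_group (carrier N \<times> carrier M) Mod tensor_subgroup R N M"

definition pure_tensor ::
  "('r, 'x) ring_scheme \<Rightarrow> ('r, 'n, 'y) module_scheme \<Rightarrow> ('r, 'm, 'z) module_scheme
     \<Rightarrow> 'n \<Rightarrow> 'm \<Rightarrow> ('n \<times> 'm \<Rightarrow>\<^sub>0 int) set" where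
  "pure_tensor R N M n m =
     tensor_subgroup R N M #>\<^bsub>free_Abelian_group (carrier N \<times> carrier M)\<^esub> frag_of (n, m)"

text \<open>
  The homomorphism from a tensor product to an abelian group \<open>G\<close> induced by a balanced map \<open>\<phi>\<close>,
  i.e. the one sending \<open>n \<otimes> m\<close> to \<open>\<phi> (n, m)\<close>. The additive extension of a balanced \<open>\<phi>\<close> is constant
  on the coset \<open>X\<close>, and \<^const>\<open>the_elem\<close> extracts its value.
\<close>

definition tensor_lift :: "('g, 'x) monoid_scheme \<Rightarrow> ('n \<times> 'm \<Rightarrow> 'g) \<Rightarrow> ('n \<times> 'm \<Rightarrow>\<^sub>0 int) set \<Rightarrow> 'g"
  where
  "tensor_lift G \<phi> X = the_elem
     ((\<lambda>f. finprod G (\<lambda>p. \<phi> p [^]\<^bsub>G\<^esub> Poly_Mapping.lookup f p) (Poly_Mapping.keys f)) ` X)"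


section \<open>Algebras over a field\<close>

text \<open>The locale \<^locale>\<open>algebra\<close> of HOL-Algebra is restricted to commutative algebras.\<close>

locale assoc_algebra = K?: field K + Module.module K A + A?: ring A
  for K :: "('k, 'x) ring_scheme" and A :: "('k, 'a, 'y) module_scheme" +
  assumes smult_mult_left: "\<lbrakk>c \<in> carrier K; x \<in> carrier A; y \<in> carrier A\<rbrakk>
      \<Longrightarrow> (c \<odot>\<^bsub>A\<^esub> x) \<otimes>\<^bsub>A\<^esub> y = c \<odot>\<^bsub>A\<^esub> (x \<otimes>\<^bsub>A\<^esub> y)"
    and smult_mult_right: "\<lbrakk>c \<in> carrier K; x \<in> carrier A; y \<in> carrier A\<rbrakk>
      \<Longrightarrow> x \<otimes>\<^bsub>A\<^esub> (c \<odot>\<^bsub>A\<^esub> y) = c \<odot>\<^bsub>A\<^esub> (x \<otimes>\<^bsub>A\<^esub> y)"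

definition finite_dimensional :: "('k, 'x) ring_scheme \<Rightarrow> ('k, 'v, 'y) module_scheme \<Rightarrow> bool" where
  "finite_dimensional K V \<longleftrightarrow> (\<exists>B. finite B \<and> B \<subseteq> carrier V \<and>
     (\<forall>x\<in>carrier V. \<exists>c \<in> B \<rightarrow> carrier K. x = finsum V (\<lambda>b. c b \<odot>\<^bsub>V\<^esub> b) B))"

definition quotient_algebra :: "('k, 'a, 'y) module_scheme \<Rightarrow> 'a set \<Rightarrow> ('k, 'a set) module" where
  "quotient_algebra A I =
     ring.extend (A Quot I) (module.fields (\<lambda>c X. \<Union>x\<in>X. I +>\<^bsub>A\<^esub> (c \<odot>\<^bsub>A\<^esub> x)))"

definition tensor_algebra ::
  "('k, 'x) ring_scheme \<Rightarrow> ('k, 'a, 'y) module_scheme \<Rightarrow> ('k, 'b, 'z) module_scheme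
     \<Rightarrow> ('k, ('a \<times> 'b \<Rightarrow>\<^sub>0 int) set) module" where
  "tensor_algebra K A B = (let T = tensor_group K A B in
     \<lparr>carrier = carrier T,
      monoid.mult = (\<lambda>X Y. tensor_lift T (\<lambda>(a, b).
                 tensor_lift T (\<lambda>(a', b'). pure_tensor K A B (a \<otimes>\<^bsub>A\<^esub> a') (b \<otimes>\<^bsub>B\<^esub> b')) Y) X),
      one = pure_tensor K A B \<one>\<^bsub>A\<^esub> \<one>\<^bsub>B\<^esub>,
      ring.zero = \<one>\<^bsub>T\<^esub>,
      add = monoid.mult T,
      smult = (\<lambda>c. tensor_lift T (\<lambda>(a, b). pure_tensor K A B (c \<odot>\<^bsub>A\<^esub> a) b))\<rparr>)"

text \<open>
  Of the two equivalent definitions of separability, semisimplicity of \<open>S \<otimes> l\<close> for all field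
  extensions \<open>l\<close> and semisimplicity of \<open>S \<otimes> S\<^sup>o\<^sup>p\<close>, the second does not quantify over types.
\<close>

definition separable_algebra :: "('k, 'x) ring_scheme \<Rightarrow> ('k, 's, 'y) module_scheme \<Rightarrow> bool" where
  "separable_algebra K S \<longleftrightarrow> assoc_algebra K S \<and> finite_dimensional K S \<and>
     semisimple_ring (tensor_algebra K S (op_ring S))"


section \<open>Projective resolutions and homological dimensions\<close>

definition proj_resolution ::
  "('r, 'x) ring_scheme \<Rightarrow> ('r, 'm, 'y) module_scheme
     \<Rightarrow> (nat \<Rightarrow> ('r, 'p) module) \<Rightarrow> (nat \<Rightarrow> 'p \<Rightarrow> 'p) \<Rightarrow> ('p \<Rightarrow> 'm) \<Rightarrow> bool" where
  "proj_resolution R M P d \<epsilon> \<longleftrightarrow>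
     (\<forall>n. projective_module R (P n)) \<and>
     (\<forall>n. d n \<in> mod_hom R (P (Suc n)) (P n)) \<and>
     \<epsilon> \<in> mod_hom R (P 0) M \<and>
     \<epsilon> ` carrier (P 0) = carrier M \<and>
     d 0 ` carrier (P 1) = kernel (add_monoid (P 0)) (add_monoid M) \<epsilon> \<and>
     (\<forall>n. d (Suc n) ` carrier (P (Suc (Suc n)))
            = kernel (add_monoid (P (Suc n))) (add_monoid (P n)) (d n))"

text \<open>
  A type in which resolutions of \<open>R\<close>-modules \<open>M\<close> with elements in \<open>'m\<close> are formed. It contains
  the free \<open>R\<close>-modules with basis in the infinite type \<open>('r \<times> 'm) list\<close>. Since \<open>M\<close> and each of
  these free modules have at most as many elements as \<open>('r \<times> 'm) list\<close>, every \<open>M\<close> has a free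
  resolution here.
  Moreover, if \<open>M\<close> has a projective resolution of length \<open>n > 0\<close>, then by Schanuel's lemma the
  \<open>n\<close>-th syzygy of such a free resolution is projective, so truncation gives one of length \<open>n\<close>
  in this type; for \<open>n = 0\<close>, a projective \<open>M\<close> embeds into a free module of this type.
\<close>

type_synonym ('r, 'm) res = "('r \<times> 'm) list \<Rightarrow> 'r"

definition proj_dim :: "('r, 'x) ring_scheme \<Rightarrow> ('r, 'm, 'y) module_scheme \<Rightarrow> enat" where
  "proj_dim R M = Inf {enat n | n.
     \<exists>(P :: nat \<Rightarrow> ('r, ('r, 'm) res) module) d \<epsilon>. proj_resolution R M P d \<epsilon> \<and>
       (\<forall>i>n. carrier (P i) = {\<zero>\<^bsub>P i\<^esub>})}"

text \<open>
  HOL cannot quantify over types, so the modules range over those with elements in \<open>'r list set\<close>.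
  Up to isomorphism, these include all \<open>R\<close>-modules having at most as many elements as this type,
  in particular all countably generated ones. By Auslander's theorem, the cyclic modules
  alone already determine the global dimension.
\<close>

definition gldim :: "('r, 'x) ring_scheme \<Rightarrow> enat" where
  "gldim R = (SUP M \<in> {M :: ('r, 'r list set) module. lmodule R M}. proj_dim R M)"


section \<open>Tor and Ext\<close>

text \<open>
  Homology in degree \<open>n\<close> of \<open>\<dots> \<rightarrow> C 2 \<rightarrow> C 1 \<rightarrow> C 0 \<rightarrow> 0\<close> with \<open>d n : C (n + 1) \<rightarrow> C n\<close>, and
  cohomology in degree \<open>n\<close> of \<open>0 \<rightarrow> C 0 \<rightarrow> C 1 \<rightarrow> \<dots>\<close> with \<open>d n : C n \<rightarrow> C (n + 1)\<close>.
\<close>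

definition homology :: "(nat \<Rightarrow> 'c monoid) \<Rightarrow> (nat \<Rightarrow> 'c \<Rightarrow> 'c) \<Rightarrow> nat \<Rightarrow> 'c set monoid" where
  "homology C d n =
     (C n)\<lparr>carrier := (case n of 0 \<Rightarrow> carrier (C 0) | Suc m \<Rightarrow> kernel (C n) (C m) (d m))\<rparr>
       Mod (d n ` carrier (C (Suc n)))"

definition cohomology :: "(nat \<Rightarrow> 'c monoid) \<Rightarrow> (nat \<Rightarrow> 'c \<Rightarrow> 'c) \<Rightarrow> nat \<Rightarrow> 'c set monoid" where
  "cohomology C d n =
     (C n)\<lparr>carrier := kernel (C n) (C (Suc n)) (d n)\<rparr>
       Mod (case n of 0 \<Rightarrow> {\<one>\<^bsub>C 0\<^esub>} | Suc m \<Rightarrow> d m ` carrier (C m))"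

definition hom_group ::
  "('r, 'x) ring_scheme \<Rightarrow> ('r, 'm, 'y) module_scheme \<Rightarrow> ('r, 'n, 'z) module_scheme
     \<Rightarrow> ('m \<Rightarrow> 'n) monoid" where
  "hom_group R M N = \<lparr>carrier = mod_hom R M N \<inter> extensional (carrier M),
     monoid.mult = (\<lambda>f g. \<lambda>x\<in>carrier M. f x \<oplus>\<^bsub>N\<^esub> g x), one = (\<lambda>x\<in>carrier M. \<zero>\<^bsub>N\<^esub>)\<rparr>"

definition chosen_resolution ::
  "('r, 'x) ring_scheme \<Rightarrow> ('r, 'm, 'y) module_scheme
     \<Rightarrow> (nat \<Rightarrow> ('r, ('r, 'm) res) module) \<times> (nat \<Rightarrow> ('r, 'm) res \<Rightarrow> ('r, 'm) res)
        \<times> (('r, 'm) res \<Rightarrow> 'm)" where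
  "chosen_resolution R M = (SOME (P, d, \<epsilon>). proj_resolution R M P d \<epsilon>)"

definition Tor ::
  "('r, 'x) ring_scheme \<Rightarrow> ('r, 'n, 'y) module_scheme \<Rightarrow> ('r, 'm, 'z) module_scheme \<Rightarrow> nat
     \<Rightarrow> ('n \<times> ('r, 'm) res \<Rightarrow>\<^sub>0 int) set set monoid" where
  "Tor R N M = (case chosen_resolution R M of (P, d, \<epsilon>) \<Rightarrow>
     homology (\<lambda>i. tensor_group R N (P i))
       (\<lambda>i. tensor_lift (tensor_group R N (P i)) (\<lambda>(n, p). pure_tensor R N (P i) n (d i p))))"

definition Ext ::
  "('r, 'x) ring_scheme \<Rightarrow> ('r, 'm, 'y) module_scheme \<Rightarrow> ('r, 'n, 'z) module_scheme \<Rightarrow> nat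
     \<Rightarrow> (('r, 'm) res \<Rightarrow> 'n) set monoid" where
  "Ext R M N = (case chosen_resolution R M of (P, d, \<epsilon>) \<Rightarrow>
     cohomology (\<lambda>i. hom_group R (P i) N) (\<lambda>i f. \<lambda>p\<in>carrier (P (Suc i)). f (d i p)))"


section \<open>Hochschild homology and cohomology\<close>

definition enveloping_algebra ::
  "('k, 'x) ring_scheme \<Rightarrow> ('k, 'a, 'y) module_scheme \<Rightarrow> ('k, ('a \<times> 'a \<Rightarrow>\<^sub>0 int) set) module" where
  "enveloping_algebra K A = tensor_algebra K A (op_ring A)"

text \<open>
  \<open>A\<close> as a left and as a right module over \<open>A \<otimes> A\<^sup>o\<^sup>p\<close>:
  \<open>(a \<otimes> b) x = a x b\<close> and \<open>x (a \<otimes> b) = b x a\<close>.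
\<close>

definition bimodule_left :: "('k, 'a, 'y) module_scheme \<Rightarrow> (('a \<times> 'a \<Rightarrow>\<^sub>0 int) set, 'a) module" where
  "bimodule_left A = \<lparr>carrier = carrier A, monoid.mult = monoid.mult A, one = \<one>\<^bsub>A\<^esub>, ring.zero = \<zero>\<^bsub>A\<^esub>, add = add A,
     smult = (\<lambda>u x. tensor_lift (add_monoid A) (\<lambda>(a, b). a \<otimes>\<^bsub>A\<^esub> x \<otimes>\<^bsub>A\<^esub> b) u)\<rparr>"

definition bimodule_right :: "('k, 'a, 'y) module_scheme \<Rightarrow> (('a \<times> 'a \<Rightarrow>\<^sub>0 int) set, 'a) module" where
  "bimodule_right A = \<lparr>carrier = carrier A, monoid.mult = monoid.mult A, one = \<one>\<^bsub>A\<^esub>, ring.zero = \<zero>\<^bsub>A\<^esub>, add = add A,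
     smult = (\<lambda>u x. tensor_lift (add_monoid A) (\<lambda>(a, b). b \<otimes>\<^bsub>A\<^esub> x \<otimes>\<^bsub>A\<^esub> a) u)\<rparr>"

definition HH_homology where
  "HH_homology K A = Tor (enveloping_algebra K A) (bimodule_right A) (bimodule_left A)"

definition HH_cohomology where
  "HH_cohomology K A = Ext (enveloping_algebra K A) (bimodule_left A) (bimodule_left A)"

text \<open>In \<^typ>\<open>enat\<close> the supremum of the empty set is \<open>0\<close>.\<close>

definition hh_dim :: "('k, 'x) ring_scheme \<Rightarrow> ('k, 'a, 'y) module_scheme \<Rightarrow> enat" where
  "hh_dim K A = Sup {enat n | n. \<not> trivial_group (HH_homology K A n)}"

definition hch_dim :: "('k, 'x) ring_scheme \<Rightarrow> ('k, 'a, 'y) module_scheme \<Rightarrow> enat" where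
  "hch_dim K A = Sup {enat n | n. \<not> trivial_group (HH_cohomology K A n)}"

end

theory Submission
  imports Defs "HOL-Library.Nat_Bijection"
begin

text \<open>
  Let \<open>J = J(A)\<close>, let \<open>P\<close> be a projective resolution of \<open>A\<close> over \<open>A\<^sup>e = A \<otimes> A\<^sup>o\<^sup>p\<close>, and let \<open>B\<close>
  be the image of \<open>P\<^sub>m\<^sub>+\<^sub>1\<close> in \<open>P\<^sub>m\<close>. It suffices to find, for one \<open>m\<close>, a bimodule retraction of
  \<open>P\<^sub>m\<close> onto \<open>B\<close>: from degree \<open>m\<close> on, \<open>P\<close> is then contractible, so that Tor and Ext vanish
  above degree \<open>m\<close>.

  As a complex of right modules \<open>P \<rightarrow> A\<close> splits. Hence \<open>P / P J\<close> is a resolution of the left module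
  \<open>A / J\<close>, it consists of projective left modules, and \<open>B \<inter> P\<^sub>m J = B J\<close>. As \<open>A / J\<close> has finite
  projective dimension, comparison with a finite resolution yields, for large \<open>m\<close>, a left linear
  retraction of \<open>P\<^sub>m / P\<^sub>m J\<close> onto \<open>B / B J\<close>. Averaging with a separability idempotent of \<open>A / J\<close>
  makes it a homomorphism of bimodules. It lifts to a bimodule homomorphism \<open>r : P\<^sub>m \<rightarrow> B\<close> with
  \<open>z - r z \<in> B J\<close> for \<open>z \<in> B\<close>. Since \<open>J\<close> is nilpotent, so is \<open>1 - r\<close> on \<open>B\<close>, and \<open>r\<close> can be corrected
  to a retraction.
\<close>

section \<open>Modules over a ring\<close>

text \<open>The resolution inside Tor and Ext is an arbitrary choice: neither minimality nor finite
  generation nor finite length is available, so the argument must work for every projective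
  resolution and cannot count dimensions in it. The radical is divided out on one side only. On
  \<open>P / P J\<close> the right action is one of \<open>A / J\<close>, which is what averaging
  asks for, while the left action is still that of \<open>A\<close>, so that \<open>gldim A\<close>
  can be applied. The price is that exactness has to survive the quotient. This is where the
  right-hand splitting enters: \<open>B\<close> is a direct summand of \<open>P\<^sub>m\<close> as a
  right module, which gives \<open>B \<inter> P\<^sub>m J = B J\<close> and with it exactness.
  Projectivity is inherited from \<open>A\<^sup>e\<close>: it is free as a right module on a basis
  of \<open>A\<close>, and modulo \<open>J\<close> on the right it becomes
  \<open>A \<otimes> (A / J)\<close>, free on the left on a basis of \<open>A / J\<close>. The lift
  of the averaged map exists because \<open>P\<^sub>m\<close> is projective over
  \<open>A\<^sup>e\<close> and \<open>B\<close> maps onto \<open>B / B J\<close>.\<close>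

context abelian_group
begin

lemma minus_self [simp]: "x \<in> carrier G \<Longrightarrow> x \<ominus> x = \<zero>"
  by (simp add: a_minus_def r_neg)

lemma minus_zero_right [simp]: "x \<in> carrier G \<Longrightarrow> x \<ominus> \<zero> = x"
  by (simp add: a_minus_def)

lemma minus_add_cancel [simp]: "\<lbrakk>x \<in> carrier G; y \<in> carrier G\<rbrakk> \<Longrightarrow> x \<ominus> y \<oplus> y = x"
  by (simp add: a_minus_def a_assoc l_neg)

lemma minus_eq_zero_iff:
  assumes "x \<in> carrier G" "y \<in> carrier G"
  shows "x \<ominus> y = \<zero> \<longleftrightarrow> x = y"
  by (metis assms l_zero minus_add_cancel minus_self)

lemma minus_minus_cancel:
  assumes "x \<in> carrier G" "y \<in> carrier G" "z \<in> carrier G"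
  shows "(x \<ominus> z) \<ominus> (y \<ominus> z) = x \<ominus> y"
proof -
  have "(x \<ominus> z) \<ominus> (y \<ominus> z) = (x \<oplus> \<ominus> y) \<oplus> (\<ominus> z \<oplus> z)"
    using assms by (simp add: a_minus_def minus_add a_ac)
  then show ?thesis using assms by (simp add: a_minus_def l_neg)
qed

lemma add_minus_cancel:
  assumes "x \<in> carrier G" "y \<in> carrier G"
  shows "(x \<oplus> y) \<ominus> x = y"
proof -
  have "(x \<oplus> y) \<ominus> x = y \<oplus> (x \<oplus> \<ominus> x)"
    using assms by (simp add: a_minus_def a_ac)
  then show ?thesis using assms by (simp add: r_neg)
qed

lemma add_minus_add_cancel:
  assumes "x \<in> carrier G" "y \<in> carrier G" "z \<in> carrier G"
  shows "(x \<oplus> y) \<ominus> (x \<oplus> z) = y \<ominus> z"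
proof -
  have "(x \<oplus> y) \<ominus> (x \<oplus> z) = (x \<oplus> \<ominus> x) \<oplus> (y \<oplus> \<ominus> z)"
    using assms by (simp add: a_minus_def minus_add a_ac)
  then show ?thesis using assms by (simp add: r_neg a_minus_def)
qed

lemma minus_minus_left_cancel:
  assumes "x \<in> carrier G" "y \<in> carrier G" "z \<in> carrier G"
  shows "(x \<ominus> y) \<ominus> (x \<ominus> z) = z \<ominus> y"
proof -
  have "(x \<ominus> y) \<ominus> (x \<ominus> z) = (x \<oplus> \<ominus> x) \<oplus> (z \<oplus> \<ominus> y)"
    using assms by (simp add: a_minus_def minus_add a_ac)
  then show ?thesis using assms by (simp add: r_neg a_minus_def)
qed

end

context lmodule
begin

lemma smult_l_null [simp]: "x \<in> carrier M \<Longrightarrow> \<zero>\<^bsub>R\<^esub> \<odot>\<^bsub>M\<^esub> x = \<zero>\<^bsub>M\<^esub>"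
  by (metis M.add.l_cancel_one R.zero_closed R.r_zero smult_closed smult_l_distr)

lemma smult_r_null [simp]: "r \<in> carrier R \<Longrightarrow> r \<odot>\<^bsub>M\<^esub> \<zero>\<^bsub>M\<^esub> = \<zero>\<^bsub>M\<^esub>"
  by (metis M.add.l_cancel_one M.zero_closed M.r_zero smult_closed smult_r_distr)

lemma smult_l_minus: "\<lbrakk>r \<in> carrier R; x \<in> carrier M\<rbrakk> \<Longrightarrow> (\<ominus>\<^bsub>R\<^esub> r) \<odot>\<^bsub>M\<^esub> x = \<ominus>\<^bsub>M\<^esub> (r \<odot>\<^bsub>M\<^esub> x)"
  by (metis M.minus_equality R.add.inv_closed R.l_neg smult_closed smult_l_distr smult_l_null)

lemma smult_r_minus: "\<lbrakk>r \<in> carrier R; x \<in> carrier M\<rbrakk> \<Longrightarrow> r \<odot>\<^bsub>M\<^esub> (\<ominus>\<^bsub>M\<^esub> x) = \<ominus>\<^bsub>M\<^esub> (r \<odot>\<^bsub>M\<^esub> x)"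
  by (metis M.minus_equality M.add.inv_closed M.l_neg smult_closed smult_r_distr smult_r_null)

lemma smult_finsum:
  "\<lbrakk>finite I; r \<in> carrier R; f \<in> I \<rightarrow> carrier M\<rbrakk>
    \<Longrightarrow> r \<odot>\<^bsub>M\<^esub> finsum M f I = finsum M (\<lambda>i. r \<odot>\<^bsub>M\<^esub> f i) I"
  by (induction I rule: finite_induct) (auto simp: Pi_def smult_closed smult_r_distr)

lemma submodule_carrier [simp]: "submodule (carrier M) R M"
  by unfold_locales (auto simp: smult_closed simp flip: a_inv_def)

lemma submoduleI:
  assumes "U \<subseteq> carrier M" "\<zero>\<^bsub>M\<^esub> \<in> U"
    and "\<And>x y. \<lbrakk>x \<in> U; y \<in> U\<rbrakk> \<Longrightarrow> x \<oplus>\<^bsub>M\<^esub> y \<in> U"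
    and sm: "\<And>r x. \<lbrakk>r \<in> carrier R; x \<in> U\<rbrakk> \<Longrightarrow> r \<odot>\<^bsub>M\<^esub> x \<in> U"
  shows "submodule U R M"
proof -
  have "\<ominus>\<^bsub>M\<^esub> x \<in> U" if "x \<in> U" for x
    using sm[of "\<ominus>\<^bsub>R\<^esub> \<one>\<^bsub>R\<^esub>" x] that assms(1) by (auto simp: smult_l_minus smult_one)
  then show ?thesis
    by unfold_locales (use assms in \<open>auto simp flip: a_inv_def\<close>)
qed

lemma submoduleD:
  assumes "submodule U R M"
  shows "U \<subseteq> carrier M" "\<zero>\<^bsub>M\<^esub> \<in> U"
    "\<And>x y. \<lbrakk>x \<in> U; y \<in> U\<rbrakk> \<Longrightarrow> x \<oplus>\<^bsub>M\<^esub> y \<in> U"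
    "\<And>x. x \<in> U \<Longrightarrow> \<ominus>\<^bsub>M\<^esub> x \<in> U"
    "\<And>x y. \<lbrakk>x \<in> U; y \<in> U\<rbrakk> \<Longrightarrow> x \<ominus>\<^bsub>M\<^esub> y \<in> U"
    "\<And>r x. \<lbrakk>r \<in> carrier R; x \<in> U\<rbrakk> \<Longrightarrow> r \<odot>\<^bsub>M\<^esub> x \<in> U"
proof -
  interpret U: submodule U R M by fact
  show "U \<subseteq> carrier M" using U.subset by simp
  show "\<zero>\<^bsub>M\<^esub> \<in> U" using U.one_closed by simp
  show ad: "x \<oplus>\<^bsub>M\<^esub> y \<in> U" if "x \<in> U" "y \<in> U" for x y using U.m_closed that by simp
  show mi: "\<ominus>\<^bsub>M\<^esub> x \<in> U" if "x \<in> U" for x using U.m_inv_closed that by (simp add: a_inv_def)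
  show "x \<ominus>\<^bsub>M\<^esub> y \<in> U" if "x \<in> U" "y \<in> U" for x y using ad mi that by (simp add: a_minus_def)
  show "r \<odot>\<^bsub>M\<^esub> x \<in> U" if "r \<in> carrier R" "x \<in> U" for r x using that by (rule U.smult_closed)
qed

lemma submodule_finsum:
  assumes "submodule U R M" "finite I" "f \<in> I \<rightarrow> U"
  shows "finsum M f I \<in> U"
proof -
  note U = submoduleD[OF assms(1)]
  have "finsum M f I \<in> U" if "f ` I \<subseteq> U"
    using assms(2) that
  proof (induction I rule: finite_induct)
    case (insert i I)
    then have "f \<in> I \<rightarrow> carrier M" "f i \<in> carrier M" using U(1) by auto
    with insert show ?case using U(3) by simp
  qed (use U(2) in simp)
  then show ?thesis using assms(3) by blast
qed

lemma lmodule_restrict_carrier: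
  assumes "submodule U R M"
  shows "lmodule R (M\<lparr>carrier := U\<rparr>)"
proof -
  note U = submoduleD[OF assms]
  have "abelian_group (M\<lparr>carrier := U\<rparr>)"
    by (rule abelian_groupI) (use U in \<open>auto simp: subset_iff M.a_ac intro!: bexI[of _ "\<ominus>\<^bsub>M\<^esub> _"] M.r_neg\<close>)
  then interpret U: abelian_group "M\<lparr>carrier := U\<rparr>" .
  show ?thesis
    by unfold_locales (use U in \<open>auto simp: subset_iff smult_l_distr smult_r_distr smult_assoc smult_one\<close>)
qed

end

lemma lmoduleI:
  assumes "ring R" "abelian_group M"
    and "\<And>r x. \<lbrakk>r \<in> carrier R; x \<in> carrier M\<rbrakk> \<Longrightarrow> r \<odot>\<^bsub>M\<^esub> x \<in> carrier M"
    and "\<And>r s x. \<lbrakk>r \<in> carrier R; s \<in> carrier R; x \<in> carrier M\<rbrakk>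
      \<Longrightarrow> (r \<oplus>\<^bsub>R\<^esub> s) \<odot>\<^bsub>M\<^esub> x = r \<odot>\<^bsub>M\<^esub> x \<oplus>\<^bsub>M\<^esub> s \<odot>\<^bsub>M\<^esub> x"
    and "\<And>r x y. \<lbrakk>r \<in> carrier R; x \<in> carrier M; y \<in> carrier M\<rbrakk>
      \<Longrightarrow> r \<odot>\<^bsub>M\<^esub> (x \<oplus>\<^bsub>M\<^esub> y) = r \<odot>\<^bsub>M\<^esub> x \<oplus>\<^bsub>M\<^esub> r \<odot>\<^bsub>M\<^esub> y"
    and "\<And>r s x. \<lbrakk>r \<in> carrier R; s \<in> carrier R; x \<in> carrier M\<rbrakk>
      \<Longrightarrow> (r \<otimes>\<^bsub>R\<^esub> s) \<odot>\<^bsub>M\<^esub> x = r \<odot>\<^bsub>M\<^esub> (s \<odot>\<^bsub>M\<^esub> x)"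
    and "\<And>x. x \<in> carrier M \<Longrightarrow> \<one>\<^bsub>R\<^esub> \<odot>\<^bsub>M\<^esub> x = x"
  shows "lmodule R M"
  using assms by (simp add: lmodule_def lmodule_axioms_def)

lemma regular_module_simps [simp]:
  "carrier (regular_module R) = carrier R" "\<zero>\<^bsub>regular_module R\<^esub> = \<zero>\<^bsub>R\<^esub>"
  "add (regular_module R) = add R" "smult (regular_module R) = monoid.mult R"
  by (simp_all add: regular_module_def)

lemma op_ring_simps [simp]:
  "carrier (op_ring R) = carrier R" "\<zero>\<^bsub>op_ring R\<^esub> = \<zero>\<^bsub>R\<^esub>" "\<one>\<^bsub>op_ring R\<^esub> = \<one>\<^bsub>R\<^esub>"
  "add (op_ring R) = add R" "x \<otimes>\<^bsub>op_ring R\<^esub> y = y \<otimes>\<^bsub>R\<^esub> x"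
  by (simp_all add: op_ring_def)

lemma abelian_group_cong:
  assumes "abelian_group G" "carrier H = carrier G" "add H = add G" "\<zero>\<^bsub>H\<^esub> = \<zero>\<^bsub>G\<^esub>"
  shows "abelian_group H"
proof -
  interpret abelian_group G by fact
  show ?thesis
    by (rule abelian_groupI) (use assms(2-) in \<open>auto simp: a_ac intro: l_neg\<close>)
qed

lemma a_inv_cong:
  assumes "carrier H = carrier G" "add H = add G" "\<zero>\<^bsub>H\<^esub> = \<zero>\<^bsub>G\<^esub>"
  shows "a_inv H = a_inv G" "a_minus H = a_minus G"
  using assms by (auto simp: a_inv_def m_inv_def a_minus_def fun_eq_iff)

lemma finsum_cong_group:
  assumes "carrier H = carrier G" "add H = add G" "\<zero>\<^bsub>H\<^esub> = \<zero>\<^bsub>G\<^esub>"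
  shows "finsum H = finsum G"
  by (intro ext) (simp add: assms finsum_def finprod_def)

lemma ring_op_ring:
  assumes "ring R"
  shows "ring (op_ring R)"
proof -
  interpret ring R by fact
  have ab: "abelian_group (op_ring R)"
    by (rule abelian_group_cong[OF is_abelian_group]) auto
  have "monoid (op_ring R)"
    by (rule monoidI) (auto simp: m_assoc)
  then show ?thesis using ab
    by (intro ringI) (auto simp: l_distr r_distr)
qed

lemma lmodule_regular:
  assumes "ring R"
  shows "lmodule R (regular_module R)"
proof -
  interpret ring R by fact
  have "abelian_group (regular_module R)"
    by (rule abelian_group_cong[OF is_abelian_group]) auto
  then show ?thesis
    by (intro lmoduleI ring_axioms) (auto simp: l_distr r_distr m_assoc)
qed

subsection \<open>Module homomorphisms\<close>

lemma mod_homI: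
  assumes "\<And>x. x \<in> carrier M \<Longrightarrow> h x \<in> carrier N"
    and "\<And>x y. \<lbrakk>x \<in> carrier M; y \<in> carrier M\<rbrakk> \<Longrightarrow> h (x \<oplus>\<^bsub>M\<^esub> y) = h x \<oplus>\<^bsub>N\<^esub> h y"
    and "\<And>r x. \<lbrakk>r \<in> carrier R; x \<in> carrier M\<rbrakk> \<Longrightarrow> h (r \<odot>\<^bsub>M\<^esub> x) = r \<odot>\<^bsub>N\<^esub> h x"
  shows "h \<in> mod_hom R M N"
  using assms by (auto simp: mod_hom_def hom_def)

lemma mod_homD:
  assumes "h \<in> mod_hom R M N"
  shows mod_hom_closed: "x \<in> carrier M \<Longrightarrow> h x \<in> carrier N"
    and mod_hom_add: "\<lbrakk>x \<in> carrier M; y \<in> carrier M\<rbrakk> \<Longrightarrow> h (x \<oplus>\<^bsub>M\<^esub> y) = h x \<oplus>\<^bsub>N\<^esub> h y"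
    and mod_hom_smult: "\<lbrakk>r \<in> carrier R; x \<in> carrier M\<rbrakk> \<Longrightarrow> h (r \<odot>\<^bsub>M\<^esub> x) = r \<odot>\<^bsub>N\<^esub> h x"
  using assms by (auto simp: mod_hom_def hom_def)

lemma additive_zero:
  assumes "abelian_group M" "abelian_group N"
    and "\<And>x. x \<in> carrier M \<Longrightarrow> h x \<in> carrier N"
    and "\<And>x y. \<lbrakk>x \<in> carrier M; y \<in> carrier M\<rbrakk> \<Longrightarrow> h (x \<oplus>\<^bsub>M\<^esub> y) = h x \<oplus>\<^bsub>N\<^esub> h y"
  shows "h \<zero>\<^bsub>M\<^esub> = \<zero>\<^bsub>N\<^esub>"
proof -
  interpret M: abelian_group M by fact
  interpret N: abelian_group N by fact
  show ?thesis
    by (metis M.l_zero M.zero_closed N.add.l_cancel_one assms(3,4))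
qed

lemma additive_minus:
  assumes "abelian_group M" "abelian_group N"
    and "\<And>x. x \<in> carrier M \<Longrightarrow> h x \<in> carrier N"
    and "\<And>x y. \<lbrakk>x \<in> carrier M; y \<in> carrier M\<rbrakk> \<Longrightarrow> h (x \<oplus>\<^bsub>M\<^esub> y) = h x \<oplus>\<^bsub>N\<^esub> h y"
  shows "x \<in> carrier M \<Longrightarrow> h (\<ominus>\<^bsub>M\<^esub> x) = \<ominus>\<^bsub>N\<^esub> h x"
    and "\<lbrakk>x \<in> carrier M; y \<in> carrier M\<rbrakk> \<Longrightarrow> h (x \<ominus>\<^bsub>M\<^esub> y) = h x \<ominus>\<^bsub>N\<^esub> h y"
proof -
  interpret M: abelian_group M by fact
  interpret N: abelian_group N by fact
  show *: "h (\<ominus>\<^bsub>M\<^esub> x) = \<ominus>\<^bsub>N\<^esub> h x" if "x \<in> carrier M" for x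
    by (metis M.add.inv_closed M.l_neg N.minus_equality additive_zero[OF assms] assms(3,4) that)
  show "h (x \<ominus>\<^bsub>M\<^esub> y) = h x \<ominus>\<^bsub>N\<^esub> h y" if "x \<in> carrier M" "y \<in> carrier M"
    using that * assms(4) by (simp add: a_minus_def)
qed

lemma mod_hom_zero:
  assumes "lmodule R M" "lmodule R N" "h \<in> mod_hom R M N"
  shows "h \<zero>\<^bsub>M\<^esub> = \<zero>\<^bsub>N\<^esub>"
  using additive_zero[of M N h] assms mod_homD[OF assms(3)] by (simp add: lmodule_def)

lemma mod_hom_minus:
  assumes "lmodule R M" "lmodule R N" "h \<in> mod_hom R M N"
  shows "x \<in> carrier M \<Longrightarrow> h (\<ominus>\<^bsub>M\<^esub> x) = \<ominus>\<^bsub>N\<^esub> h x"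
    and "\<lbrakk>x \<in> carrier M; y \<in> carrier M\<rbrakk> \<Longrightarrow> h (x \<ominus>\<^bsub>M\<^esub> y) = h x \<ominus>\<^bsub>N\<^esub> h y"
  using additive_minus[of M N h] assms mod_homD[OF assms(3)] by (simp_all add: lmodule_def)

lemma mod_hom_finsum:
  assumes "lmodule R M" "lmodule R N" "h \<in> mod_hom R M N" "finite I" "f \<in> I \<rightarrow> carrier M"
  shows "h (finsum M f I) = finsum N (\<lambda>i. h (f i)) I"
proof -
  interpret M: lmodule R M by fact
  interpret N: lmodule R N by fact
  note h = mod_homD[OF assms(3)]
  show ?thesis using assms(4,5)
    by (induction I rule: finite_induct)
      (auto simp: Pi_def h mod_hom_zero[OF assms(1-3)])
qed

lemma mod_hom_id: "(\<lambda>x. x) \<in> mod_hom R M M"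
  by (auto intro: mod_homI)

lemma mod_hom_compose:
  assumes "f \<in> mod_hom R M N" "g \<in> mod_hom R N Q"
  shows "(\<lambda>x. g (f x)) \<in> mod_hom R M Q"
  by (intro mod_homI) (simp_all add: mod_homD[OF assms(1)] mod_homD[OF assms(2)])

lemma mod_hom_zero_map:
  assumes "lmodule R N"
  shows "(\<lambda>x. \<zero>\<^bsub>N\<^esub>) \<in> mod_hom R M N"
proof -
  interpret lmodule R N by fact
  show ?thesis by (intro mod_homI) auto
qed

lemma mod_hom_plus:
  assumes "lmodule R N" "f \<in> mod_hom R M N" "g \<in> mod_hom R M N"
  shows "(\<lambda>x. f x \<oplus>\<^bsub>N\<^esub> g x) \<in> mod_hom R M N"
proof -
  interpret lmodule R N by fact
  note [simp] = mod_homD[OF assms(2)] mod_homD[OF assms(3)]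
  show ?thesis by (intro mod_homI) (auto simp: smult_r_distr M.a_ac)
qed

lemma mod_hom_diff:
  assumes "lmodule R N" "f \<in> mod_hom R M N" "g \<in> mod_hom R M N"
  shows "(\<lambda>x. f x \<ominus>\<^bsub>N\<^esub> g x) \<in> mod_hom R M N"
proof -
  interpret lmodule R N by fact
  note [simp] = mod_homD[OF assms(2)] mod_homD[OF assms(3)]
  show ?thesis
    by (intro mod_homI)
      (auto simp: smult_r_distr M.a_ac a_minus_def M.minus_add smult_r_minus)
qed

lemma submodule_kernel:
  assumes "lmodule R M" "lmodule R N" "h \<in> mod_hom R M N"
  shows "submodule {x \<in> carrier M. h x = \<zero>\<^bsub>N\<^esub>} R M"
proof -
  interpret M: lmodule R M by fact
  interpret N: lmodule R N by fact
  show ?thesis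
    by (rule M.submoduleI)
      (auto simp: mod_homD[OF assms(3)] mod_hom_zero[OF assms] M.smult_closed)
qed

lemma submodule_image:
  assumes "lmodule R M" "lmodule R N" "h \<in> mod_hom R M N"
  shows "submodule (h ` carrier M) R N"
proof -
  interpret M: lmodule R M by fact
  interpret N: lmodule R N by fact
  note h = mod_homD[OF assms(3)]
  show ?thesis
  proof (rule N.submoduleI)
    show "\<zero>\<^bsub>N\<^esub> \<in> h ` carrier M"
      using mod_hom_zero[OF assms] M.zero_closed by (metis image_eqI)
    show "x \<oplus>\<^bsub>N\<^esub> y \<in> h ` carrier M" if "x \<in> h ` carrier M" "y \<in> h ` carrier M" for x y
      using that by (auto simp: h(2)[symmetric])
    show "r \<odot>\<^bsub>N\<^esub> x \<in> h ` carrier M" if "r \<in> carrier R" "x \<in> h ` carrier M" for r x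
      using that by (auto simp: h(3)[symmetric] M.smult_closed)
  qed (auto simp: h)
qed

subsection \<open>Quotients\<close>

text \<open>
  A quotient of \<open>M\<close> whose elements are the values of a map \<open>p\<close> on \<open>M\<close> that separates exactly the
  cosets of a submodule.
\<close>

definition image_module :: "('r, 'm, 'y) module_scheme \<Rightarrow> ('m \<Rightarrow> 'n) \<Rightarrow> ('r, 'n) module" where
  "image_module M p = \<lparr>carrier = p ` carrier M, monoid.mult = undefined, one = undefined,
     ring.zero = p \<zero>\<^bsub>M\<^esub>,
     add = (\<lambda>u v. p (inv_into (carrier M) p u \<oplus>\<^bsub>M\<^esub> inv_into (carrier M) p v)),
     smult = (\<lambda>r u. p (r \<odot>\<^bsub>M\<^esub> inv_into (carrier M) p u))\<rparr>"

locale module_quotient = lmodule R M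
  for R :: "('r, 'x) ring_scheme" and M :: "('r, 'm, 'y) module_scheme" +
  fixes U :: "'m set" and p :: "'m \<Rightarrow> 'n"
  assumes U: "submodule U R M"
    and p_eq_iff: "\<lbrakk>x \<in> carrier M; y \<in> carrier M\<rbrakk> \<Longrightarrow> p x = p y \<longleftrightarrow> x \<ominus>\<^bsub>M\<^esub> y \<in> U"
begin

abbreviation "Q \<equiv> image_module M p"

lemma carrier_Q [simp]: "carrier Q = p ` carrier M"
  by (simp add: image_module_def)

lemma p_closed [simp]: "x \<in> carrier M \<Longrightarrow> p x \<in> carrier Q"
  by simp

lemma zero_Q: "\<zero>\<^bsub>Q\<^esub> = p \<zero>\<^bsub>M\<^esub>"
  by (simp add: image_module_def)

lemma rep:
  assumes "x \<in> carrier M"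
  shows "inv_into (carrier M) p (p x) \<in> carrier M" "inv_into (carrier M) p (p x) \<ominus>\<^bsub>M\<^esub> x \<in> U"
  using assms p_eq_iff[of "inv_into (carrier M) p (p x)" x]
  by (auto simp: inv_into_into f_inv_into_f)

lemma p_add:
  assumes "x \<in> carrier M" "y \<in> carrier M"
  shows "p (x \<oplus>\<^bsub>M\<^esub> y) = p x \<oplus>\<^bsub>Q\<^esub> p y"
proof -
  let ?x = "inv_into (carrier M) p (p x)" and ?y = "inv_into (carrier M) p (p y)"
  note r = rep[OF assms(1)] rep[OF assms(2)]
  have "(?x \<oplus>\<^bsub>M\<^esub> ?y) \<ominus>\<^bsub>M\<^esub> (x \<oplus>\<^bsub>M\<^esub> y) = (?x \<ominus>\<^bsub>M\<^esub> x) \<oplus>\<^bsub>M\<^esub> (?y \<ominus>\<^bsub>M\<^esub> y)"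
    using r assms by (simp add: a_minus_def M.minus_add M.a_ac)
  then have "p (?x \<oplus>\<^bsub>M\<^esub> ?y) = p (x \<oplus>\<^bsub>M\<^esub> y)"
    using r assms by (subst p_eq_iff) (auto intro: submoduleD(3)[OF U])
  then show ?thesis
    by (simp add: image_module_def)
qed

lemma p_smult:
  assumes "r \<in> carrier R" "x \<in> carrier M"
  shows "p (r \<odot>\<^bsub>M\<^esub> x) = r \<odot>\<^bsub>Q\<^esub> p x"
proof -
  let ?x = "inv_into (carrier M) p (p x)"
  note r = rep[OF assms(2)]
  have "r \<odot>\<^bsub>M\<^esub> ?x \<ominus>\<^bsub>M\<^esub> r \<odot>\<^bsub>M\<^esub> x = r \<odot>\<^bsub>M\<^esub> (?x \<ominus>\<^bsub>M\<^esub> x)"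
    using r assms by (simp add: a_minus_def smult_r_distr smult_r_minus)
  then have "p (r \<odot>\<^bsub>M\<^esub> ?x) = p (r \<odot>\<^bsub>M\<^esub> x)"
    using r assms by (subst p_eq_iff) (auto intro: submoduleD(6)[OF U] smult_closed)
  then show ?thesis
    by (simp add: image_module_def)
qed

lemma lmodule_Q: "lmodule R Q"
proof -
  have "abelian_group Q"
  proof (rule abelian_groupI)
    fix u assume "u \<in> carrier Q"
    then obtain x where "x \<in> carrier M" "u = p x" by auto
    then show "\<exists>v\<in>carrier Q. v \<oplus>\<^bsub>Q\<^esub> u = \<zero>\<^bsub>Q\<^esub>"
      by (intro bexI[of _ "p (\<ominus>\<^bsub>M\<^esub> x)"]) (auto simp: p_add[symmetric] M.l_neg zero_Q)
  qed (auto simp: p_add[symmetric] zero_Q M.a_ac)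
  then show ?thesis
    by (intro lmoduleI R.ring_axioms)
      (auto simp: p_add[symmetric] p_smult[symmetric] smult_closed smult_l_distr smult_r_distr
        smult_assoc smult_one)
qed

lemma p_hom: "p \<in> mod_hom R M Q"
  by (intro mod_homI) (auto simp: p_add p_smult)

lemma p_eq_zero_iff: "x \<in> carrier M \<Longrightarrow> p x = \<zero>\<^bsub>Q\<^esub> \<longleftrightarrow> x \<in> U"
  by (simp add: zero_Q p_eq_iff)

lemma factor_hom:
  assumes "lmodule R N" "h \<in> mod_hom R M N" "\<And>x. x \<in> U \<Longrightarrow> h x = \<zero>\<^bsub>N\<^esub>"
  obtains h' where "h' \<in> mod_hom R Q N" "\<And>x. x \<in> carrier M \<Longrightarrow> h' (p x) = h x"
proof
  interpret N: lmodule R N by fact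
  let ?h = "\<lambda>u. h (inv_into (carrier M) p u)"
  note hm = mod_homD[OF assms(2)]
  show *: "?h (p x) = h x" if "x \<in> carrier M" for x
  proof -
    let ?x = "inv_into (carrier M) p (p x)"
    note r = rep[OF that]
    have "h ?x \<ominus>\<^bsub>N\<^esub> h x = \<zero>\<^bsub>N\<^esub>"
      using r that assms(3) mod_hom_minus[OF lmodule_axioms assms(1,2)] by metis
    then show ?thesis using r that hm by (simp add: N.M.minus_eq_zero_iff)
  qed
  show "?h \<in> mod_hom R Q N"
    by (rule mod_homI)
      (auto simp: p_add[symmetric] p_smult[symmetric] smult_closed * hm)
qed

end

text \<open>A chosen representative stands for its coset, so the quotient keeps the element type of
  \<open>M\<close>. For \<open>A / J\<close> this makes the passage to the type over which
  \<open>gldim\<close> ranges immediate.\<close>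

lemma (in lmodule) module_quotient_exists:
  assumes U: "submodule U R M"
  obtains p :: "'m \<Rightarrow> 'm" where "module_quotient R M U p"
proof
  let ?p = "\<lambda>x. SOME y. y \<in> carrier M \<and> x \<ominus>\<^bsub>M\<^esub> y \<in> U"
  note UD = submoduleD[OF U]
  show "module_quotient R M U ?p"
  proof (intro module_quotient.intro lmodule_axioms module_quotient_axioms.intro U)
    fix x y assume x: "x \<in> carrier M" and y: "y \<in> carrier M"
    have s: "?p z \<in> carrier M \<and> z \<ominus>\<^bsub>M\<^esub> ?p z \<in> U" if "z \<in> carrier M" for z
      by (rule someI[where P = "\<lambda>y. y \<in> carrier M \<and> z \<ominus>\<^bsub>M\<^esub> y \<in> U" and x = z])
        (use that UD(2) in simp)
    show "?p x = ?p y \<longleftrightarrow> x \<ominus>\<^bsub>M\<^esub> y \<in> U"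
    proof
      assume eq: "?p x = ?p y"
      have "x \<ominus>\<^bsub>M\<^esub> y = (x \<ominus>\<^bsub>M\<^esub> ?p x) \<ominus>\<^bsub>M\<^esub> (y \<ominus>\<^bsub>M\<^esub> ?p x)"
        using s[OF x] x y by (simp add: M.minus_minus_cancel)
      then show "x \<ominus>\<^bsub>M\<^esub> y \<in> U" using s[OF x] s[OF y] eq UD(5) by simp
    next
      assume xy: "x \<ominus>\<^bsub>M\<^esub> y \<in> U"
      \<comment> \<open>Congruent elements define the same predicate of \<open>z\<close>, so the
        choice operator returns the same representative for both.\<close>
      have "x \<ominus>\<^bsub>M\<^esub> z \<in> U \<longleftrightarrow> y \<ominus>\<^bsub>M\<^esub> z \<in> U" if z: "z \<in> carrier M" for z
      proof -
        have "x \<ominus>\<^bsub>M\<^esub> z = (x \<ominus>\<^bsub>M\<^esub> y) \<oplus>\<^bsub>M\<^esub> (y \<ominus>\<^bsub>M\<^esub> z)"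
          using x y z by (simp add: a_minus_def M.a_ac M.r_neg1 M.r_neg2)
        moreover have "y \<ominus>\<^bsub>M\<^esub> z = (x \<ominus>\<^bsub>M\<^esub> z) \<ominus>\<^bsub>M\<^esub> (x \<ominus>\<^bsub>M\<^esub> y)"
          using x y z by (simp add: a_minus_def M.minus_add M.a_ac M.r_neg1 M.r_neg2)
        ultimately show ?thesis using xy UD by metis
      qed
      then show "?p x = ?p y"
        by (metis (no_types, lifting))
    qed
  qed
qed

section \<open>Free and projective modules\<close>

lemma free_module_simps [simp]:
  "\<zero>\<^bsub>free_module R X\<^esub> = (\<lambda>x. \<zero>\<^bsub>R\<^esub>)" "add (free_module R X) = (\<lambda>f g x. f x \<oplus>\<^bsub>R\<^esub> g x)"
  "smult (free_module R X) = (\<lambda>r f x. r \<otimes>\<^bsub>R\<^esub> f x)"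
  by (simp_all add: free_module_def)

definition basis_vector :: "('r, 'x) ring_scheme \<Rightarrow> 'g \<Rightarrow> 'g \<Rightarrow> 'r" where
  "basis_vector R x = (\<lambda>y. if y = x then \<one>\<^bsub>R\<^esub> else \<zero>\<^bsub>R\<^esub>)"

definition free_lift ::
  "('r, 'x) ring_scheme \<Rightarrow> ('r, 'm, 'y) module_scheme \<Rightarrow> ('g \<Rightarrow> 'm) \<Rightarrow> ('g \<Rightarrow> 'r) \<Rightarrow> 'm" where
  "free_lift R M v f = finsum M (\<lambda>x. f x \<odot>\<^bsub>M\<^esub> v x) {x. f x \<noteq> \<zero>\<^bsub>R\<^esub>}"

context ring
begin

lemma free_module_carrier:
  "f \<in> carrier (free_module R X) \<longleftrightarrow>
     (\<forall>x. f x \<in> carrier R) \<and> (\<forall>x. x \<notin> X \<longrightarrow> f x = \<zero>) \<and> finite {x. f x \<noteq> \<zero>}"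
  unfolding free_module_def using zero_closed by (simp; metis)

lemma free_module_plus_closed:
  assumes "f \<in> carrier (free_module R X)" "g \<in> carrier (free_module R X)"
  shows "(\<lambda>x. f x \<oplus> g x) \<in> carrier (free_module R X)"
proof -
  have "{x. f x \<oplus> g x \<noteq> \<zero>} \<subseteq> {x. f x \<noteq> \<zero>} \<union> {x. g x \<noteq> \<zero>}" by auto
  then have "finite {x. f x \<oplus> g x \<noteq> \<zero>}"
    by (rule finite_subset) (use assms in \<open>auto simp: free_module_carrier\<close>)
  then show ?thesis using assms by (auto simp: free_module_carrier)
qed

lemma free_module_smult_closed:
  assumes "r \<in> carrier R" "g \<in> carrier (free_module R X)"
  shows "(\<lambda>x. r \<otimes> g x) \<in> carrier (free_module R X)"
proof -
  have "{x. r \<otimes> g x \<noteq> \<zero>} \<subseteq> {x. g x \<noteq> \<zero>}" using assms by auto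
  then have "finite {x. r \<otimes> g x \<noteq> \<zero>}"
    by (rule finite_subset) (use assms in \<open>auto simp: free_module_carrier\<close>)
  then show ?thesis using assms by (auto simp: free_module_carrier)
qed

lemma lmodule_free: "lmodule R (free_module R X)"
proof (intro lmoduleI ring_axioms abelian_groupI)
  fix f assume f: "f \<in> carrier (free_module R X)"
  have "(\<lambda>x. \<ominus> \<one> \<otimes> f x) \<in> carrier (free_module R X)"
    by (rule free_module_smult_closed) (use f in auto)
  moreover have "\<ominus> \<one> \<otimes> f x \<oplus> f x = \<zero>" for x
    using f by (simp add: free_module_carrier l_minus l_neg)
  ultimately show "\<exists>g\<in>carrier (free_module R X). g \<oplus>\<^bsub>free_module R X\<^esub> f = \<zero>\<^bsub>free_module R X\<^esub>"
    by (auto intro!: bexI[of _ "\<lambda>x. \<ominus> \<one> \<otimes> f x"])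
next
  show "f \<oplus>\<^bsub>free_module R X\<^esub> g \<in> carrier (free_module R X)"
    if "f \<in> carrier (free_module R X)" "g \<in> carrier (free_module R X)" for f g
    using free_module_plus_closed[OF that] by simp
  show "r \<odot>\<^bsub>free_module R X\<^esub> f \<in> carrier (free_module R X)"
    if "r \<in> carrier R" "f \<in> carrier (free_module R X)" for r f
    using free_module_smult_closed[OF that] by simp
qed (auto simp: free_module_carrier a_ac l_distr r_distr m_assoc)

lemma basis_vector_closed: "x \<in> X \<Longrightarrow> basis_vector R x \<in> carrier (free_module R X)"
  by (auto simp: free_module_carrier basis_vector_def)

lemma free_module_induct [consumes 1, case_names zero add]:
  assumes "f \<in> carrier (free_module R X)"
    and P0: "P (\<lambda>x. \<zero>)"
    and Padd: "\<And>f r x. \<lbrakk>f \<in> carrier (free_module R X); r \<in> carrier R; x \<in> X; P f\<rbrakk>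
      \<Longrightarrow> P (f \<oplus>\<^bsub>free_module R X\<^esub> r \<odot>\<^bsub>free_module R X\<^esub> basis_vector R x)"
  shows "P f"
proof -
  have "\<forall>f. f \<in> carrier (free_module R X) \<and> {x. f x \<noteq> \<zero>} = S \<longrightarrow> P f" if "finite S" for S
    using that
  proof (induction S rule: finite_induct)
    case empty
    have "f = (\<lambda>x. \<zero>)" if "{x. f x \<noteq> \<zero>} = {}" for f :: "_ \<Rightarrow> 'a" using that by auto
    then show ?case using P0 by blast
  next
    case (insert s S)
    show ?case
    proof (intro allI impI, elim conjE)
      fix f assume f: "f \<in> carrier (free_module R X)" and S: "{x. f x \<noteq> \<zero>} = insert s S"
      let ?g = "f(s := \<zero>)"
      have gS: "{x. ?g x \<noteq> \<zero>} = S" using S insert.hyps by auto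
      then have g: "?g \<in> carrier (free_module R X)"
        using f insert.hyps by (auto simp: free_module_carrier)
      have s: "s \<in> X" using f S by (auto simp: free_module_carrier)
      have fs: "f s \<in> carrier R" using f by (auto simp: free_module_carrier)
      have eq: "f = ?g \<oplus>\<^bsub>free_module R X\<^esub> f s \<odot>\<^bsub>free_module R X\<^esub> basis_vector R s"
        using f by (auto simp: fun_eq_iff basis_vector_def free_module_carrier)
      show "P f"
        by (subst eq, rule Padd) (use g s fs gS insert.IH in auto)
    qed
  qed
  then show ?thesis using assms(1) by (auto simp: free_module_carrier)
qed

end

context lmodule
begin

text \<open>Two functions and their sum have different supports; on a common finite superset their
  lifts can be added termwise.\<close>

lemma free_lift_superset:
  assumes "f \<in> carrier (free_module R X)" "v \<in> X \<rightarrow> carrier M"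
    and "finite S" "{x. f x \<noteq> \<zero>\<^bsub>R\<^esub>} \<subseteq> S" "S \<subseteq> X"
  shows "free_lift R M v f = finsum M (\<lambda>x. f x \<odot>\<^bsub>M\<^esub> v x) S"
  unfolding free_lift_def
proof (rule M.add.finprod_mono_neutral_cong_left)
  show "f i \<odot>\<^bsub>M\<^esub> v i = \<zero>\<^bsub>M\<^esub>" if "i \<in> S - {x. f x \<noteq> \<zero>\<^bsub>R\<^esub>}" for i
    using assms that by (auto simp: Pi_def subset_iff)
  show "(\<lambda>x. f x \<odot>\<^bsub>M\<^esub> v x) \<in> S \<rightarrow> carrier M"
    using assms by (auto simp: Pi_def subset_iff R.free_module_carrier intro!: smult_closed)
qed (use assms(3,4) in simp_all)

lemma free_lift_hom:
  assumes v: "v \<in> X \<rightarrow> carrier M"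
  shows "free_lift R M v \<in> mod_hom R (free_module R X) M"
proof (rule mod_homI)
  let ?F = "free_module R X"
  have sup: "finite {x. f x \<noteq> \<zero>\<^bsub>R\<^esub>}" "{x. f x \<noteq> \<zero>\<^bsub>R\<^esub>} \<subseteq> X" if "f \<in> carrier ?F" for f
    using that by (auto simp: R.free_module_carrier)
  have cl: "(\<lambda>x. f x \<odot>\<^bsub>M\<^esub> v x) \<in> S \<rightarrow> carrier M" if "f \<in> carrier ?F" "S \<subseteq> X" for f S
    using that v by (auto simp: R.free_module_carrier Pi_def intro!: smult_closed)
  show "free_lift R M v f \<in> carrier M" if "f \<in> carrier ?F" for f
    unfolding free_lift_def using that sup cl by (intro M.finsum_closed) auto
  fix f assume f: "f \<in> carrier ?F"
  {
    fix g assume g: "g \<in> carrier ?F"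
    let ?S = "{x. f x \<noteq> \<zero>\<^bsub>R\<^esub>} \<union> {x. g x \<noteq> \<zero>\<^bsub>R\<^esub>}"
    have S: "finite ?S" "?S \<subseteq> X" using sup[OF f] sup[OF g] by auto
    have fg: "f \<oplus>\<^bsub>?F\<^esub> g \<in> carrier ?F" using R.free_module_plus_closed[OF f g] by simp
    have "free_lift R M v (f \<oplus>\<^bsub>?F\<^esub> g) = finsum M (\<lambda>x. (f x \<oplus>\<^bsub>R\<^esub> g x) \<odot>\<^bsub>M\<^esub> v x) ?S"
      by (subst free_lift_superset[OF fg v S(1) _ S(2)]) auto
    also have "\<dots> = finsum M (\<lambda>x. f x \<odot>\<^bsub>M\<^esub> v x \<oplus>\<^bsub>M\<^esub> g x \<odot>\<^bsub>M\<^esub> v x) ?S"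
      using f g v S cl[OF f S(2)] cl[OF g S(2)]
      by (intro M.finsum_cong') (auto simp: R.free_module_carrier Pi_def subset_iff smult_l_distr)
    also have "\<dots> = finsum M (\<lambda>x. f x \<odot>\<^bsub>M\<^esub> v x) ?S \<oplus>\<^bsub>M\<^esub> finsum M (\<lambda>x. g x \<odot>\<^bsub>M\<^esub> v x) ?S"
      using cl[OF f S(2)] cl[OF g S(2)] by (rule M.finsum_addf)
    also have "\<dots> = free_lift R M v f \<oplus>\<^bsub>M\<^esub> free_lift R M v g"
      using S by (simp add: free_lift_superset[OF f v S(1) _ S(2)] free_lift_superset[OF g v S(1) _ S(2)])
    finally show "free_lift R M v (f \<oplus>\<^bsub>?F\<^esub> g) = free_lift R M v f \<oplus>\<^bsub>M\<^esub> free_lift R M v g" .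
  next
    fix r assume r: "r \<in> carrier R"
    let ?S = "{x. f x \<noteq> \<zero>\<^bsub>R\<^esub>}"
    note S = sup[OF f]
    have rf: "r \<odot>\<^bsub>?F\<^esub> f \<in> carrier ?F" using R.free_module_smult_closed[OF r f] by simp
    have "free_lift R M v (r \<odot>\<^bsub>?F\<^esub> f) = finsum M (\<lambda>x. (r \<otimes>\<^bsub>R\<^esub> f x) \<odot>\<^bsub>M\<^esub> v x) ?S"
      by (subst free_lift_superset[OF rf v S(1) _ S(2)]) (auto simp: r)
    also have "\<dots> = finsum M (\<lambda>x. r \<odot>\<^bsub>M\<^esub> (f x \<odot>\<^bsub>M\<^esub> v x)) ?S"
      using f v S r cl[OF f S(2)]
      by (intro M.finsum_cong')
        (auto simp: R.free_module_carrier Pi_def subset_iff smult_assoc intro!: smult_closed)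
    also have "\<dots> = r \<odot>\<^bsub>M\<^esub> free_lift R M v f"
      unfolding free_lift_def using S r cl[OF f S(2)] by (simp add: smult_finsum)
    finally show "free_lift R M v (r \<odot>\<^bsub>?F\<^esub> f) = r \<odot>\<^bsub>M\<^esub> free_lift R M v f" .
  }
qed

lemma free_lift_basis_vector:
  assumes "v x \<in> carrier M"
  shows "free_lift R M v (basis_vector R x) = v x"
\<comment> \<open>Over the zero ring the basis vector has empty support and the sum does not see
  \<open>v x\<close>; but then \<open>M\<close> is zero.\<close>
proof (cases "\<one>\<^bsub>R\<^esub> = \<zero>\<^bsub>R\<^esub>")
  case True
  then have "v x = \<zero>\<^bsub>M\<^esub>" by (metis assms smult_one smult_l_null)
  then show ?thesis using True by (simp add: free_lift_def basis_vector_def)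
next
  case False
  then have "{y. basis_vector R x y \<noteq> \<zero>\<^bsub>R\<^esub>} = {x}" by (auto simp: basis_vector_def)
  then have "free_lift R M v (basis_vector R x) = finsum M (\<lambda>y. basis_vector R x y \<odot>\<^bsub>M\<^esub> v y) {x}"
    by (simp only: free_lift_def)
  then show ?thesis using assms
    by (simp add: basis_vector_def smult_one)
qed

end

lemma free_hom_eqI:
  assumes "ring R" "lmodule R M" "g \<in> mod_hom R (free_module R X) M"
    "h \<in> mod_hom R (free_module R X) M"
    and "\<And>x. x \<in> X \<Longrightarrow> g (basis_vector R x) = h (basis_vector R x)"
    and "f \<in> carrier (free_module R X)"
  shows "g f = h f"
proof -
  interpret R: ring R by fact
  interpret F: lmodule R "free_module R X" by (rule R.lmodule_free)
  note g = mod_homD[OF assms(3)] and h = mod_homD[OF assms(4)]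
  show ?thesis using assms(6)
  proof (induction rule: R.free_module_induct)
    case zero
    show ?case
      using mod_hom_zero[OF F.lmodule_axioms assms(2,3)] mod_hom_zero[OF F.lmodule_axioms assms(2,4)]
      by simp
  next
    case (add f r x)
    have "r \<odot>\<^bsub>free_module R X\<^esub> basis_vector R x \<in> carrier (free_module R X)"
      using add by (intro F.smult_closed R.basis_vector_closed)
    then show ?case using add by (simp only: g h R.basis_vector_closed assms(5))
  qed
qed

lemma projective_module_lmodule: "projective_module R P \<Longrightarrow> lmodule R P"
  by (simp add: projective_module_def)

lemma free_lifting:
  assumes "ring R" "lmodule R V" "lmodule R W" "f \<in> mod_hom R (free_module R X) W"
    "g \<in> mod_hom R V W" "f ` carrier (free_module R X) \<subseteq> g ` carrier V"
  obtains h where "h \<in> mod_hom R (free_module R X) V"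
    "\<And>x. x \<in> carrier (free_module R X) \<Longrightarrow> g (h x) = f x"
proof -
  interpret R: ring R by fact
  interpret V: lmodule R V by fact
  have "\<exists>v. v \<in> carrier V \<and> g v = f (basis_vector R x)" if "x \<in> X" for x
    using assms(6) R.basis_vector_closed[OF that] by (metis image_iff subset_iff)
  then obtain v where v: "\<And>x. x \<in> X \<Longrightarrow> v x \<in> carrier V \<and> g (v x) = f (basis_vector R x)"
    by metis
  have h: "free_lift R V v \<in> mod_hom R (free_module R X) V"
    by (rule V.free_lift_hom) (use v in auto)
  show thesis
  proof (rule that[OF h])
    show "g (free_lift R V v x) = f x" if "x \<in> carrier (free_module R X)" for x
      by (rule free_hom_eqI[OF assms(1,3) mod_hom_compose[OF h assms(5)] assms(4) _ that])
        (simp add: v V.free_lift_basis_vector)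
  qed
qed

text \<open>The summand maps \<open>i\<close> and \<open>q\<close> reduce this to free modules,
  where basis vectors are lifted one by one. Asking only that \<open>f\<close> lands in the image of
  \<open>g\<close> allows maps into boundaries to be lifted along a differential.\<close>

lemma projective_lifting:
  assumes "projective_module R P" "lmodule R V" "lmodule R W" "f \<in> mod_hom R P W"
    "g \<in> mod_hom R V W" "f ` carrier P \<subseteq> g ` carrier V"
  obtains h where "h \<in> mod_hom R P V" "\<And>x. x \<in> carrier P \<Longrightarrow> g (h x) = f x"
proof -
  from assms(1) obtain X :: "'c set" and i q where i: "i \<in> mod_hom R P (free_module R X)"
    and q: "q \<in> mod_hom R (free_module R X) P" and qi: "\<And>x. x \<in> carrier P \<Longrightarrow> q (i x) = x"
    and P: "lmodule R P"
    unfolding projective_module_def by blast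
  have R: "ring R" using P by (simp add: lmodule_def)
  obtain h where h: "h \<in> mod_hom R (free_module R X) V"
    "\<And>x. x \<in> carrier (free_module R X) \<Longrightarrow> g (h x) = f (q x)"
    by (rule free_lifting[OF R assms(2,3) mod_hom_compose[OF q assms(4)] assms(5)])
      (use mod_hom_closed[OF q] assms(6) in auto)
  show thesis
    by (rule that[OF mod_hom_compose[OF i h(1)]]) (simp add: h(2) mod_hom_closed[OF i] qi)
qed

text \<open>The definition wants a basis inside the element type of \<open>P\<close>, whereas
  summands arise from free modules over other types. Lifting \<open>q\<close> along the canonical
  surjection from the free module on \<open>carrier P\<close> trades one basis for the
  other.\<close>

lemma projective_moduleI:
  fixes Y :: "'y set" and P :: "('r, 'p, 'z) module_scheme"
  assumes "lmodule R P" "i \<in> mod_hom R P (free_module R Y)" "q \<in> mod_hom R (free_module R Y) P"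
    and "\<And>x. x \<in> carrier P \<Longrightarrow> q (i x) = x"
  shows "projective_module R P"
proof -
  interpret P: lmodule R P by fact
  have R: "ring R" by (rule P.R.ring_axioms)
  let ?F = "free_module R (carrier P)"
  have c: "free_lift R P (\<lambda>x. x) \<in> mod_hom R ?F P"
    by (rule P.free_lift_hom) auto
  obtain h where h: "h \<in> mod_hom R (free_module R Y) ?F"
    "\<And>y. y \<in> carrier (free_module R Y) \<Longrightarrow> free_lift R P (\<lambda>x. x) (h y) = q y"
  proof (rule free_lifting[OF R P.R.lmodule_free assms(1) assms(3) c])
    show "q ` carrier (free_module R Y) \<subseteq> free_lift R P (\<lambda>x. x) ` carrier ?F"
    proof
      fix y assume "y \<in> q ` carrier (free_module R Y)"
      then have "y \<in> carrier P" using mod_hom_closed[OF assms(3)] by auto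
      then show "y \<in> free_lift R P (\<lambda>x. x) ` carrier ?F"
        by (metis P.R.basis_vector_closed P.free_lift_basis_vector image_eqI)
    qed
  qed auto
  have "\<forall>x\<in>carrier P. free_lift R P (\<lambda>x. x) (h (i x)) = x"
    using h(2) assms(4) mod_hom_closed[OF assms(2)] by auto
  then show ?thesis
    unfolding projective_module_def
    by (intro conjI assms(1) exI[of _ "carrier P"] bexI[OF _ mod_hom_compose[OF assms(2) h(1)]] bexI[OF _ c])
qed

lemma projective_free:
  assumes "ring R"
  shows "projective_module R (free_module R X)"
  by (rule projective_moduleI[OF ring.lmodule_free[OF assms] mod_hom_id mod_hom_id]) simp

section \<open>Projective resolutions\<close>

locale resolution = M?: lmodule R M
  for R :: "('r, 'x) ring_scheme" and M :: "('r, 'm, 'y) module_scheme"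
    and P :: "nat \<Rightarrow> ('r, 'p) module" and d :: "nat \<Rightarrow> 'p \<Rightarrow> 'p" and \<epsilon> :: "'p \<Rightarrow> 'm" +
  assumes res: "proj_resolution R M P d \<epsilon>"
begin

lemma projective: "projective_module R (P n)"
  and d_hom: "d n \<in> mod_hom R (P (Suc n)) (P n)"
  and \<epsilon>_hom: "\<epsilon> \<in> mod_hom R (P 0) M"
  and \<epsilon>_surj: "\<epsilon> ` carrier (P 0) = carrier M"
  using res by (auto simp: proj_resolution_def)

lemma lmodule_P: "lmodule R (P n)"
  by (rule projective_module_lmodule[OF projective])

lemma exact_0: "d 0 ` carrier (P (Suc 0)) = {x \<in> carrier (P 0). \<epsilon> x = \<zero>\<^bsub>M\<^esub>}"
  using res by (simp add: proj_resolution_def kernel_def)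

lemma exact_Suc: "d (Suc n) ` carrier (P (Suc (Suc n))) = {x \<in> carrier (P (Suc n)). d n x = \<zero>\<^bsub>P n\<^esub>}"
  using res by (simp add: proj_resolution_def kernel_def)

lemma \<epsilon>_d: "x \<in> carrier (P (Suc 0)) \<Longrightarrow> \<epsilon> (d 0 x) = \<zero>\<^bsub>M\<^esub>"
  using exact_0 by blast

lemma d_d: "x \<in> carrier (P (Suc (Suc n))) \<Longrightarrow> d n (d (Suc n) x) = \<zero>\<^bsub>P n\<^esub>"
  using exact_Suc[of n] by blast

lemma boundary_subset: "d n ` carrier (P (Suc n)) \<subseteq> carrier (P n)"
  using mod_hom_closed[OF d_hom] by blast

end

text \<open>A splitting of the inclusion of the boundaries. For a projective resolution of
  \<open>M\<close> it exists iff the quotient of \<open>P n\<close> by them, the \<open>n\<close>-th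
  syzygy, is projective, i.e. iff \<open>M\<close> has projective dimension at most
  \<open>n\<close>.\<close>

definition retraction_at ::
  "('r, 'x) ring_scheme \<Rightarrow> (nat \<Rightarrow> ('r, 'p) module) \<Rightarrow> (nat \<Rightarrow> 'p \<Rightarrow> 'p) \<Rightarrow> nat \<Rightarrow> ('p \<Rightarrow> 'p) \<Rightarrow> bool"
  where
  "retraction_at R P d n \<rho> \<longleftrightarrow> \<rho> \<in> mod_hom R (P n) (P n) \<and>
     \<rho> ` carrier (P n) \<subseteq> d n ` carrier (P (Suc n)) \<and> (\<forall>z\<in>d n ` carrier (P (Suc n)). \<rho> z = z)"

context resolution
begin

text \<open>Lift \<open>\<rho>\<close> to \<open>\<sigma>\<close> with
  \<open>d \<sigma> = \<rho>\<close>. As \<open>\<rho>\<close> fixes boundaries,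
  \<open>d (x - \<sigma> (d x)) = 0\<close>, and by exactness \<open>1 - \<sigma> d\<close> retracts
  onto the boundaries one degree higher.\<close>

lemma retraction_Suc:
  assumes "retraction_at R P d n \<rho>"
  obtains \<sigma> \<rho>' where "\<sigma> \<in> mod_hom R (P n) (P (Suc n))" "retraction_at R P d (Suc n) \<rho>'"
    "\<And>x. x \<in> carrier (P (Suc n)) \<Longrightarrow> x = \<rho>' x \<oplus>\<^bsub>P (Suc n)\<^esub> \<sigma> (d n x)"
proof -
  interpret P: lmodule R "P n" by (rule lmodule_P)
  interpret P': lmodule R "P (Suc n)" by (rule lmodule_P)
  note \<rho> = assms[unfolded retraction_at_def]
  obtain \<sigma> where \<sigma>: "\<sigma> \<in> mod_hom R (P n) (P (Suc n))" "\<And>x. x \<in> carrier (P n) \<Longrightarrow> d n (\<sigma> x) = \<rho> x"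
    using projective_lifting[OF projective lmodule_P lmodule_P _ d_hom] \<rho> by metis
  note [simp] = mod_hom_closed[OF \<sigma>(1)] mod_hom_closed[OF d_hom]
  let ?\<rho> = "\<lambda>x. x \<ominus>\<^bsub>P (Suc n)\<^esub> \<sigma> (d n x)"
  have "?\<rho> \<in> mod_hom R (P (Suc n)) (P (Suc n))"
    by (intro mod_hom_diff lmodule_P mod_hom_id mod_hom_compose[OF d_hom \<sigma>(1)])
  moreover have "d n (?\<rho> x) = \<zero>\<^bsub>P n\<^esub>" if "x \<in> carrier (P (Suc n))" for x
    using that \<rho> by (simp add: mod_hom_minus[OF lmodule_P lmodule_P d_hom] \<sigma>(2))
  moreover have "?\<rho> z = z" if "z \<in> carrier (P (Suc n))" "d n z = \<zero>\<^bsub>P n\<^esub>" for z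
    using that by (simp add: mod_hom_zero[OF lmodule_P lmodule_P \<sigma>(1)])
  ultimately have "retraction_at R P d (Suc n) ?\<rho>"
    by (auto simp: retraction_at_def exact_Suc)
  then show thesis
    by (rule that[OF \<sigma>(1)]) simp
qed

lemma retraction_mono:
  assumes "retraction_at R P d n \<rho>" "n \<le> m"
  shows "\<exists>\<rho>. retraction_at R P d m \<rho>"
  using assms(2) by (induction m rule: dec_induct) (use assms(1) retraction_Suc in metis)+

text \<open>Factoring the next retraction as \<open>d \<tau>\<close> gives the identity of a
  contracting homotopy in the single degree \<open>Suc n\<close>. Additive functors preserve it, so
  it serves for Tor and for Ext.\<close>

lemma contraction:
  assumes "retraction_at R P d n \<rho>"
  obtains \<sigma> \<tau> where "\<sigma> \<in> mod_hom R (P n) (P (Suc n))" "\<tau> \<in> mod_hom R (P (Suc n)) (P (Suc (Suc n)))"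
    "\<And>x. x \<in> carrier (P (Suc n)) \<Longrightarrow> x = d (Suc n) (\<tau> x) \<oplus>\<^bsub>P (Suc n)\<^esub> \<sigma> (d n x)"
proof -
  obtain \<sigma> \<rho>' where \<sigma>: "\<sigma> \<in> mod_hom R (P n) (P (Suc n))"
    and \<rho>': "\<rho>' \<in> mod_hom R (P (Suc n)) (P (Suc n))"
      "\<rho>' ` carrier (P (Suc n)) \<subseteq> d (Suc n) ` carrier (P (Suc (Suc n)))"
    and eq: "\<And>x. x \<in> carrier (P (Suc n)) \<Longrightarrow> x = \<rho>' x \<oplus>\<^bsub>P (Suc n)\<^esub> \<sigma> (d n x)"
    using retraction_Suc[OF assms] unfolding retraction_at_def by metis
  obtain \<tau> where "\<tau> \<in> mod_hom R (P (Suc n)) (P (Suc (Suc n)))"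
    "\<And>x. x \<in> carrier (P (Suc n)) \<Longrightarrow> d (Suc n) (\<tau> x) = \<rho>' x"
    by (rule projective_lifting[OF projective lmodule_P lmodule_P \<rho>'(1) d_hom \<rho>'(2)]) auto
  then show thesis using that[OF \<sigma>] eq by metis
qed

end

text \<open>
  In degree \<open>i\<close> the map \<open>\<theta>\<close> is \<open>d h\<close> for a homotopy \<open>h\<close> from \<open>\<psi> \<phi>\<close> to the identity, where
  \<open>\<phi>\<close> and \<open>\<psi>\<close> are comparison maps between the two resolutions.
\<close>

lemma comparison:
  fixes P :: "nat \<Rightarrow> ('r, 'p) module" and P' :: "nat \<Rightarrow> ('r, 'q) module"
  assumes "resolution R M P d \<epsilon>" "resolution R M P' d' \<epsilon>'"
  shows "\<exists>\<phi>\<in>mod_hom R (P i) (P' i). \<exists>\<psi>\<in>mod_hom R (P' i) (P i). \<exists>\<theta>\<in>mod_hom R (P i) (P i).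
     \<phi> ` (d i ` carrier (P (Suc i))) \<subseteq> d' i ` carrier (P' (Suc i)) \<and>
     \<psi> ` (d' i ` carrier (P' (Suc i))) \<subseteq> d i ` carrier (P (Suc i)) \<and>
     \<theta> ` carrier (P i) \<subseteq> d i ` carrier (P (Suc i)) \<and>
     (\<forall>z\<in>d i ` carrier (P (Suc i)). \<theta> z = z \<ominus>\<^bsub>P i\<^esub> \<psi> (\<phi> z))"
proof (induction i)
  interpret P: resolution R M P d \<epsilon> by fact
  interpret P': resolution R M P' d' \<epsilon>' by fact
  {
    case 0
    interpret P0: lmodule R "P 0" by (rule P.lmodule_P)
    obtain \<phi> where \<phi>: "\<phi> \<in> mod_hom R (P 0) (P' 0)"
      "\<And>x. x \<in> carrier (P 0) \<Longrightarrow> \<epsilon>' (\<phi> x) = \<epsilon> x"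
      by (rule projective_lifting[OF P.projective P'.lmodule_P P.lmodule_axioms P.\<epsilon>_hom P'.\<epsilon>_hom])
        (auto simp: P.\<epsilon>_surj P'.\<epsilon>_surj)
    obtain \<psi> where \<psi>: "\<psi> \<in> mod_hom R (P' 0) (P 0)"
      "\<And>x. x \<in> carrier (P' 0) \<Longrightarrow> \<epsilon> (\<psi> x) = \<epsilon>' x"
      by (rule projective_lifting[OF P'.projective P.lmodule_P P.lmodule_axioms P'.\<epsilon>_hom P.\<epsilon>_hom])
        (auto simp: P.\<epsilon>_surj P'.\<epsilon>_surj)
    \<comment> \<open>In degree 0 no homotopy comes from below: \<open>1 - \<psi> \<phi>\<close>
      already lands in the kernel of \<open>\<epsilon>\<close>.\<close>
    let ?\<theta> = "\<lambda>x. x \<ominus>\<^bsub>P 0\<^esub> \<psi> (\<phi> x)"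
    note [simp] = mod_hom_closed[OF \<phi>(1)] mod_hom_closed[OF \<psi>(1)] mod_hom_closed[OF P.\<epsilon>_hom]
    have \<theta>: "?\<theta> \<in> mod_hom R (P 0) (P 0)"
      by (intro mod_hom_diff P.lmodule_P mod_hom_id mod_hom_compose[OF \<phi>(1) \<psi>(1)])
    have "\<epsilon> (?\<theta> x) = \<zero>\<^bsub>M\<^esub>" if "x \<in> carrier (P 0)" for x
      using that
      by (simp add: mod_hom_minus[OF P.lmodule_P P.lmodule_axioms P.\<epsilon>_hom] \<phi>(2) \<psi>(2))
    then show ?case
      by (intro bexI[OF _ \<phi>(1)] bexI[OF _ \<psi>(1)] bexI[OF _ \<theta>])
        (auto simp: P.exact_0 P'.exact_0 \<phi>(2) \<psi>(2))
  next
    case (Suc i)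
    interpret Pi: lmodule R "P i" by (rule P.lmodule_P)
    interpret PS: lmodule R "P (Suc i)" by (rule P.lmodule_P)
    from Suc obtain \<phi> \<psi> \<theta> where \<phi>: "\<phi> \<in> mod_hom R (P i) (P' i)"
      "\<phi> ` (d i ` carrier (P (Suc i))) \<subseteq> d' i ` carrier (P' (Suc i))"
      and \<psi>: "\<psi> \<in> mod_hom R (P' i) (P i)"
      "\<psi> ` (d' i ` carrier (P' (Suc i))) \<subseteq> d i ` carrier (P (Suc i))"
      and \<theta>: "\<theta> \<in> mod_hom R (P i) (P i)" "\<theta> ` carrier (P i) \<subseteq> d i ` carrier (P (Suc i))"
      "\<And>z. z \<in> carrier (P (Suc i)) \<Longrightarrow> \<theta> (d i z) = d i z \<ominus>\<^bsub>P i\<^esub> \<psi> (\<phi> (d i z))"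
      by auto
    obtain \<phi>' where \<phi>': "\<phi>' \<in> mod_hom R (P (Suc i)) (P' (Suc i))"
      "\<And>x. x \<in> carrier (P (Suc i)) \<Longrightarrow> d' i (\<phi>' x) = \<phi> (d i x)"
      by (rule projective_lifting[OF P.projective P'.lmodule_P P'.lmodule_P
            mod_hom_compose[OF P.d_hom \<phi>(1)] P'.d_hom]) (use \<phi>(2) in auto)
    obtain \<psi>' where \<psi>': "\<psi>' \<in> mod_hom R (P' (Suc i)) (P (Suc i))"
      "\<And>x. x \<in> carrier (P' (Suc i)) \<Longrightarrow> d i (\<psi>' x) = \<psi> (d' i x)"
      by (rule projective_lifting[OF P'.projective P.lmodule_P P.lmodule_P
            mod_hom_compose[OF P'.d_hom \<psi>(1)] P.d_hom]) (use \<psi>(2) in auto)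
    obtain h where h: "h \<in> mod_hom R (P i) (P (Suc i))"
      "\<And>x. x \<in> carrier (P i) \<Longrightarrow> d i (h x) = \<theta> x"
      by (rule projective_lifting[OF P.projective P.lmodule_P P.lmodule_P \<theta>(1) P.d_hom \<theta>(2)]) auto
    \<comment> \<open>Applying \<open>d\<close> gives
      \<open>d x - \<psi> (\<phi> (d x)) - \<theta> (d x)\<close>, which is zero by the property of
      \<open>\<theta>\<close> one degree lower; so the values are cycles. On cycles themselves the
      term \<open>h d\<close> drops out.\<close>
    let ?\<theta> = "\<lambda>x. x \<ominus>\<^bsub>P (Suc i)\<^esub> \<psi>' (\<phi>' x) \<ominus>\<^bsub>P (Suc i)\<^esub> h (d i x)"
    note [simp] = mod_hom_closed[OF \<phi>(1)] mod_hom_closed[OF \<psi>(1)] mod_hom_closed[OF \<phi>'(1)]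
      mod_hom_closed[OF \<psi>'(1)] mod_hom_closed[OF h(1)] mod_hom_closed[OF P.d_hom]
    have \<theta>': "?\<theta> \<in> mod_hom R (P (Suc i)) (P (Suc i))"
      by (intro mod_hom_diff P.lmodule_P mod_hom_id mod_hom_compose[OF \<phi>'(1) \<psi>'(1)]
          mod_hom_compose[OF P.d_hom h(1)])
    have "d i (?\<theta> x) = \<zero>\<^bsub>P i\<^esub>" if "x \<in> carrier (P (Suc i))" for x
      using that
      by (simp add: mod_hom_minus[OF P.lmodule_P P.lmodule_P P.d_hom] \<phi>'(2) \<psi>'(2) h(2) \<theta>(3))
    moreover have "?\<theta> z = z \<ominus>\<^bsub>P (Suc i)\<^esub> \<psi>' (\<phi>' z)"
      if "z \<in> carrier (P (Suc i))" "d i z = \<zero>\<^bsub>P i\<^esub>" for z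
      using that by (simp add: mod_hom_zero[OF P.lmodule_P P.lmodule_P h(1)])
    ultimately show ?case
      by (intro bexI[OF _ \<phi>'(1)] bexI[OF _ \<psi>'(1)] bexI[OF _ \<theta>'])
        (auto simp: P.exact_Suc P'.exact_Suc \<phi>'(2) \<psi>'(2)
          mod_hom_zero[OF P.lmodule_P P'.lmodule_P \<phi>(1)] mod_hom_zero[OF P'.lmodule_P P.lmodule_P \<psi>(1)])
  }
qed

text \<open>If \<open>P' i\<close> is zero, \<open>\<psi> \<phi>\<close> factors through it, so
  \<open>\<theta>\<close> fixes every boundary and is the retraction. The two resolutions may have
  different element types, so a finite resolution can be compared with any other one.\<close>

lemma retraction_if_finite_resolution:
  assumes "resolution R M P d \<epsilon>" "resolution R M P' d' \<epsilon>'"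
    and "carrier (P' i) = {\<zero>\<^bsub>P' i\<^esub>}"
  obtains \<rho> where "retraction_at R P d i \<rho>"
proof -
  interpret P: resolution R M P d \<epsilon> by fact
  interpret P': resolution R M P' d' \<epsilon>' by fact
  interpret Pi: lmodule R "P i" by (rule P.lmodule_P)
  obtain \<phi> \<psi> \<theta> where \<phi>: "\<phi> \<in> mod_hom R (P i) (P' i)" and \<psi>: "\<psi> \<in> mod_hom R (P' i) (P i)"
    and \<theta>: "\<theta> \<in> mod_hom R (P i) (P i)" "\<theta> ` carrier (P i) \<subseteq> d i ` carrier (P (Suc i))"
      "\<And>z. z \<in> d i ` carrier (P (Suc i)) \<Longrightarrow> \<theta> z = z \<ominus>\<^bsub>P i\<^esub> \<psi> (\<phi> z)"
    using comparison[OF assms(1,2), of i] by (elim bexE conjE) (rule that, assumption+, rule bspec)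
  have "\<psi> (\<phi> x) = \<zero>\<^bsub>P i\<^esub>" if "x \<in> carrier (P i)" for x
    using mod_hom_closed[OF \<phi> that] assms(3) mod_hom_zero[OF P'.lmodule_P P.lmodule_P \<psi>] by simp
  then have "\<theta> z = z" if "z \<in> d i ` carrier (P (Suc i))" for z
    using \<theta>(3)[OF that] that P.boundary_subset[of i] by auto
  with \<theta>(1,2) have "retraction_at R P d i \<theta>" by (simp add: retraction_at_def)
  then show thesis by (rule that)
qed

subsection \<open>Existence of free resolutions\<close>

text \<open>The padding makes the total length of the code determine the lengths of the sublists.\<close>

definition list_list_code :: "'e list list \<Rightarrow> 'e list" where
  "list_list_code xss = concat xss @
     replicate (prod_encode (list_encode (map length xss), length (concat xss)) - length (concat xss)) undefined"

lemma inj_list_list_code: "inj list_list_code"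
proof
  fix xss yss :: "'e list list"
  assume eq: "list_list_code xss = list_list_code yss"
  \<comment> \<open>The second component never exceeds the code of a pair, so the truncated
    subtraction in the padding is exact and the total length is that code.\<close>
  have len: "length (list_list_code zss) = prod_encode (list_encode (map length zss), length (concat zss))"
    for zss :: "'e list list"
    using le_prod_encode_2 by (simp add: list_list_code_def)
  have "(list_encode (map length xss), length (concat xss)) = (list_encode (map length yss), length (concat yss))"
    using eq len by (metis prod_encode_eq)
  then have l: "map length xss = map length yss" "length (concat xss) = length (concat yss)"
    using list_encode_eq by auto
  then have "concat xss = concat yss"
    using eq by (simp add: list_list_code_def)
  moreover have "length xss = length yss" using l(1) by (rule map_eq_imp_length_eq)
  moreover have "\<forall>(x, y)\<in>set (zip xss yss). length x = length y"
    using l(1) by (auto simp: set_zip) (metis nth_map)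
  ultimately show "xss = yss" by (rule concat_injective)
qed

text \<open>A function of finite support is coded by listing its support. Each argument, itself a
  list, gets its value prepended in a head whose second component is filler; flattening the list of
  lists leads back to the basis type.\<close>

lemma finite_support_code:
  obtains j :: "('r, 'm) res \<Rightarrow> ('r \<times> 'm) list" where "inj_on j {f. finite {x. f x \<noteq> z}}"
proof
  define L :: "('r, 'm) res \<Rightarrow> ('r \<times> 'm) list list"
    where "L f = map (\<lambda>x. (f x, undefined) # x) (SOME xs. set xs = {x. f x \<noteq> z})" for f
  have L: "set (L f) = (\<lambda>x. (f x, undefined) # x) ` {x. f x \<noteq> z}" if "finite {x. f x \<noteq> z}" for f
    using someI_ex[OF finite_list[OF that]] by (simp add: L_def)
  have "inj_on L {f. finite {x. f x \<noteq> z}}"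
  proof (rule inj_onI, rule ext, clarify)
    fix f g :: "('r, 'm) res" and x
    assume fg: "finite {x. f x \<noteq> z}" "finite {x. g x \<noteq> z}" "L f = L g"
    then have eq: "(\<lambda>x. (f x, undefined :: 'm) # x) ` {x. f x \<noteq> z} = (\<lambda>x. (g x, undefined) # x) ` {x. g x \<noteq> z}"
      using L[OF fg(1)] L[OF fg(2)] by simp
    then have "f x \<noteq> z \<Longrightarrow> (f x, undefined) # x \<in> (\<lambda>x. (g x, undefined :: 'm) # x) ` {x. g x \<noteq> z}"
      "g x \<noteq> z \<Longrightarrow> (g x, undefined) # x \<in> (\<lambda>x. (f x, undefined :: 'm) # x) ` {x. f x \<noteq> z}"
      by blast+
    then show "f x = g x" by (cases "f x = z"; cases "g x = z") (clarsimp | blast)+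
  qed
  then show "inj_on (list_list_code \<circ> L) {f. finite {x. f x \<noteq> z}}"
    by (intro comp_inj_on) (auto intro: inj_on_subset[OF inj_list_list_code])
qed

text \<open>The choice in \<open>chosen_resolution\<close> needs a witness in this very type. All
  modules of the resolution are free submodules of one module \<open>U\<close>. Its elements are
  coded by \<open>j\<close> in the basis type, so every submodule of \<open>U\<close> is covered by
  the free module on its codes, which again lies in \<open>U\<close>.\<close>

lemma exists_resolution:
  fixes M :: "('r, 'm, 'y) module_scheme"
  assumes "lmodule R M"
  shows "\<exists>(P :: nat \<Rightarrow> ('r, ('r, 'm) res) module) d \<epsilon>. proj_resolution R M P d \<epsilon>"
proof -
  interpret M: lmodule R M by fact
  define U :: "('r, ('r, 'm) res) module" where "U = free_module R UNIV"
  interpret U: lmodule R U unfolding U_def by (rule M.R.lmodule_free)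
  obtain j :: "('r, 'm) res \<Rightarrow> ('r \<times> 'm) list" where "inj_on j {f. finite {x. f x \<noteq> \<zero>\<^bsub>R\<^esub>}}"
    by (rule finite_support_code)
  then have j: "inj_on j (carrier U)"
    by (rule inj_on_subset) (auto simp: U_def M.R.free_module_carrier)
  \<comment> \<open>The inverse of the coding does not depend on the degree, so the same map
    \<open>D\<close> is the differential everywhere.\<close>
  define v where "v = inv_into (carrier U) j"
  have vj: "v (j f) = f" if "f \<in> carrier U" for f
    using j that by (simp add: v_def inv_into_f_f)
  define D where "D = free_lift R U v"
  define j0 :: "'m \<Rightarrow> ('r \<times> 'm) list" where "j0 m = [(undefined, m)]" for m
  define v0 :: "('r \<times> 'm) list \<Rightarrow> 'm" where "v0 l = snd (hd l)" for l
  define X where "X = j0 ` carrier M"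
  define \<epsilon> where "\<epsilon> = free_lift R M v0"
  define F :: "('r \<times> 'm) list set \<Rightarrow> ('r, ('r, 'm) res) module" where "F Y = free_module R Y" for Y
  \<comment> \<open>\<open>Z n\<close> consists of the cycles in degree \<open>n\<close>; their
    codes are the basis in degree \<open>Suc n\<close>.\<close>
  define Z where "Z = rec_nat {f \<in> carrier (F X). \<epsilon> f = \<zero>\<^bsub>M\<^esub>} (\<lambda>_ Z. {f \<in> carrier (F (j ` Z)). D f = \<zero>\<^bsub>U\<^esub>})"
  have Z0: "Z 0 = {f \<in> carrier (F X). \<epsilon> f = \<zero>\<^bsub>M\<^esub>}"
    and ZS: "Z (Suc n) = {f \<in> carrier (F (j ` Z n)). D f = \<zero>\<^bsub>U\<^esub>}" for n
    by (simp_all add: Z_def)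
  have F: "projective_module R (F Y)" "lmodule R (F Y)" for Y
    by (simp_all add: F_def projective_free M.R.ring_axioms M.R.lmodule_free)
  have FU: "carrier (F Y) \<subseteq> carrier U" "add (F Y) = add U" "smult (F Y) = smult U" "\<zero>\<^bsub>F Y\<^esub> = \<zero>\<^bsub>U\<^esub>" for Y
    by (auto simp: F_def U_def M.R.free_module_carrier)
  have \<epsilon>: "\<epsilon> \<in> mod_hom R (F X) M"
    unfolding \<epsilon>_def F_def by (rule M.free_lift_hom) (auto simp: X_def j0_def v0_def)
  have D: "D \<in> mod_hom R (F (j ` S)) U" if "S \<subseteq> carrier U" for S
    unfolding D_def F_def by (rule U.free_lift_hom) (use that in \<open>auto simp: vj\<close>)
  have sub: "submodule S R U" if "submodule S R (F Y)" for S Y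
  proof -
    interpret FY: lmodule R "F Y" by (rule F)
    show ?thesis
      by (rule U.submoduleI) (use FY.submoduleD[OF that] FU[of Y] in auto)
  qed
  have Z: "submodule (Z n) R U" for n
  proof (induction n)
    case 0
    show ?case unfolding Z0 by (rule sub[OF submodule_kernel[OF F(2) M.lmodule_axioms \<epsilon>]])
  next
    case (Suc n)
    then show ?case unfolding ZS
      by (intro sub[OF submodule_kernel[OF F(2) U.lmodule_axioms D]]) (rule U.submoduleD)
  qed
  note ZU = U.submoduleD(1)[OF Z]
  have D_image: "D ` carrier (F (j ` Z n)) = Z n" for n
  proof (intro subset_antisym image_subsetI subsetI)
    fix f assume f: "f \<in> carrier (F (j ` Z n))"
    have "D f = finsum U (\<lambda>x. f x \<odot>\<^bsub>U\<^esub> v x) {x. f x \<noteq> \<zero>\<^bsub>R\<^esub>}"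
      by (simp add: D_def free_lift_def)
    also have "\<dots> \<in> Z n"
    proof (rule U.submodule_finsum[OF Z])
      show "finite {x. f x \<noteq> \<zero>\<^bsub>R\<^esub>}"
        using f by (simp add: F_def M.R.free_module_carrier)
      show "(\<lambda>x. f x \<odot>\<^bsub>U\<^esub> v x) \<in> {x. f x \<noteq> \<zero>\<^bsub>R\<^esub>} \<rightarrow> Z n"
      proof
        fix x assume "x \<in> {x. f x \<noteq> \<zero>\<^bsub>R\<^esub>}"
        then obtain z where "z \<in> Z n" "x = j z"
          using f by (auto simp: F_def M.R.free_module_carrier)
        then have "v x \<in> Z n" using vj ZU[of n] by auto
        moreover have "f x \<in> carrier R"
          using f by (simp add: F_def M.R.free_module_carrier)
        ultimately show "f x \<odot>\<^bsub>U\<^esub> v x \<in> Z n" by (rule U.submoduleD(6)[OF Z, rotated])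
      qed
    qed
    finally show "D f \<in> Z n" .
  next
    fix z assume z: "z \<in> Z n"
    then have zU: "z \<in> carrier U" using ZU[of n] by auto
    have "D (basis_vector R (j z)) = v (j z)"
      unfolding D_def by (rule U.free_lift_basis_vector) (simp add: vj zU)
    moreover have "basis_vector R (j z) \<in> carrier (F (j ` Z n))"
      unfolding F_def by (rule M.R.basis_vector_closed) (use z in simp)
    ultimately show "z \<in> D ` carrier (F (j ` Z n))"
      by (metis image_eqI vj zU)
  qed
  define P where "P n = F (case n of 0 \<Rightarrow> X | Suc m \<Rightarrow> j ` Z m)" for n
  have P0: "P 0 = F X" and PS: "P (Suc n) = F (j ` Z n)" for n
    by (simp_all add: P_def)
  have ZP: "Z n \<subseteq> carrier (P n)" for n
    by (cases n) (auto simp: Z0 ZS P_def)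
  have "proj_resolution R M P (\<lambda>n. D) \<epsilon>"
    unfolding proj_resolution_def kernel_def
  proof (intro conjI allI)
    show "projective_module R (P n)" for n by (simp add: P_def F)
    show "D \<in> mod_hom R (P (Suc n)) (P n)" for n
    proof (rule mod_homI)
      note D' = mod_homD[OF D[OF ZU[of n]]]
      show "D f \<in> carrier (P n)" if "f \<in> carrier (P (Suc n))" for f
        using that ZP[of n] D_image[of n] by (auto simp: PS)
      show "D (f \<oplus>\<^bsub>P (Suc n)\<^esub> g) = D f \<oplus>\<^bsub>P n\<^esub> D g"
        if "f \<in> carrier (P (Suc n))" "g \<in> carrier (P (Suc n))" for f g
        using that D'(2) by (simp add: PS FU(2)) (simp add: P_def FU(2))
      show "D (r \<odot>\<^bsub>P (Suc n)\<^esub> f) = r \<odot>\<^bsub>P n\<^esub> D f" if "r \<in> carrier R" "f \<in> carrier (P (Suc n))" for r f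
        using that D'(3) by (simp add: PS FU(3)) (simp add: P_def FU(3))
    qed
    show "\<epsilon> \<in> mod_hom R (P 0) M" using \<epsilon> by (simp add: P0)
    show "\<epsilon> ` carrier (P 0) = carrier M"
    proof (intro subset_antisym subsetI)
      fix m assume m: "m \<in> carrier M"
      have "\<epsilon> (basis_vector R (j0 m)) = v0 (j0 m)"
        unfolding \<epsilon>_def by (rule M.free_lift_basis_vector) (simp add: m j0_def v0_def)
      moreover have "basis_vector R (j0 m) \<in> carrier (P 0)"
        unfolding F_def P0 by (rule M.R.basis_vector_closed) (use m in \<open>simp add: X_def\<close>)
      ultimately show "m \<in> \<epsilon> ` carrier (P 0)"
        by (auto simp: j0_def v0_def intro: rev_image_eqI)
    qed (use mod_hom_closed[OF \<epsilon>] in \<open>auto simp: P0\<close>)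
    show "D ` carrier (P 1) = {x \<in> carrier (add_monoid (P 0)). \<epsilon> x = \<one>\<^bsub>add_monoid M\<^esub>}"
      using D_image[of 0] unfolding One_nat_def by (simp add: PS P0 Z0)
    show "D ` carrier (P (Suc (Suc n))) = {x \<in> carrier (add_monoid (P (Suc n))). D x = \<one>\<^bsub>add_monoid (P n)\<^esub>}" for n
      using D_image[of "Suc n"] by (simp add: PS ZS) (simp add: P_def FU(4))
  qed
  then show ?thesis by (intro exI)
qed

lemma chosen_resolution:
  fixes M :: "('r, 'm, 'y) module_scheme"
  assumes "lmodule R M" "chosen_resolution R M = (P, d, \<epsilon>)"
  shows "proj_resolution R M P d \<epsilon>"
proof -
  have "\<exists>t :: (nat \<Rightarrow> ('r, ('r, 'm) res) module) \<times> (nat \<Rightarrow> ('r, 'm) res \<Rightarrow> ('r, 'm) res)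
      \<times> (('r, 'm) res \<Rightarrow> 'm). case t of (P, d, \<epsilon>) \<Rightarrow> proj_resolution R M P d \<epsilon>"
    using exists_resolution[OF assms(1)] by (simp add: split_paired_Ex)
  from someI_ex[OF this] show ?thesis
    using assms(2) unfolding chosen_resolution_def by simp
qed

section \<open>Tensor products\<close>

definition frag_lift :: "('g, 'x) monoid_scheme \<Rightarrow> ('b \<Rightarrow> 'g) \<Rightarrow> ('b \<Rightarrow>\<^sub>0 int) \<Rightarrow> 'g" where
  "frag_lift G \<phi> f = finprod G (\<lambda>p. \<phi> p [^]\<^bsub>G\<^esub> Poly_Mapping.lookup f p) (Poly_Mapping.keys f)"

context comm_group
begin

lemma frag_lift_superset:
  assumes "\<phi> ` B \<subseteq> carrier G" "finite K" "Poly_Mapping.keys f \<subseteq> K" "K \<subseteq> B"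
  shows "frag_lift G \<phi> f = finprod G (\<lambda>p. \<phi> p [^] Poly_Mapping.lookup f p) K"
  unfolding frag_lift_def
proof (rule finprod_mono_neutral_cong_left)
  show "(\<lambda>p. \<phi> p [^] Poly_Mapping.lookup f p) \<in> K \<rightarrow> carrier G"
    using assms(1,4) by (auto simp: image_subset_iff subset_iff)
qed (use assms(2,3) in \<open>auto simp: in_keys_iff\<close>)

lemma frag_lift_hom:
  assumes "\<phi> ` B \<subseteq> carrier G"
  shows "frag_lift G \<phi> \<in> hom (free_Abelian_group B) G"
proof (rule homI)
  fix f assume "f \<in> carrier (free_Abelian_group B)"
  then have f: "Poly_Mapping.keys f \<subseteq> B" by simp
  then show "frag_lift G \<phi> f \<in> carrier G"
    using assms unfolding frag_lift_def by (intro finprod_closed) auto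
  fix g assume "g \<in> carrier (free_Abelian_group B)"
  then have g: "Poly_Mapping.keys g \<subseteq> B" by simp
  let ?K = "Poly_Mapping.keys f \<union> Poly_Mapping.keys g"
  have K: "finite ?K" "?K \<subseteq> B" using f g by auto
  have cl: "\<phi> p \<in> carrier G" if "p \<in> ?K" for p using that K assms by auto
  have "frag_lift G \<phi> (f + g) = finprod G (\<lambda>p. \<phi> p [^] Poly_Mapping.lookup (f + g) p) ?K"
    by (rule frag_lift_superset[OF assms K(1) keys_add K(2)])
  also have "\<dots> = finprod G (\<lambda>p. \<phi> p [^] Poly_Mapping.lookup f p \<otimes> \<phi> p [^] Poly_Mapping.lookup g p) ?K"
    by (rule finprod_cong') (use cl in \<open>auto simp: Poly_Mapping.lookup_add int_pow_mult\<close>)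
  also have "\<dots> = finprod G (\<lambda>p. \<phi> p [^] Poly_Mapping.lookup f p) ?K
      \<otimes> finprod G (\<lambda>p. \<phi> p [^] Poly_Mapping.lookup g p) ?K"
    by (rule finprod_multf) (use cl in auto)
  also have "\<dots> = frag_lift G \<phi> f \<otimes> frag_lift G \<phi> g"
    by (simp add: frag_lift_superset[OF assms K(1) _ K(2)])
  finally show "frag_lift G \<phi> (f \<otimes>\<^bsub>free_Abelian_group B\<^esub> g) = frag_lift G \<phi> f \<otimes> frag_lift G \<phi> g"
    by simp
qed

lemma frag_lift_frag_of: "\<phi> p \<in> carrier G \<Longrightarrow> frag_lift G \<phi> (frag_of p) = \<phi> p"
  by (simp add: frag_lift_def)

end

definition balanced ::
  "('r, 'x) ring_scheme \<Rightarrow> ('r, 'n, 'y) module_scheme \<Rightarrow> ('r, 'm, 'z) module_scheme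
     \<Rightarrow> ('g, 'w) monoid_scheme \<Rightarrow> ('n \<times> 'm \<Rightarrow> 'g) \<Rightarrow> bool" where
  "balanced R N M G \<phi> \<longleftrightarrow>
     (\<forall>n\<in>carrier N. \<forall>m\<in>carrier M. \<phi> (n, m) \<in> carrier G) \<and>
     (\<forall>n\<in>carrier N. \<forall>n'\<in>carrier N. \<forall>m\<in>carrier M. \<phi> (n \<oplus>\<^bsub>N\<^esub> n', m) = \<phi> (n, m) \<otimes>\<^bsub>G\<^esub> \<phi> (n', m)) \<and>
     (\<forall>n\<in>carrier N. \<forall>m\<in>carrier M. \<forall>m'\<in>carrier M. \<phi> (n, m \<oplus>\<^bsub>M\<^esub> m') = \<phi> (n, m) \<otimes>\<^bsub>G\<^esub> \<phi> (n, m')) \<and>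
     (\<forall>r\<in>carrier R. \<forall>n\<in>carrier N. \<forall>m\<in>carrier M. \<phi> (r \<odot>\<^bsub>N\<^esub> n, m) = \<phi> (n, r \<odot>\<^bsub>M\<^esub> m))"

text \<open>The assumptions are those that place the tensor relations inside \<open>F\<close>. Both
  the tensor product of algebras over \<open>K\<close> and the groups of the Tor complex are
  instances.\<close>

locale tensor_product = N?: abelian_group N + M?: abelian_group M
  for R :: "('r, 'x) ring_scheme" and N :: "('r, 'n, 'y) module_scheme"
    and M :: "('r, 'm, 'z) module_scheme" +
  assumes smult_closed_N: "\<lbrakk>r \<in> carrier R; n \<in> carrier N\<rbrakk> \<Longrightarrow> r \<odot>\<^bsub>N\<^esub> n \<in> carrier N"
    and smult_closed_M: "\<lbrakk>r \<in> carrier R; m \<in> carrier M\<rbrakk> \<Longrightarrow> r \<odot>\<^bsub>M\<^esub> m \<in> carrier M"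
begin

abbreviation "F \<equiv> free_Abelian_group (carrier N \<times> carrier M)"
abbreviation "S \<equiv> tensor_subgroup R N M"
abbreviation "T \<equiv> tensor_group R N M"
abbreviation "pt \<equiv> pure_tensor R N M"

sublocale F: comm_group F
  by (rule abelian_free_Abelian_group)

lemma F_diff_closed: "\<lbrakk>x \<in> carrier F; y \<in> carrier F\<rbrakk> \<Longrightarrow> x - y \<in> carrier F"
  unfolding carrier_free_Abelian_group_iff using keys_diff[of x y] by (rule order_trans) simp

lemma relations_subset: "tensor_relations R N M \<subseteq> carrier F"
  unfolding tensor_relations_def
  by (intro Un_least subsetI; elim CollectE exE conjE; hypsubst; intro F_diff_closed)
    (simp_all add: smult_closed_N smult_closed_M)

sublocale S: normal S F
  unfolding tensor_subgroup_def F.normal_iff_subgroup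
  by (rule F.generate_is_subgroup[OF relations_subset])

sublocale T: comm_group T
  unfolding tensor_group_def by (rule F.abelian_FactGroup[OF S.subgroup_axioms])

lemma T_mult: "\<lbrakk>x \<in> carrier F; y \<in> carrier F\<rbrakk>
    \<Longrightarrow> (S #>\<^bsub>F\<^esub> x) \<otimes>\<^bsub>T\<^esub> (S #>\<^bsub>F\<^esub> y) = S #>\<^bsub>F\<^esub> (x + y)"
  unfolding tensor_group_def using S.rcos_sum[of x y] by simp

lemma T_carrier: "carrier T = (\<lambda>x. S #>\<^bsub>F\<^esub> x) ` carrier F"
  unfolding tensor_group_def by (rule carrier_FactGroup)

lemma T_one: "\<one>\<^bsub>T\<^esub> = S #>\<^bsub>F\<^esub> 0"
  using F.coset_mult_one[OF S.subset] by (simp add: tensor_group_def)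

lemma coset_eqI:
  assumes "x - y \<in> S" "x \<in> carrier F" "y \<in> carrier F"
  shows "S #>\<^bsub>F\<^esub> x = S #>\<^bsub>F\<^esub> y"
proof -
  have "x \<in> S #>\<^bsub>F\<^esub> y" using assms(1) by (auto simp: r_coset_def intro!: bexI[of _ "x - y"])
  then show ?thesis using F.repr_independence assms(3) S.subgroup_axioms by metis
qed

lemma relation_mem: "x \<in> tensor_relations R N M \<Longrightarrow> x \<in> S"
  unfolding tensor_subgroup_def by (rule generate.incl)

lemma pt_closed [simp]: "\<lbrakk>n \<in> carrier N; m \<in> carrier M\<rbrakk> \<Longrightarrow> pt n m \<in> carrier T"
  by (auto simp: T_carrier pure_tensor_def)

lemma pt_add_left:
  assumes "n \<in> carrier N" "n' \<in> carrier N" "m \<in> carrier M"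
  shows "pt (n \<oplus>\<^bsub>N\<^esub> n') m = pt n m \<otimes>\<^bsub>T\<^esub> pt n' m"
proof -
  have "frag_of (n \<oplus>\<^bsub>N\<^esub> n', m) - frag_of (n, m) - frag_of (n', m) \<in> S"
    by (rule relation_mem) (use assms in \<open>unfold tensor_relations_def, blast\<close>)
  then have "S #>\<^bsub>F\<^esub> frag_of (n \<oplus>\<^bsub>N\<^esub> n', m) = S #>\<^bsub>F\<^esub> (frag_of (n, m) + frag_of (n', m))"
    by (intro coset_eqI) (use assms in \<open>auto simp: algebra_simps intro!: subset_trans[OF keys_add]\<close>)
  then show ?thesis using assms by (simp add: pure_tensor_def T_mult)
qed

lemma pt_add_right:
  assumes "n \<in> carrier N" "m \<in> carrier M" "m' \<in> carrier M"
  shows "pt n (m \<oplus>\<^bsub>M\<^esub> m') = pt n m \<otimes>\<^bsub>T\<^esub> pt n m'"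
proof -
  have "frag_of (n, m \<oplus>\<^bsub>M\<^esub> m') - frag_of (n, m) - frag_of (n, m') \<in> S"
    by (rule relation_mem) (use assms in \<open>unfold tensor_relations_def, blast\<close>)
  then have "S #>\<^bsub>F\<^esub> frag_of (n, m \<oplus>\<^bsub>M\<^esub> m') = S #>\<^bsub>F\<^esub> (frag_of (n, m) + frag_of (n, m'))"
    by (intro coset_eqI) (use assms in \<open>auto simp: algebra_simps intro!: subset_trans[OF keys_add]\<close>)
  then show ?thesis using assms by (simp add: pure_tensor_def T_mult)
qed

lemma pt_smult:
  assumes "r \<in> carrier R" "n \<in> carrier N" "m \<in> carrier M"
  shows "pt (r \<odot>\<^bsub>N\<^esub> n) m = pt n (r \<odot>\<^bsub>M\<^esub> m)"
proof -
  have "frag_of (r \<odot>\<^bsub>N\<^esub> n, m) - frag_of (n, r \<odot>\<^bsub>M\<^esub> m) \<in> S"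
    by (rule relation_mem) (use assms in \<open>unfold tensor_relations_def, blast\<close>)
  then show ?thesis unfolding pure_tensor_def
    by (rule coset_eqI) (use assms in \<open>auto simp: smult_closed_N smult_closed_M\<close>)
qed

lemma pt_zero_left [simp]: "m \<in> carrier M \<Longrightarrow> pt \<zero>\<^bsub>N\<^esub> m = \<one>\<^bsub>T\<^esub>"
  by (metis N.l_zero N.zero_closed T.l_cancel_one' pt_add_left pt_closed)

lemma pt_zero_right [simp]: "n \<in> carrier N \<Longrightarrow> pt n \<zero>\<^bsub>M\<^esub> = \<one>\<^bsub>T\<^esub>"
  by (metis M.l_zero M.zero_closed T.l_cancel_one' pt_add_right pt_closed)

text \<open>The inverse of a pure tensor is the pure tensor of \<open>\<ominus> n\<close> and
  \<open>m\<close>, so sums of pure tensors, without differences, exhaust \<open>T\<close>.\<close>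

lemma T_induct [consumes 1, case_names pt mult]:
  assumes "X \<in> carrier T"
    and pt: "\<And>n m. \<lbrakk>n \<in> carrier N; m \<in> carrier M\<rbrakk> \<Longrightarrow> Q (pt n m)"
    and mult: "\<And>X Y. \<lbrakk>X \<in> carrier T; Y \<in> carrier T; Q X; Q Y\<rbrakk> \<Longrightarrow> Q (X \<otimes>\<^bsub>T\<^esub> Y)"
  shows "Q X"
proof -
  \<comment> \<open>Induction in a free abelian group runs over differences, so the claim has to
    carry \<open>f\<close> and \<open>- f\<close> together.\<close>
  have *: "Q (S #>\<^bsub>F\<^esub> f) \<and> Q (S #>\<^bsub>F\<^esub> (- f))" if "Poly_Mapping.keys f \<subseteq> carrier N \<times> carrier M" for f
    using that
  proof (induction rule: free_Abelian_group_induct[consumes 1])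
    case 1
    show ?case using pt[of "\<zero>\<^bsub>N\<^esub>" "\<zero>\<^bsub>M\<^esub>"] by (simp add: T_one)
  next
    case (2 x y)
    have cl: "x \<in> carrier F" "y \<in> carrier F" "- x \<in> carrier F" "- y \<in> carrier F"
      using 2 by auto
    have in_T: "S #>\<^bsub>F\<^esub> z \<in> carrier T" if "z \<in> carrier F" for z
      using that T_carrier by blast
    have "S #>\<^bsub>F\<^esub> (x - y) = (S #>\<^bsub>F\<^esub> x) \<otimes>\<^bsub>T\<^esub> (S #>\<^bsub>F\<^esub> (- y))"
      "S #>\<^bsub>F\<^esub> (- (x - y)) = (S #>\<^bsub>F\<^esub> (- x)) \<otimes>\<^bsub>T\<^esub> (S #>\<^bsub>F\<^esub> y)"
      using T_mult[of x "- y"] T_mult[of "- x" y] cl by simp_all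
    then show ?case using 2 mult in_T cl by metis
  next
    case (3 p)
    obtain n m where p: "p = (n, m)" "n \<in> carrier N" "m \<in> carrier M" using 3 by auto
    have "(S #>\<^bsub>F\<^esub> (- frag_of p)) \<otimes>\<^bsub>T\<^esub> pt n m = \<one>\<^bsub>T\<^esub>"
      using p T_mult[of "- frag_of p" "frag_of p"] by (simp add: pure_tensor_def T_one)
    moreover have "pt (\<ominus>\<^bsub>N\<^esub> n) m \<otimes>\<^bsub>T\<^esub> pt n m = \<one>\<^bsub>T\<^esub>"
      using p pt_add_left[of "\<ominus>\<^bsub>N\<^esub> n" n m] by (simp add: N.l_neg)
    moreover have "S #>\<^bsub>F\<^esub> (- frag_of p) \<in> carrier T"
      using p by (auto simp: T_carrier)
    ultimately have "S #>\<^bsub>F\<^esub> (- frag_of p) = pt (\<ominus>\<^bsub>N\<^esub> n) m"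
      using p by (metis N.a_inv_closed T.right_cancel pt_closed)
    then show ?case using pt p by (auto simp: pure_tensor_def)
  qed
  show ?thesis using assms(1) * by (auto simp: T_carrier)
qed

context
  fixes G :: "('g, 'w) monoid_scheme" and \<phi> :: "'n \<times> 'm \<Rightarrow> 'g"
  assumes G: "comm_group G" and \<phi>: "balanced R N M G \<phi>"
begin

interpretation G: comm_group G by (rule G)

text \<open>The three kinds of relations correspond to the three laws of a balanced map, so they lie
  in the kernel, and the kernel is a subgroup.\<close>

lemma frag_lift_vanishes: "f \<in> S \<Longrightarrow> frag_lift G \<phi> f = \<one>\<^bsub>G\<^esub>"
proof -
  have "\<phi> ` (carrier N \<times> carrier M) \<subseteq> carrier G" using \<phi> by (auto simp: balanced_def)
  then have hom: "frag_lift G \<phi> \<in> hom F G" by (rule G.frag_lift_hom)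
  interpret h: group_hom F G "frag_lift G \<phi>"
    by unfold_locales (rule hom)
  have sub: "subgroup (kernel F G (frag_lift G \<phi>)) F" by (rule h.subgroup_kernel)
  have diff: "frag_lift G \<phi> (x - y) = frag_lift G \<phi> x \<otimes>\<^bsub>G\<^esub> inv\<^bsub>G\<^esub> frag_lift G \<phi> y"
    if "x \<in> carrier F" "y \<in> carrier F" for x y
    using h.hom_mult[of x "- y"] h.hom_inv[of y] that by simp
  have of: "frag_lift G \<phi> (frag_of (n, m)) = \<phi> (n, m)" "\<phi> (n, m) \<in> carrier G"
    if "n \<in> carrier N" "m \<in> carrier M" for n m
    using \<phi> that by (auto simp: balanced_def intro!: G.frag_lift_frag_of)
  have "tensor_relations R N M \<subseteq> kernel F G (frag_lift G \<phi>)"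
  proof
    fix x assume x: "x \<in> tensor_relations R N M"
    then have "x \<in> carrier F" using relations_subset by blast
    moreover from x have "frag_lift G \<phi> x = \<one>\<^bsub>G\<^esub>"
      unfolding tensor_relations_def
    proof (elim UnE CollectE exE conjE)
      fix n n' m assume "x = frag_of (n \<oplus>\<^bsub>N\<^esub> n', m) - frag_of (n, m) - frag_of (n', m)"
        and *: "n \<in> carrier N" "n' \<in> carrier N" "m \<in> carrier M"
      then have "frag_lift G \<phi> x = \<phi> (n \<oplus>\<^bsub>N\<^esub> n', m) \<otimes>\<^bsub>G\<^esub> inv\<^bsub>G\<^esub> \<phi> (n, m) \<otimes>\<^bsub>G\<^esub> inv\<^bsub>G\<^esub> \<phi> (n', m)"
        by (simp add: diff of F_diff_closed del: carrier_free_Abelian_group_iff)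
      also have "\<phi> (n \<oplus>\<^bsub>N\<^esub> n', m) = \<phi> (n', m) \<otimes>\<^bsub>G\<^esub> \<phi> (n, m)"
        using \<phi> * by (simp add: balanced_def G.m_comm)
      finally show ?thesis using * by (simp add: of G.m_assoc)
    next
      fix n m m' assume "x = frag_of (n, m \<oplus>\<^bsub>M\<^esub> m') - frag_of (n, m) - frag_of (n, m')"
        and *: "n \<in> carrier N" "m \<in> carrier M" "m' \<in> carrier M"
      then have "frag_lift G \<phi> x = \<phi> (n, m \<oplus>\<^bsub>M\<^esub> m') \<otimes>\<^bsub>G\<^esub> inv\<^bsub>G\<^esub> \<phi> (n, m) \<otimes>\<^bsub>G\<^esub> inv\<^bsub>G\<^esub> \<phi> (n, m')"
        by (simp add: diff of F_diff_closed del: carrier_free_Abelian_group_iff)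
      also have "\<phi> (n, m \<oplus>\<^bsub>M\<^esub> m') = \<phi> (n, m') \<otimes>\<^bsub>G\<^esub> \<phi> (n, m)"
        using \<phi> * by (simp add: balanced_def G.m_comm)
      finally show ?thesis using * by (simp add: of G.m_assoc)
    next
      fix r n m assume "x = frag_of (r \<odot>\<^bsub>N\<^esub> n, m) - frag_of (n, r \<odot>\<^bsub>M\<^esub> m)"
        and *: "r \<in> carrier R" "n \<in> carrier N" "m \<in> carrier M"
      then show ?thesis
        using \<phi> by (simp add: diff of smult_closed_N smult_closed_M balanced_def
            del: carrier_free_Abelian_group_iff)
    qed
    ultimately show "x \<in> kernel F G (frag_lift G \<phi>)" by (simp add: kernel_def)
  qed
  then have "S \<subseteq> kernel F G (frag_lift G \<phi>)"
    unfolding tensor_subgroup_def by (rule F.generate_subgroup_incl[OF _ sub])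
  then show "f \<in> S \<Longrightarrow> frag_lift G \<phi> f = \<one>\<^bsub>G\<^esub>" by (auto simp: kernel_def)
qed

text \<open>The additive extension of \<open>\<phi>\<close> kills \<open>S\<close> and is therefore
  constant on a coset; the image is a singleton, as \<open>the_elem\<close> requires.\<close>

lemma tensor_lift_coset:
  assumes "x \<in> carrier F"
  shows "tensor_lift G \<phi> (S #>\<^bsub>F\<^esub> x) = frag_lift G \<phi> x"
proof -
  have "\<phi> ` (carrier N \<times> carrier M) \<subseteq> carrier G" using \<phi> by (auto simp: balanced_def)
  then have hom: "frag_lift G \<phi> \<in> hom F G" by (rule G.frag_lift_hom)
  have "frag_lift G \<phi> y = frag_lift G \<phi> x" if y: "y \<in> S #>\<^bsub>F\<^esub> x" for y
  proof -
    obtain s where s: "s \<in> S" "y = s \<otimes>\<^bsub>F\<^esub> x" using y by (auto simp: r_coset_def)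
    then have "s \<in> carrier F" using S.subset by blast
    then show ?thesis
      using hom_mult[OF hom, of s x] s assms frag_lift_vanishes hom_in_carrier[OF hom assms] by simp
  qed
  then have "frag_lift G \<phi> ` (S #>\<^bsub>F\<^esub> x) = (\<lambda>_. frag_lift G \<phi> x) ` (S #>\<^bsub>F\<^esub> x)"
    by (intro image_cong refl)
  also have "\<dots> = {frag_lift G \<phi> x}"
    by (rule image_constant) (rule F.rcos_self[OF assms S.subgroup_axioms])
  finally have "frag_lift G \<phi> ` (S #>\<^bsub>F\<^esub> x) = {frag_lift G \<phi> x}" .
  then show ?thesis by (simp add: tensor_lift_def frag_lift_def[abs_def])
qed

lemma tensor_lift_hom: "tensor_lift G \<phi> \<in> hom T G"
proof -
  have "\<phi> ` (carrier N \<times> carrier M) \<subseteq> carrier G" using \<phi> by (auto simp: balanced_def)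
  then have hom: "frag_lift G \<phi> \<in> hom F G" by (rule G.frag_lift_hom)
  show ?thesis
  proof (rule homI)
    show "tensor_lift G \<phi> X \<in> carrier G" if "X \<in> carrier T" for X
      using that hom_in_carrier[OF hom] unfolding T_carrier by (auto simp: tensor_lift_coset)
    fix X Y assume "X \<in> carrier T" "Y \<in> carrier T"
    then obtain x y where xy: "x \<in> carrier F" "y \<in> carrier F" "X = S #>\<^bsub>F\<^esub> x" "Y = S #>\<^bsub>F\<^esub> y"
      unfolding T_carrier by auto
    moreover have "x + y \<in> carrier F" using F.m_closed[OF xy(1,2)] by simp
    ultimately show "tensor_lift G \<phi> (X \<otimes>\<^bsub>T\<^esub> Y) = tensor_lift G \<phi> X \<otimes>\<^bsub>G\<^esub> tensor_lift G \<phi> Y"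
      using hom_mult[OF hom xy(1,2)] by (simp only: T_mult tensor_lift_coset mult_free_Abelian_group)
  qed
qed

lemma tensor_lift_pt:
  assumes "n \<in> carrier N" "m \<in> carrier M"
  shows "tensor_lift G \<phi> (pt n m) = \<phi> (n, m)"
proof -
  have "\<phi> (n, m) \<in> carrier G" using \<phi> assms by (auto simp: balanced_def)
  then show ?thesis
    unfolding pure_tensor_def using assms by (simp add: tensor_lift_coset G.frag_lift_frag_of)
qed

end

text \<open>The separability idempotent is taken apart in this form: a list of pairs can be
  evaluated in other groups, and its entries can be lifted from a quotient.\<close>

lemma T_finite_sum:
  assumes "X \<in> carrier T"
  obtains ps where "set ps \<subseteq> carrier N \<times> carrier M"
    "X = foldr (\<lambda>(n, m) Y. pt n m \<otimes>\<^bsub>T\<^esub> Y) ps \<one>\<^bsub>T\<^esub>"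
proof -
  have cl: "foldr (\<lambda>(n, m) Y. pt n m \<otimes>\<^bsub>T\<^esub> Y) ps \<one>\<^bsub>T\<^esub> \<in> carrier T"
    if "set ps \<subseteq> carrier N \<times> carrier M" for ps
    using that by (induction ps) auto
  have "\<exists>ps. set ps \<subseteq> carrier N \<times> carrier M \<and> X = foldr (\<lambda>(n, m) Y. pt n m \<otimes>\<^bsub>T\<^esub> Y) ps \<one>\<^bsub>T\<^esub>"
    using assms
  proof (induction rule: T_induct)
    case (pt n m)
    then show ?case by (intro exI[of _ "[(n, m)]"]) auto
  next
    case (mult X Y)
    then obtain ps qs where ps: "set ps \<subseteq> carrier N \<times> carrier M"
      "X = foldr (\<lambda>(n, m) Y. pt n m \<otimes>\<^bsub>T\<^esub> Y) ps \<one>\<^bsub>T\<^esub>"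
      and qs: "set qs \<subseteq> carrier N \<times> carrier M"
      "Y = foldr (\<lambda>(n, m) Y. pt n m \<otimes>\<^bsub>T\<^esub> Y) qs \<one>\<^bsub>T\<^esub>" by blast
    have "foldr (\<lambda>(n, m) Y. pt n m \<otimes>\<^bsub>T\<^esub> Y) ps Y = foldr (\<lambda>(n, m) Y. pt n m \<otimes>\<^bsub>T\<^esub> Y) ps \<one>\<^bsub>T\<^esub> \<otimes>\<^bsub>T\<^esub> Y"
      using ps(1) mult(2) by (induction ps) (auto simp: T.m_assoc cl)
    then show ?case using ps qs by (intro exI[of _ "ps @ qs"]) auto
  qed
  then show thesis using that by blast
qed

end

section \<open>Tensor products of algebras\<close>

context assoc_algebra
begin

lemma assoc_algebra_op_ring: "assoc_algebra K (op_ring A)"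
proof -
  interpret O: ring "op_ring A" by (rule ring_op_ring[OF A.ring_axioms])
  have [simp]: "smult (op_ring A) = smult A" by (simp add: op_ring_def)
  have "Module.module K (op_ring A)"
    by (rule moduleI)
      (auto simp: smult_l_distr smult_r_distr smult_assoc1 intro: K.is_cring O.abelian_group_axioms)
  then show ?thesis
    by (intro assoc_algebra.intro assoc_algebra_axioms.intro K.field_axioms O.ring_axioms)
      (auto simp: smult_mult_left smult_mult_right)
qed

end

lemma smult_op_ring [simp]: "smult (op_ring A) = smult A"
  by (simp add: op_ring_def)

locale algebra_tensor_product = A: assoc_algebra K A + B: assoc_algebra K B
  for K :: "('k, 'x) ring_scheme" and A :: "('k, 'a, 'y) module_scheme"
    and B :: "('k, 'b, 'z) module_scheme"
begin

sublocale tensor_product K A B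
  by unfold_locales auto

abbreviation "E \<equiv> tensor_algebra K A B"

lemma E_simps [simp]:
  "carrier E = carrier T" "\<one>\<^bsub>E\<^esub> = pt \<one>\<^bsub>A\<^esub> \<one>\<^bsub>B\<^esub>" "\<zero>\<^bsub>E\<^esub> = \<one>\<^bsub>T\<^esub>" "add E = monoid.mult T"
  by (simp_all add: tensor_algebra_def Let_def)

text \<open>The inner lift in the product of \<open>tensor_algebra\<close>, that is, left
  multiplication by the pure tensor of \<open>a\<close> and \<open>b\<close>.\<close>

definition mult_by :: "'a \<Rightarrow> 'b \<Rightarrow> ('a \<times> 'b \<Rightarrow>\<^sub>0 int) set \<Rightarrow> ('a \<times> 'b \<Rightarrow>\<^sub>0 int) set" where
  "mult_by a b = tensor_lift T (\<lambda>(a', b'). pt (a \<otimes>\<^bsub>A\<^esub> a') (b \<otimes>\<^bsub>B\<^esub> b'))"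

lemma E_mult: "X \<otimes>\<^bsub>E\<^esub> Y = tensor_lift T (\<lambda>(a, b). mult_by a b Y) X"
  by (simp add: tensor_algebra_def Let_def mult_by_def)

lemma mult_by:
  assumes "a \<in> carrier A" "b \<in> carrier B"
  shows mult_by_hom: "mult_by a b \<in> hom T T"
    and mult_by_pt: "\<lbrakk>a' \<in> carrier A; b' \<in> carrier B\<rbrakk>
      \<Longrightarrow> mult_by a b (pt a' b') = pt (a \<otimes>\<^bsub>A\<^esub> a') (b \<otimes>\<^bsub>B\<^esub> b')"
proof -
  have bal: "balanced K A B T (\<lambda>(a', b'). pt (a \<otimes>\<^bsub>A\<^esub> a') (b \<otimes>\<^bsub>B\<^esub> b'))"
    using assms
    by (auto simp: balanced_def A.A.r_distr B.A.r_distr pt_add_left pt_add_right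
        A.smult_mult_right B.smult_mult_right pt_smult)
  show "mult_by a b \<in> hom T T"
    unfolding mult_by_def by (rule tensor_lift_hom[OF T.comm_group_axioms bal])
  show "mult_by a b (pt a' b') = pt (a \<otimes>\<^bsub>A\<^esub> a') (b \<otimes>\<^bsub>B\<^esub> b')"
    if "a' \<in> carrier A" "b' \<in> carrier B"
    unfolding mult_by_def using tensor_lift_pt[OF T.comm_group_axioms bal that] by simp
qed

lemmas mult_by_mult = hom_mult[OF mult_by_hom]

lemma mult_by_closed: "\<lbrakk>a \<in> carrier A; b \<in> carrier B; Y \<in> carrier T\<rbrakk> \<Longrightarrow> mult_by a b Y \<in> carrier T"
  using mult_by_hom by (rule hom_in_carrier)

lemma balanced_mult_by:
  assumes "Y \<in> carrier T"
  shows "balanced K A B T (\<lambda>(a, b). mult_by a b Y)"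
  unfolding balanced_def
proof (intro conjI ballI; simp only: prod.case)
  fix a a' b assume "a \<in> carrier A" "a' \<in> carrier A" "b \<in> carrier B"
  with assms show "mult_by (a \<oplus>\<^bsub>A\<^esub> a') b Y = mult_by a b Y \<otimes>\<^bsub>T\<^esub> mult_by a' b Y"
    by (induction rule: T_induct)
      (simp_all add: mult_by_pt A.A.l_distr pt_add_left mult_by_mult mult_by_closed T.m_ac)
next
  fix a b b' assume "a \<in> carrier A" "b \<in> carrier B" "b' \<in> carrier B"
  with assms show "mult_by a (b \<oplus>\<^bsub>B\<^esub> b') Y = mult_by a b Y \<otimes>\<^bsub>T\<^esub> mult_by a b' Y"
    by (induction rule: T_induct)
      (simp_all add: mult_by_pt B.A.l_distr pt_add_right mult_by_mult mult_by_closed T.m_ac)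
next
  fix c a b assume "c \<in> carrier K" "a \<in> carrier A" "b \<in> carrier B"
  with assms show "mult_by (c \<odot>\<^bsub>A\<^esub> a) b Y = mult_by a (c \<odot>\<^bsub>B\<^esub> b) Y"
    by (induction rule: T_induct)
      (simp_all add: mult_by_pt A.smult_mult_left B.smult_mult_left pt_smult mult_by_mult)
qed (use assms in \<open>auto intro: mult_by_closed\<close>)

lemma E_mult_hom: "Y \<in> carrier T \<Longrightarrow> (\<lambda>X. X \<otimes>\<^bsub>E\<^esub> Y) \<in> hom T T"
  unfolding E_mult by (rule tensor_lift_hom[OF T.comm_group_axioms balanced_mult_by])

lemma E_mult_pt_left:
  "\<lbrakk>Y \<in> carrier T; a \<in> carrier A; b \<in> carrier B\<rbrakk> \<Longrightarrow> pt a b \<otimes>\<^bsub>E\<^esub> Y = mult_by a b Y"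
  unfolding E_mult using tensor_lift_pt[OF T.comm_group_axioms balanced_mult_by] by simp

lemma E_mult_pt:
  "\<lbrakk>a \<in> carrier A; b \<in> carrier B; a' \<in> carrier A; b' \<in> carrier B\<rbrakk>
    \<Longrightarrow> pt a b \<otimes>\<^bsub>E\<^esub> pt a' b' = pt (a \<otimes>\<^bsub>A\<^esub> a') (b \<otimes>\<^bsub>B\<^esub> b')"
  by (simp add: E_mult_pt_left mult_by_pt)

lemma E_mult_closed: "\<lbrakk>X \<in> carrier T; Y \<in> carrier T\<rbrakk> \<Longrightarrow> X \<otimes>\<^bsub>E\<^esub> Y \<in> carrier T"
  using hom_in_carrier[OF E_mult_hom] .

lemma E_l_distr: "\<lbrakk>X \<in> carrier T; Y \<in> carrier T; Z \<in> carrier T\<rbrakk>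
    \<Longrightarrow> (X \<otimes>\<^bsub>T\<^esub> Y) \<otimes>\<^bsub>E\<^esub> Z = (X \<otimes>\<^bsub>E\<^esub> Z) \<otimes>\<^bsub>T\<^esub> (Y \<otimes>\<^bsub>E\<^esub> Z)"
  using hom_mult[OF E_mult_hom] .

lemma E_r_distr:
  assumes "X \<in> carrier T" "Y \<in> carrier T" "Z \<in> carrier T"
  shows "Z \<otimes>\<^bsub>E\<^esub> (X \<otimes>\<^bsub>T\<^esub> Y) = (Z \<otimes>\<^bsub>E\<^esub> X) \<otimes>\<^bsub>T\<^esub> (Z \<otimes>\<^bsub>E\<^esub> Y)"
  using assms(3,1,2)
  by (induction rule: T_induct)
    (simp_all add: E_mult_pt_left mult_by_mult E_l_distr E_mult_closed T.m_ac)

text \<open>Both sides are additive in each factor, so the factors are reduced to pure tensors one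
  at a time, beginning with the last.\<close>

lemma E_assoc:
  assumes "X \<in> carrier T" "Y \<in> carrier T" "Z \<in> carrier T"
  shows "(X \<otimes>\<^bsub>E\<^esub> Y) \<otimes>\<^bsub>E\<^esub> Z = X \<otimes>\<^bsub>E\<^esub> (Y \<otimes>\<^bsub>E\<^esub> Z)"
proof -
  have pt3: "(pt a b \<otimes>\<^bsub>E\<^esub> pt a' b') \<otimes>\<^bsub>E\<^esub> Z = pt a b \<otimes>\<^bsub>E\<^esub> (pt a' b' \<otimes>\<^bsub>E\<^esub> Z)"
    if "a \<in> carrier A" "b \<in> carrier B" "a' \<in> carrier A" "b' \<in> carrier B" for a b a' b'
    using assms(3)
    by (induction rule: T_induct)
      (use that in \<open>simp_all add: E_mult_pt E_r_distr E_mult_closed A.m_assoc B.m_assoc\<close>)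
  have pt2: "(pt a b \<otimes>\<^bsub>E\<^esub> Y) \<otimes>\<^bsub>E\<^esub> Z = pt a b \<otimes>\<^bsub>E\<^esub> (Y \<otimes>\<^bsub>E\<^esub> Z)"
    if "a \<in> carrier A" "b \<in> carrier B" for a b
    using assms(2)
    by (induction rule: T_induct)
      (use that assms(3) pt3 in \<open>simp_all add: E_l_distr E_r_distr E_mult_closed\<close>)
  show ?thesis
    using assms(1)
    by (induction rule: T_induct)
      (use assms(2,3) pt2 in \<open>simp_all add: E_l_distr E_mult_closed\<close>)
qed

lemma ring_E: "ring E"
proof (rule ringI)
  show "abelian_group E"
    by (rule abelian_groupI) (auto simp: T.m_ac intro: T.l_inv_ex)
  have "pt \<one>\<^bsub>A\<^esub> \<one>\<^bsub>B\<^esub> \<otimes>\<^bsub>E\<^esub> X = X" if "X \<in> carrier T" for X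
    using that by (induction rule: T_induct) (simp_all add: E_mult_pt E_r_distr)
  moreover have "X \<otimes>\<^bsub>E\<^esub> pt \<one>\<^bsub>A\<^esub> \<one>\<^bsub>B\<^esub> = X" if "X \<in> carrier T" for X
    using that by (induction rule: T_induct) (simp_all add: E_mult_pt E_l_distr)
  ultimately show "monoid E"
    by (intro monoidI) (auto simp: E_mult_closed E_assoc)
qed (simp_all add: E_l_distr E_r_distr)

end

section \<open>The enveloping algebra and \<open>A\<close> as a module over it\<close>

locale envelope = assoc_algebra K A
  for K :: "('k, 'x) ring_scheme" and A :: "('k, 'a, 'y) module_scheme"
begin

sublocale T: algebra_tensor_product K A "op_ring A"
  by (intro algebra_tensor_product.intro assoc_algebra_axioms assoc_algebra_op_ring)

abbreviation "Ae \<equiv> enveloping_algebra K A"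

lemma Ae_eq: "Ae = tensor_algebra K A (op_ring A)"
  by (simp add: enveloping_algebra_def)

sublocale Ae: ring Ae
  unfolding Ae_eq by (rule T.ring_E)

definition left_unit :: "'a \<Rightarrow> ('a \<times> 'a \<Rightarrow>\<^sub>0 int) set" where
  "left_unit a = pure_tensor K A (op_ring A) a \<one>\<^bsub>A\<^esub>"

definition right_unit :: "'a \<Rightarrow> ('a \<times> 'a \<Rightarrow>\<^sub>0 int) set" where
  "right_unit b = pure_tensor K A (op_ring A) \<one>\<^bsub>A\<^esub> b"

lemma unit_closed [simp]:
  "a \<in> carrier A \<Longrightarrow> left_unit a \<in> carrier Ae" "a \<in> carrier A \<Longrightarrow> right_unit a \<in> carrier Ae"
  by (simp_all add: Ae_eq left_unit_def right_unit_def)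

lemma pt_eq_units:
  assumes "a \<in> carrier A" "b \<in> carrier A"
  shows "pure_tensor K A (op_ring A) a b = left_unit a \<otimes>\<^bsub>Ae\<^esub> right_unit b"
  using assms T.E_mult_pt by (simp add: left_unit_def right_unit_def Ae_eq)

lemma units_commute:
  assumes "a \<in> carrier A" "b \<in> carrier A"
  shows "left_unit a \<otimes>\<^bsub>Ae\<^esub> right_unit b = right_unit b \<otimes>\<^bsub>Ae\<^esub> left_unit a"
  using assms T.E_mult_pt by (simp add: left_unit_def right_unit_def Ae_eq)

lemma left_unit_mult:
  "\<lbrakk>a \<in> carrier A; b \<in> carrier A\<rbrakk> \<Longrightarrow> left_unit (a \<otimes>\<^bsub>A\<^esub> b) = left_unit a \<otimes>\<^bsub>Ae\<^esub> left_unit b"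
  using T.E_mult_pt by (simp add: left_unit_def Ae_eq)

lemma right_unit_mult:
  "\<lbrakk>a \<in> carrier A; b \<in> carrier A\<rbrakk> \<Longrightarrow> right_unit (a \<otimes>\<^bsub>A\<^esub> b) = right_unit b \<otimes>\<^bsub>Ae\<^esub> right_unit a"
  using T.E_mult_pt by (simp add: right_unit_def Ae_eq)

lemma left_unit_add:
  "\<lbrakk>a \<in> carrier A; b \<in> carrier A\<rbrakk> \<Longrightarrow> left_unit (a \<oplus>\<^bsub>A\<^esub> b) = left_unit a \<oplus>\<^bsub>Ae\<^esub> left_unit b"
  using T.pt_add_left by (simp add: left_unit_def Ae_eq)

lemma right_unit_add:
  "\<lbrakk>a \<in> carrier A; b \<in> carrier A\<rbrakk> \<Longrightarrow> right_unit (a \<oplus>\<^bsub>A\<^esub> b) = right_unit a \<oplus>\<^bsub>Ae\<^esub> right_unit b"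
  using T.pt_add_right by (simp add: right_unit_def Ae_eq)

lemma unit_one: "left_unit \<one>\<^bsub>A\<^esub> = \<one>\<^bsub>Ae\<^esub>" "right_unit \<one>\<^bsub>A\<^esub> = \<one>\<^bsub>Ae\<^esub>"
  by (simp_all add: left_unit_def right_unit_def Ae_eq)

text \<open>The tensor product is taken over \<open>K\<close>, so scalars act alike on both sides.
  This is what makes maps assembled from the two actions balanced over \<open>K\<close>.\<close>

lemma unit_scalar:
  "c \<in> carrier K \<Longrightarrow> left_unit (c \<odot>\<^bsub>A\<^esub> \<one>\<^bsub>A\<^esub>) = right_unit (c \<odot>\<^bsub>A\<^esub> \<one>\<^bsub>A\<^esub>)"
  using T.pt_smult by (simp add: left_unit_def right_unit_def)

text \<open>Products of a left and a right unit generate \<open>Ae\<close> additively, so statements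
  on bimodules split into a left and a right part.\<close>

lemma Ae_induct [consumes 1, case_names unit add]:
  assumes "u \<in> carrier Ae"
    and "\<And>a b. \<lbrakk>a \<in> carrier A; b \<in> carrier A\<rbrakk> \<Longrightarrow> Q (left_unit a \<otimes>\<^bsub>Ae\<^esub> right_unit b)"
    and "\<And>u v. \<lbrakk>u \<in> carrier Ae; v \<in> carrier Ae; Q u; Q v\<rbrakk> \<Longrightarrow> Q (u \<oplus>\<^bsub>Ae\<^esub> v)"
  shows "Q u"
proof -
  have "u \<in> carrier (tensor_group K A (op_ring A))" using assms(1) by (simp add: Ae_eq)
  then show ?thesis
    by (induction rule: T.T_induct) (use assms(2,3) in \<open>auto simp: pt_eq_units Ae_eq\<close>)
qed

abbreviation "AL \<equiv> bimodule_left A"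
abbreviation "AR \<equiv> bimodule_right A"

lemma bimodule_simps [simp]:
  "carrier AL = carrier A" "\<zero>\<^bsub>AL\<^esub> = \<zero>\<^bsub>A\<^esub>" "add AL = add A"
  "carrier AR = carrier A" "\<zero>\<^bsub>AR\<^esub> = \<zero>\<^bsub>A\<^esub>" "add AR = add A"
  by (simp_all add: bimodule_left_def bimodule_right_def)

lemma AL_smult:
  assumes "x \<in> carrier A"
  shows AL_smult_hom: "(\<lambda>u. u \<odot>\<^bsub>AL\<^esub> x) \<in> hom (tensor_group K A (op_ring A)) (add_monoid A)"
    and AL_smult_unit: "\<lbrakk>a \<in> carrier A; b \<in> carrier A\<rbrakk>
      \<Longrightarrow> (left_unit a \<otimes>\<^bsub>Ae\<^esub> right_unit b) \<odot>\<^bsub>AL\<^esub> x = a \<otimes>\<^bsub>A\<^esub> x \<otimes>\<^bsub>A\<^esub> b"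
proof -
  have bal: "balanced K A (op_ring A) (add_monoid A) (\<lambda>(a, b). a \<otimes>\<^bsub>A\<^esub> x \<otimes>\<^bsub>A\<^esub> b)"
    using assms
    by (auto simp: balanced_def A.l_distr A.r_distr smult_mult_left smult_mult_right)
  show "(\<lambda>u. u \<odot>\<^bsub>AL\<^esub> x) \<in> hom (tensor_group K A (op_ring A)) (add_monoid A)"
    using T.tensor_lift_hom[OF M.a_comm_group bal] by (simp add: bimodule_left_def)
  show "(left_unit a \<otimes>\<^bsub>Ae\<^esub> right_unit b) \<odot>\<^bsub>AL\<^esub> x = a \<otimes>\<^bsub>A\<^esub> x \<otimes>\<^bsub>A\<^esub> b"
    if "a \<in> carrier A" "b \<in> carrier A"
    using T.tensor_lift_pt[OF M.a_comm_group bal] that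
    by (simp add: bimodule_left_def pt_eq_units)
qed

lemma AR_smult_closed:
  assumes "u \<in> carrier Ae" "x \<in> carrier A"
  shows "u \<odot>\<^bsub>AR\<^esub> x \<in> carrier A"
proof -
  have bal: "balanced K A (op_ring A) (add_monoid A) (\<lambda>(a, b). b \<otimes>\<^bsub>A\<^esub> x \<otimes>\<^bsub>A\<^esub> a)"
    using assms(2)
    by (auto simp: balanced_def A.l_distr A.r_distr smult_mult_left smult_mult_right)
  show ?thesis
    using hom_in_carrier[OF T.tensor_lift_hom[OF M.a_comm_group bal]] assms(1)
    by (simp add: bimodule_right_def Ae_eq)
qed

lemma AL_closed: "\<lbrakk>u \<in> carrier Ae; x \<in> carrier A\<rbrakk> \<Longrightarrow> u \<odot>\<^bsub>AL\<^esub> x \<in> carrier A"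
  using hom_in_carrier[OF AL_smult_hom] by (simp add: Ae_eq)

lemma AL_l_distr: "\<lbrakk>u \<in> carrier Ae; v \<in> carrier Ae; x \<in> carrier A\<rbrakk>
    \<Longrightarrow> (u \<oplus>\<^bsub>Ae\<^esub> v) \<odot>\<^bsub>AL\<^esub> x = u \<odot>\<^bsub>AL\<^esub> x \<oplus>\<^bsub>A\<^esub> v \<odot>\<^bsub>AL\<^esub> x"
  using hom_mult[OF AL_smult_hom] by (simp add: Ae_eq)

lemma AL_r_distr:
  assumes "u \<in> carrier Ae" "x \<in> carrier A" "y \<in> carrier A"
  shows "u \<odot>\<^bsub>AL\<^esub> (x \<oplus>\<^bsub>A\<^esub> y) = u \<odot>\<^bsub>AL\<^esub> x \<oplus>\<^bsub>A\<^esub> u \<odot>\<^bsub>AL\<^esub> y"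
  using assms
  by (induction rule: Ae_induct)
    (simp_all add: AL_smult_unit AL_l_distr AL_closed A.l_distr A.r_distr M.a_ac)

lemma AL_assoc:
  assumes "u \<in> carrier Ae" "v \<in> carrier Ae" "x \<in> carrier A"
  shows "(u \<otimes>\<^bsub>Ae\<^esub> v) \<odot>\<^bsub>AL\<^esub> x = u \<odot>\<^bsub>AL\<^esub> (v \<odot>\<^bsub>AL\<^esub> x)"
  using assms
proof (induction rule: Ae_induct)
  case (unit a b)
  from unit(3,1,2,4) show ?case
  proof (induction rule: Ae_induct)
    case (unit a' b')
    have "(left_unit a \<otimes>\<^bsub>Ae\<^esub> right_unit b) \<otimes>\<^bsub>Ae\<^esub> (left_unit a' \<otimes>\<^bsub>Ae\<^esub> right_unit b')
      = left_unit (a \<otimes>\<^bsub>A\<^esub> a') \<otimes>\<^bsub>Ae\<^esub> right_unit (b' \<otimes>\<^bsub>A\<^esub> b)"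
      using unit T.E_mult_pt by (simp add: pt_eq_units[symmetric]) (simp add: Ae_eq)
    then show ?case using unit by (simp add: AL_smult_unit A.m_assoc)
  qed (simp_all add: AL_l_distr AL_r_distr AL_closed Ae.r_distr)
qed (simp_all add: AL_l_distr AL_closed Ae.l_distr)

lemma lmodule_AL: "lmodule Ae AL"
proof (rule lmoduleI)
  show "abelian_group AL"
    by (rule abelian_group_cong[OF A.is_abelian_group]) simp_all
  show "\<one>\<^bsub>Ae\<^esub> \<odot>\<^bsub>AL\<^esub> x = x" if "x \<in> carrier AL" for x
    using AL_smult_unit[of x "\<one>\<^bsub>A\<^esub>" "\<one>\<^bsub>A\<^esub>"] that by (simp add: unit_one)
qed (simp_all add: Ae.ring_axioms AL_closed AL_l_distr AL_r_distr AL_assoc)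

lemma abelian_group_AR: "abelian_group AR"
  by (rule abelian_group_cong[OF A.is_abelian_group]) simp_all

end

section \<open>Vanishing of Tor and Ext\<close>

lemma trivial_group_Mod_carrier:
  assumes "comm_group G"
  shows "trivial_group (G Mod carrier G)"
proof -
  interpret comm_group G by fact
  interpret N: normal "carrier G" G
    unfolding normal_iff_subgroup by (rule subgroup_self)
  have "carrier (G Mod carrier G) = {carrier G}"
    unfolding carrier_FactGroup using coset_join2[OF _ subgroup_self] by force
  then show ?thesis
    using N.factorgroup_is_group by (simp add: trivial_group_def)
qed

text \<open>Homology and cohomology in positive degree are quotients of this shape, with cycles
  \<open>H\<close> and boundaries \<open>H'\<close>.\<close>

lemma trivial_group_exact:
  assumes "comm_group G" "subgroup H G" "H = H'"
  shows "trivial_group (G\<lparr>carrier := H\<rparr> Mod H')"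
proof -
  interpret comm_group G by fact
  interpret H: group "G\<lparr>carrier := H\<rparr>"
    by (rule subgroup.subgroup_is_group[OF assms(2) group_axioms])
  have "comm_group (G\<lparr>carrier := H\<rparr>)"
    by (rule H.group_comm_groupI) (use subgroup.subset[OF assms(2)] in \<open>auto simp: m_comm subset_iff\<close>)
  from trivial_group_Mod_carrier[OF this] show ?thesis using assms(3) by simp
qed

lemma tensor_product_lmodule:
  assumes "abelian_group N" "lmodule R P"
    and "\<And>r n. \<lbrakk>r \<in> carrier R; n \<in> carrier N\<rbrakk> \<Longrightarrow> r \<odot>\<^bsub>N\<^esub> n \<in> carrier N"
  shows "tensor_product R N P"
proof -
  interpret lmodule R P by fact
  show ?thesis
    by (intro tensor_product.intro tensor_product_axioms.intro assms(1,3) M.abelian_group_axioms smult_closed)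
qed

text \<open>Spelled like the differential inside \<open>Tor\<close>, so that unfolding identifies
  the two.\<close>

definition tensor_map ::
  "('r, 'x) ring_scheme \<Rightarrow> ('r, 'n, 'y) module_scheme \<Rightarrow> ('r, 'q, 'z) module_scheme \<Rightarrow> ('p \<Rightarrow> 'q)
     \<Rightarrow> ('n \<times> 'p \<Rightarrow>\<^sub>0 int) set \<Rightarrow> ('n \<times> 'q \<Rightarrow>\<^sub>0 int) set" where
  "tensor_map R N Q g = tensor_lift (tensor_group R N Q) (\<lambda>(n, p). pure_tensor R N Q n (g p))"

lemma tensor_map:
  assumes "tensor_product R N P" "tensor_product R N Q" "g \<in> mod_hom R P Q"
  shows tensor_map_hom: "tensor_map R N Q g \<in> hom (tensor_group R N P) (tensor_group R N Q)"
    and tensor_map_pt: "\<lbrakk>n \<in> carrier N; p \<in> carrier P\<rbrakk>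
      \<Longrightarrow> tensor_map R N Q g (pure_tensor R N P n p) = pure_tensor R N Q n (g p)"
proof -
  interpret P: tensor_product R N P by fact
  interpret Q: tensor_product R N Q by fact
  have bal: "balanced R N P Q.T (\<lambda>(n, p). Q.pt n (g p))"
    by (auto simp: balanced_def mod_homD[OF assms(3)] Q.pt_add_left Q.pt_add_right Q.pt_smult)
  show "tensor_map R N Q g \<in> hom P.T Q.T"
    unfolding tensor_map_def by (rule P.tensor_lift_hom[OF Q.T.comm_group_axioms bal])
  show "tensor_map R N Q g (P.pt n p) = Q.pt n (g p)" if "n \<in> carrier N" "p \<in> carrier P"
    unfolding tensor_map_def using P.tensor_lift_pt[OF Q.T.comm_group_axioms bal that] by simp
qed

text \<open>Tensoring carries \<open>1 = d \<tau> + \<sigma> d\<close> over to the complex, by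
  comparison on pure tensors. A cycle is then the boundary of its image under the tensored
  \<open>\<tau>\<close>.\<close>

lemma (in resolution) tensor_homology_trivial:
  assumes N: "abelian_group N" "\<And>r n. \<lbrakk>r \<in> carrier R; n \<in> carrier N\<rbrakk> \<Longrightarrow> r \<odot>\<^bsub>N\<^esub> n \<in> carrier N"
    and \<rho>: "retraction_at R P d n \<rho>"
  shows "trivial_group (homology (\<lambda>i. tensor_group R N (P i)) (\<lambda>i. tensor_map R N (P i) (d i)) (Suc n))"
proof -
  have tp: "tensor_product R N (P i)" for i
    by (rule tensor_product_lmodule[OF N(1) lmodule_P N(2)])
  let ?C = "\<lambda>i. tensor_group R N (P i)" and ?d = "\<lambda>i. tensor_map R N (P i) (d i)"
  interpret T0: tensor_product R N "P n" by (rule tp)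
  interpret T1: tensor_product R N "P (Suc n)" by (rule tp)
  interpret T2: tensor_product R N "P (Suc (Suc n))" by (rule tp)
  obtain \<sigma> \<tau> where \<sigma>: "\<sigma> \<in> mod_hom R (P n) (P (Suc n))"
    and \<tau>: "\<tau> \<in> mod_hom R (P (Suc n)) (P (Suc (Suc n)))"
    and eq: "\<And>x. x \<in> carrier (P (Suc n)) \<Longrightarrow> x = d (Suc n) (\<tau> x) \<oplus>\<^bsub>P (Suc n)\<^esub> \<sigma> (d n x)"
    by (fact contraction[OF \<rho>])
  note d_closed = mod_hom_closed[OF d_hom]
  note maps = tensor_map[OF tp tp d_hom] tensor_map[OF tp tp \<sigma>] tensor_map[OF tp tp \<tau>]
  let ?s = "tensor_map R N (P (Suc n)) \<sigma>" and ?t = "tensor_map R N (P (Suc (Suc n))) \<tau>"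
  note cl = hom_in_carrier[OF maps(1)] hom_in_carrier[OF maps(3)] hom_in_carrier[OF maps(5)]
  note hm = hom_mult[OF maps(1)] hom_mult[OF maps(3)] hom_mult[OF maps(5)]
  have split: "X = ?d (Suc n) (?t X) \<otimes>\<^bsub>T1.T\<^esub> ?s (?d n X)" if "X \<in> carrier T1.T" for X
    using that
  proof (induction rule: T1.T_induct)
    case (pt n' x)
    note x = mod_hom_closed[OF \<tau> pt(2)] d_closed[OF pt(2)]
    have "?d (Suc n) (?t (T1.pt n' x)) \<otimes>\<^bsub>T1.T\<^esub> ?s (?d n (T1.pt n' x))
      = T1.pt n' (d (Suc n) (\<tau> x)) \<otimes>\<^bsub>T1.T\<^esub> T1.pt n' (\<sigma> (d n x))"
      using pt x by (simp add: maps)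
    also have "\<dots> = T1.pt n' (d (Suc n) (\<tau> x) \<oplus>\<^bsub>P (Suc n)\<^esub> \<sigma> (d n x))"
      using pt x d_closed mod_hom_closed[OF \<sigma>] by (simp add: T1.pt_add_right)
    finally show ?case using eq[OF pt(2)] by simp
  next
    case (mult X Y)
    have "?d (Suc n) (?t (X \<otimes>\<^bsub>T1.T\<^esub> Y)) \<otimes>\<^bsub>T1.T\<^esub> ?s (?d n (X \<otimes>\<^bsub>T1.T\<^esub> Y))
      = (?d (Suc n) (?t X) \<otimes>\<^bsub>T1.T\<^esub> ?s (?d n X)) \<otimes>\<^bsub>T1.T\<^esub> (?d (Suc n) (?t Y) \<otimes>\<^bsub>T1.T\<^esub> ?s (?d n Y))"
      using mult(1,2) by (simp add: hm cl T1.T.m_ac)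
    then show ?case using mult(3,4) by simp
  qed
  have dd: "?d n (?d (Suc n) X) = \<one>\<^bsub>T0.T\<^esub>" if "X \<in> carrier T2.T" for X
    using that
    by (induction rule: T2.T_induct) (simp_all add: maps d_closed d_d hm cl)
  have s1: "?s \<one>\<^bsub>T0.T\<^esub> = \<one>\<^bsub>T1.T\<^esub>"
    by (rule hom_one[OF maps(3) T0.T.group_axioms T1.T.group_axioms])
  have ker: "kernel T1.T T0.T (?d n) \<subseteq> ?d (Suc n) ` carrier T2.T"
  proof
    fix X assume "X \<in> kernel T1.T T0.T (?d n)"
    then have X: "X \<in> carrier T1.T" "?d n X = \<one>\<^bsub>T0.T\<^esub>" by (auto simp: kernel_def)
    then have "X = ?d (Suc n) (?t X)"
      using split[OF X(1)] cl(1)[of _ "Suc n"] cl(3) by (simp add: s1)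
    then show "X \<in> ?d (Suc n) ` carrier T2.T" using cl(3) X(1) by blast
  qed
  have im: "?d (Suc n) ` carrier T2.T \<subseteq> kernel T1.T T0.T (?d n)"
    using dd cl(1) by (auto simp: kernel_def)
  interpret dn: group_hom T1.T T0.T "?d n"
    by unfold_locales (rule maps(1))
  show ?thesis
    unfolding homology_def nat.case
    by (intro trivial_group_exact T1.T.comm_group_axioms dn.subgroup_kernel subset_antisym ker im)
qed

section \<open>Hom groups and the vanishing of Ext\<close>

lemma hom_group_simps:
  "carrier (hom_group R M N) = mod_hom R M N \<inter> extensional (carrier M)"
  "\<one>\<^bsub>hom_group R M N\<^esub> = (\<lambda>x\<in>carrier M. \<zero>\<^bsub>N\<^esub>)"
  "f \<otimes>\<^bsub>hom_group R M N\<^esub> g = (\<lambda>x\<in>carrier M. f x \<oplus>\<^bsub>N\<^esub> g x)"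
  by (simp_all add: hom_group_def)

lemma restrict_mod_hom:
  assumes "lmodule R M" "f \<in> mod_hom R M N"
  shows "(\<lambda>x\<in>carrier M. f x) \<in> carrier (hom_group R M N)"
proof -
  interpret M: lmodule R M by fact
  show ?thesis
    unfolding hom_group_simps
    by (intro IntI mod_homI) (auto simp: mod_homD[OF assms(2)] M.smult_closed)
qed

lemma comm_group_hom_group:
  assumes "lmodule R M" "lmodule R N"
  shows "comm_group (hom_group R M N)"
proof -
  interpret M: lmodule R M by fact
  interpret N: lmodule R N by fact
  let ?G = "hom_group R M N"
  have cl: "f x \<in> carrier N" if "f \<in> carrier ?G" "x \<in> carrier M" for f x
    using that by (auto simp: hom_group_simps dest: mod_hom_closed)
  have ext: "f = (\<lambda>x\<in>carrier M. f x)" if "f \<in> carrier ?G" for f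
    using that by (simp add: hom_group_simps extensional_restrict)
  show ?thesis
  proof (rule comm_groupI)
    fix f g assume f: "f \<in> carrier ?G" and g: "g \<in> carrier ?G"
    show "f \<otimes>\<^bsub>?G\<^esub> g \<in> carrier ?G"
      unfolding hom_group_simps(3)
      by (rule restrict_mod_hom[OF assms(1) mod_hom_plus[OF assms(2)]]) (use f g in \<open>auto simp: hom_group_simps\<close>)
    show "f \<otimes>\<^bsub>?G\<^esub> g = g \<otimes>\<^bsub>?G\<^esub> f"
      unfolding hom_group_simps(3) by (rule restrict_ext) (use cl f g in \<open>simp add: N.a_comm\<close>)
    fix h assume h: "h \<in> carrier ?G"
    show "(f \<otimes>\<^bsub>?G\<^esub> g) \<otimes>\<^bsub>?G\<^esub> h = f \<otimes>\<^bsub>?G\<^esub> (g \<otimes>\<^bsub>?G\<^esub> h)"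
      unfolding hom_group_simps(3) by (rule restrict_ext) (use cl f g h in \<open>simp add: N.a_assoc\<close>)
  next
    show "\<one>\<^bsub>?G\<^esub> \<in> carrier ?G"
      unfolding hom_group_simps(2) by (rule restrict_mod_hom[OF assms(1) mod_hom_zero_map[OF assms(2)]])
  next
    fix f assume f: "f \<in> carrier ?G"
    have "(\<lambda>x\<in>carrier M. \<zero>\<^bsub>N\<^esub> \<oplus>\<^bsub>N\<^esub> f x) = (\<lambda>x\<in>carrier M. f x)"
      by (rule restrict_ext) (use cl f in simp)
    then show "\<one>\<^bsub>?G\<^esub> \<otimes>\<^bsub>?G\<^esub> f = f"
      using ext[OF f] by (simp add: hom_group_simps cong: restrict_cong)
    have "(\<lambda>x. \<zero>\<^bsub>N\<^esub> \<ominus>\<^bsub>N\<^esub> f x) \<in> mod_hom R M N"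
      by (rule mod_hom_diff[OF assms(2) mod_hom_zero_map[OF assms(2)]]) (use f in \<open>simp add: hom_group_simps\<close>)
    from restrict_mod_hom[OF assms(1) this]
    show "\<exists>g\<in>carrier ?G. g \<otimes>\<^bsub>?G\<^esub> f = \<one>\<^bsub>?G\<^esub>"
      by (rule bexI[rotated]) (auto simp: hom_group_simps(2,3) cl[OF f] intro!: restrict_ext)
  qed
qed

text \<open>A cocycle \<open>f\<close> kills boundaries, so \<open>1 = d \<tau> + \<sigma> d\<close>
  turns into \<open>f = f \<sigma> d\<close>, the coboundary of \<open>f \<sigma>\<close>.\<close>

lemma (in resolution) hom_cohomology_trivial:
  assumes N: "lmodule R N" and \<rho>: "retraction_at R P d n \<rho>"
  shows "trivial_group (cohomology (\<lambda>i. hom_group R (P i) N)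
    (\<lambda>i f. \<lambda>p\<in>carrier (P (Suc i)). f (d i p)) (Suc n))"
proof -
  interpret N: lmodule R N by fact
  let ?C = "\<lambda>i. hom_group R (P i) N" and ?d = "\<lambda>i f. \<lambda>p\<in>carrier (P (Suc i)). f (d i p)"
  obtain \<sigma> \<tau> where \<sigma>: "\<sigma> \<in> mod_hom R (P n) (P (Suc n))"
    and \<tau>: "\<tau> \<in> mod_hom R (P (Suc n)) (P (Suc (Suc n)))"
    and eq: "\<And>x. x \<in> carrier (P (Suc n)) \<Longrightarrow> x = d (Suc n) (\<tau> x) \<oplus>\<^bsub>P (Suc n)\<^esub> \<sigma> (d n x)"
    by (fact contraction[OF \<rho>])
  interpret C1: comm_group "?C (Suc n)" by (rule comm_group_hom_group[OF lmodule_P N])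
  interpret C2: comm_group "?C (Suc (Suc n))" by (rule comm_group_hom_group[OF lmodule_P N])
  note d_closed = mod_hom_closed[OF d_hom]
  note \<sigma>_closed = mod_hom_closed[OF \<sigma>] and \<tau>_closed = mod_hom_closed[OF \<tau>]
  have d_carrier: "?d i f \<in> carrier (?C (Suc i))" if "f \<in> carrier (?C i)" for i f
    by (rule restrict_mod_hom[OF lmodule_P mod_hom_compose[OF d_hom]]) (use that in \<open>simp add: hom_group_simps\<close>)
  have "?d (Suc n) \<in> hom (?C (Suc n)) (?C (Suc (Suc n)))"
    by (rule homI) (auto simp: d_carrier hom_group_simps(3) d_closed intro!: restrict_ext)
  then interpret d: group_hom "?C (Suc n)" "?C (Suc (Suc n))" "?d (Suc n)"
    by unfold_locales
  have "kernel (?C (Suc n)) (?C (Suc (Suc n))) (?d (Suc n)) = ?d n ` carrier (?C n)"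
  proof (intro subset_antisym subsetI)
    fix f assume "f \<in> kernel (?C (Suc n)) (?C (Suc (Suc n))) (?d (Suc n))"
    then have f: "f \<in> mod_hom R (P (Suc n)) N" "f \<in> extensional (carrier (P (Suc n)))"
      and "?d (Suc n) f = \<one>\<^bsub>?C (Suc (Suc n))\<^esub>"
      by (auto simp: kernel_def hom_group_simps(1))
    then have fd: "f (d (Suc n) y) = \<zero>\<^bsub>N\<^esub>" if "y \<in> carrier (P (Suc (Suc n)))" for y
      using that by (metis (no_types, lifting) hom_group_simps(2) restrict_apply')
    let ?g = "\<lambda>x\<in>carrier (P n). f (\<sigma> x)"
    have "f x = f (\<sigma> (d n x))" if x: "x \<in> carrier (P (Suc n))" for x
    proof -
      have "f x = f (d (Suc n) (\<tau> x) \<oplus>\<^bsub>P (Suc n)\<^esub> \<sigma> (d n x))" using eq[OF x] by (rule arg_cong)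
      also have "\<dots> = f (d (Suc n) (\<tau> x)) \<oplus>\<^bsub>N\<^esub> f (\<sigma> (d n x))"
        using x by (intro mod_hom_add[OF f(1)] d_closed \<sigma>_closed \<tau>_closed)
      also have "\<dots> = f (\<sigma> (d n x))"
        using x by (simp add: fd \<tau>_closed mod_hom_closed[OF f(1)] \<sigma>_closed d_closed)
      finally show ?thesis .
    qed
    then have "f = ?d n ?g"
      using f(2) d_closed by (intro extensionalityI[of _ "carrier (P (Suc n))"]) auto
    moreover have "?g \<in> carrier (?C n)"
      by (rule restrict_mod_hom[OF lmodule_P mod_hom_compose[OF \<sigma> f(1)]])
    ultimately show "f \<in> ?d n ` carrier (?C n)" by blast
  next
    fix f assume "f \<in> ?d n ` carrier (?C n)"
    then obtain g where g: "g \<in> carrier (?C n)" "f = ?d n g" by blast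
    have "g \<zero>\<^bsub>P n\<^esub> = \<zero>\<^bsub>N\<^esub>"
      using g(1) mod_hom_zero[OF lmodule_P N] by (simp add: hom_group_simps(1))
    then have "?d (Suc n) f = \<one>\<^bsub>?C (Suc (Suc n))\<^esub>"
      unfolding g(2) hom_group_simps(2) by (intro restrict_ext) (simp add: d_closed d_d)
    then show "f \<in> kernel (?C (Suc n)) (?C (Suc (Suc n))) (?d (Suc n))"
      using d_carrier[OF g(1)] g(2) by (simp add: kernel_def)
  qed
  then show ?thesis
    unfolding cohomology_def nat.case
    by (intro trivial_group_exact C1.comm_group_axioms d.subgroup_kernel)
qed

section \<open>Finite-dimensional vector spaces\<close>

lemma module_lmodule: "Module.module K V \<Longrightarrow> lmodule K V"
  by (intro lmoduleI)
    (auto simp: Module.module_def module_axioms_def cring.axioms(1))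

locale vector_space = lmodule K V + K?: field K
  for K :: "('k, 'x) ring_scheme" and V :: "('k, 'v, 'y) module_scheme"
begin

lemma inverse_exists:
  assumes "c \<in> carrier K" "c \<noteq> \<zero>\<^bsub>K\<^esub>"
  obtains d where "d \<in> carrier K" "d \<otimes>\<^bsub>K\<^esub> c = \<one>\<^bsub>K\<^esub>"
  using assms K.field_Units unfolding Units_def by blast

fun list_span :: "'v list \<Rightarrow> 'v set" where
  "list_span [] = {\<zero>\<^bsub>V\<^esub>}"
| "list_span (b # bs) = {c \<odot>\<^bsub>V\<^esub> b \<oplus>\<^bsub>V\<^esub> v | c v. c \<in> carrier K \<and> v \<in> list_span bs}"

lemma submodule_list_span: "set bs \<subseteq> carrier V \<Longrightarrow> submodule (list_span bs) K V"
proof (induction bs)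
  case Nil
  show ?case by (rule submoduleI) auto
next
  case (Cons b bs)
  then have IH: "submodule (list_span bs) K V" and b: "b \<in> carrier V" by auto
  note L = submoduleD[OF IH]
  show ?case
  proof (rule submoduleI)
    show "list_span (b # bs) \<subseteq> carrier V" using L(1) b by (auto intro!: smult_closed)
    show "\<zero>\<^bsub>V\<^esub> \<in> list_span (b # bs)"
      using L(2) b by (auto intro!: exI[of _ "\<zero>\<^bsub>K\<^esub>"] exI[of _ "\<zero>\<^bsub>V\<^esub>"])
  next
    fix x y assume "x \<in> list_span (b # bs)" "y \<in> list_span (b # bs)"
    then obtain c v d w where x: "x = c \<odot>\<^bsub>V\<^esub> b \<oplus>\<^bsub>V\<^esub> v" "c \<in> carrier K" "v \<in> list_span bs"
      and y: "y = d \<odot>\<^bsub>V\<^esub> b \<oplus>\<^bsub>V\<^esub> w" "d \<in> carrier K" "w \<in> list_span bs" by auto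
    have "v \<in> carrier V" "w \<in> carrier V" using x y L(1) by auto
    then have "x \<oplus>\<^bsub>V\<^esub> y = (c \<oplus>\<^bsub>K\<^esub> d) \<odot>\<^bsub>V\<^esub> b \<oplus>\<^bsub>V\<^esub> (v \<oplus>\<^bsub>V\<^esub> w)"
      using x(1,2) y(1,2) b by (simp add: smult_l_distr smult_closed M.a_ac)
    then show "x \<oplus>\<^bsub>V\<^esub> y \<in> list_span (b # bs)" using x y L(3) by auto
  next
    fix r x assume r: "r \<in> carrier K" and "x \<in> list_span (b # bs)"
    then obtain c v where x: "x = c \<odot>\<^bsub>V\<^esub> b \<oplus>\<^bsub>V\<^esub> v" "c \<in> carrier K" "v \<in> list_span bs" by auto
    have "v \<in> carrier V" using x L(1) by auto
    then have "r \<odot>\<^bsub>V\<^esub> x = (r \<otimes>\<^bsub>K\<^esub> c) \<odot>\<^bsub>V\<^esub> b \<oplus>\<^bsub>V\<^esub> r \<odot>\<^bsub>V\<^esub> v"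
      using r x(1,2) b by (simp add: smult_r_distr smult_closed smult_assoc)
    then show "r \<odot>\<^bsub>V\<^esub> x \<in> list_span (b # bs)" using r x L(6) by auto
  qed
qed

lemma list_span_superset: "\<lbrakk>set bs \<subseteq> carrier V; b \<in> set bs\<rbrakk> \<Longrightarrow> b \<in> list_span bs"
proof (induction bs)
  case (Cons a bs)
  note L = submoduleD[OF submodule_list_span[of bs]]
  show ?case
  proof (cases "b = a")
    case True
    then show ?thesis using Cons L(2)
      by (auto simp: smult_one intro!: exI[of _ "\<one>\<^bsub>K\<^esub>"] exI[of _ "\<zero>\<^bsub>V\<^esub>"])
  next
    case False
    then have "b \<in> list_span bs" using Cons by auto
    then show ?thesis using Cons L(1)
      by (auto intro!: exI[of _ "\<zero>\<^bsub>K\<^esub>"] exI[of _ b])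
  qed
qed simp

text \<open>
  The number of pivots of a subspace takes the place of its dimension; no basis is needed for it.
\<close>

fun pivots :: "'v list \<Rightarrow> 'v set \<Rightarrow> nat" where
  "pivots [] W = 0"
| "pivots (b # bs) W = pivots bs W + (if W \<inter> list_span (b # bs) \<subseteq> list_span bs then 0 else 1)"

lemma pivots_mono: "W' \<subseteq> W \<Longrightarrow> pivots bs W' \<le> pivots bs W"
proof (induction bs)
  case (Cons b bs)
  then have "W \<inter> list_span (b # bs) \<subseteq> list_span bs \<Longrightarrow> W' \<inter> list_span (b # bs) \<subseteq> list_span bs"
    by blast
  with Cons show ?case by auto
qed simp

text \<open>Gaussian elimination along the list: equal counts for nested subspaces force equal
  pivots at every stage, so where \<open>W\<close> has a vector with a new leading coordinate,
  \<open>W'\<close> has one too.\<close>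

lemma pivots_eq_imp:
  assumes "submodule W K V" "submodule W' K V" "W' \<subseteq> W" "set bs \<subseteq> carrier V"
    and "pivots bs W' = pivots bs W"
  shows "W \<inter> list_span bs \<subseteq> W'"
  using assms(4,5)
proof (induction bs)
  case Nil
  then show ?case using submoduleD(2)[OF assms(2)] by auto
next
  case (Cons b bs)
  note W = submoduleD[OF assms(1)] and W' = submoduleD[OF assms(2)]
  have b: "b \<in> carrier V" "set bs \<subseteq> carrier V" using Cons by auto
  note L = submoduleD[OF submodule_list_span[OF b(2)]]
  let ?P = "\<lambda>W. W \<inter> list_span (b # bs) \<subseteq> list_span bs"
  have "?P W \<Longrightarrow> ?P W'" using assms(3) by blast
  moreover have "pivots bs W' \<le> pivots bs W" by (rule pivots_mono[OF assms(3)])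
  ultimately have *: "pivots bs W' = pivots bs W" "?P W' \<longleftrightarrow> ?P W"
    using Cons.prems(2) unfolding pivots.simps by (auto split: if_splits simp del: list_span.simps)
  have IH: "W \<inter> list_span bs \<subseteq> W'" using Cons.IH b(2) *(1) by blast
  show ?case
  proof
    fix w assume w: "w \<in> W \<inter> list_span (b # bs)"
    show "w \<in> W'"
    proof (cases "?P W")
      case True
      then show ?thesis using w IH by blast
    next
      case False
      then obtain w' where w': "w' \<in> W'" "w' \<in> list_span (b # bs)" "w' \<notin> list_span bs"
        using *(2) by blast
      obtain c v where cv: "w = c \<odot>\<^bsub>V\<^esub> b \<oplus>\<^bsub>V\<^esub> v" "c \<in> carrier K" "v \<in> list_span bs" using w by auto
      obtain c' v' where cv': "w' = c' \<odot>\<^bsub>V\<^esub> b \<oplus>\<^bsub>V\<^esub> v'" "c' \<in> carrier K" "v' \<in> list_span bs" using w' by auto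
      have vV: "v \<in> carrier V" "v' \<in> carrier V" "w' \<in> carrier V" "w \<in> carrier V"
        using cv cv' L(1) w' W'(1) w W(1) by auto
      have "c' \<noteq> \<zero>\<^bsub>K\<^esub>" using w'(3) cv' vV b by auto
      then obtain i where i: "i \<in> carrier K" "i \<otimes>\<^bsub>K\<^esub> c' = \<one>\<^bsub>K\<^esub>" using inverse_exists cv'(2) by blast
      \<comment> \<open>This is \<open>c / c'\<close>: subtracting that multiple of
        \<open>w'\<close> from \<open>w\<close> cancels the coordinate at \<open>b\<close> and
        leaves a vector to which the induction hypothesis applies.\<close>
      let ?k = "c \<otimes>\<^bsub>K\<^esub> i"
      have k: "?k \<in> carrier K" "?k \<otimes>\<^bsub>K\<^esub> c' = c" using cv i cv' by (auto simp: R.m_assoc)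
      let ?u = "w \<ominus>\<^bsub>V\<^esub> ?k \<odot>\<^bsub>V\<^esub> w'"
      have cb: "c \<odot>\<^bsub>V\<^esub> b \<in> carrier V" "?k \<odot>\<^bsub>V\<^esub> v' \<in> carrier V" using cv b k vV by (auto intro: smult_closed)
      have kw': "?k \<odot>\<^bsub>V\<^esub> w' = c \<odot>\<^bsub>V\<^esub> b \<oplus>\<^bsub>V\<^esub> ?k \<odot>\<^bsub>V\<^esub> v'"
        using cv' k b vV by (simp add: smult_r_distr smult_closed flip: smult_assoc)
      have "?u = v \<ominus>\<^bsub>V\<^esub> ?k \<odot>\<^bsub>V\<^esub> v'"
        unfolding kw' cv(1) using cb vV by (simp add: M.add_minus_add_cancel)
      then have "?u \<in> list_span bs" using L cv cv' k by simp
      moreover have "?u \<in> W" using W w w' k assms(3) by auto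
      ultimately have "?u \<in> W'" using IH by blast
      then have "?u \<oplus>\<^bsub>V\<^esub> ?k \<odot>\<^bsub>V\<^esub> w' \<in> W'" using W'(6) w'(1) k(1) by (intro W'(3)) auto
      then show "w \<in> W'" using vV k smult_closed by simp
    qed
  qed
qed

lemma finite_dimensional_list:
  assumes "finite_dimensional K V"
  obtains bs where "set bs \<subseteq> carrier V" "list_span bs = carrier V"
proof -
  obtain B where B: "finite B" "B \<subseteq> carrier V"
    and span: "\<And>x. x \<in> carrier V \<Longrightarrow> \<exists>c\<in>B \<rightarrow> carrier K. x = finsum V (\<lambda>b. c b \<odot>\<^bsub>V\<^esub> b) B"
    using assms unfolding finite_dimensional_def by blast
  obtain bs where bs: "set bs = B" using finite_list[OF B(1)] by blast
  then have sb: "set bs \<subseteq> carrier V" using B by simp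
  note L = submoduleD[OF submodule_list_span[OF sb]]
  have "x \<in> list_span bs" if x: "x \<in> carrier V" for x
  proof -
    obtain c where c: "c \<in> B \<rightarrow> carrier K" "x = finsum V (\<lambda>b. c b \<odot>\<^bsub>V\<^esub> b) B"
      using span[OF x] by blast
    show ?thesis unfolding c(2)
      by (rule submodule_finsum[OF submodule_list_span[OF sb] B(1)])
        (use c(1) L(6) list_span_superset[OF sb] bs in auto)
  qed
  with L(1) sb show thesis by (intro that) auto
qed

text \<open>A bound together with strict growth along proper inclusions yields both chain conditions
  on subspaces.\<close>

lemma rank_exists:
  assumes "finite_dimensional K V"
  obtains rk :: "'v set \<Rightarrow> nat" and n where "\<And>W. rk W \<le> n"
    "\<And>W W'. W' \<subseteq> W \<Longrightarrow> rk W' \<le> rk W"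
    "\<And>W W'. \<lbrakk>submodule W K V; submodule W' K V; W' \<subseteq> W; rk W' = rk W\<rbrakk> \<Longrightarrow> W' = W"
proof -
  obtain bs where bs: "set bs \<subseteq> carrier V" "list_span bs = carrier V"
    by (rule finite_dimensional_list[OF assms])
  have len: "pivots cs W \<le> length cs" for cs W
    by (induction cs) auto
  show thesis
  proof (rule that)
    show "pivots bs W \<le> length bs" for W by (rule len)
    show "pivots bs W' \<le> pivots bs W" if "W' \<subseteq> W" for W W' by (rule pivots_mono[OF that])
    show "W' = W" if "submodule W K V" "submodule W' K V" "W' \<subseteq> W" "pivots bs W' = pivots bs W" for W W'
      using pivots_eq_imp[OF that(1-3) bs(1) that(4)] submoduleD(1)[OF that(1)] bs(2) that(3) by blast
  qed
qed

text \<open>A system of generators of \<open>V / U\<close> with matching functionals, written on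
  \<open>V\<close> so that no quotient space occurs. It is used with \<open>U = J\<close> for
  projectivity on the left and with \<open>U = 0\<close> for projectivity on the right.\<close>

definition coordinates_mod :: "'v set \<Rightarrow> nat \<Rightarrow> (nat \<Rightarrow> 'v) \<Rightarrow> (nat \<Rightarrow> 'v \<Rightarrow> 'k) \<Rightarrow> bool" where
  "coordinates_mod U n e \<kappa> \<longleftrightarrow>
     (\<forall>i<n. e i \<in> carrier V \<and> \<kappa> i \<in> mod_hom K V (regular_module K) \<and> (\<forall>u\<in>U. \<kappa> i u = \<zero>\<^bsub>K\<^esub>)) \<and>
     (\<forall>v\<in>carrier V. v \<ominus>\<^bsub>V\<^esub> finsum V (\<lambda>i. \<kappa> i v \<odot>\<^bsub>V\<^esub> e i) {..<n} \<in> U)"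

text \<open>Induction over a list that spans \<open>V\<close> modulo \<open>U\<close>, with
  \<open>U\<close> arbitrary: the head \<open>b\<close> is added to \<open>U\<close>, and the
  induction hypothesis gives coordinates modulo the larger space. If \<open>b\<close> is not in
  \<open>U\<close>, the coefficient of \<open>b\<close> in what remains is one more
  functional.\<close>

lemma exists_coordinates_mod_list:
  assumes "set bs \<subseteq> carrier V" "submodule U K V"
    and "\<And>v. v \<in> carrier V \<Longrightarrow> \<exists>s\<in>list_span bs. \<exists>u\<in>U. v = s \<oplus>\<^bsub>V\<^esub> u"
  shows "\<exists>n e \<kappa>. coordinates_mod U n e \<kappa>"
  using assms
proof (induction bs arbitrary: U)
  case Nil
  note U = submoduleD[OF Nil(2)]
  have "v \<in> U" if v: "v \<in> carrier V" for v
  proof -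
    obtain u where "u \<in> U" "v = \<zero>\<^bsub>V\<^esub> \<oplus>\<^bsub>V\<^esub> u" using Nil(3)[OF v] by auto
    then show ?thesis using U(1) by auto
  qed
  then show ?case by (intro exI[of _ 0]) (simp add: coordinates_mod_def)
next
  case (Cons b bs)
  have b: "b \<in> carrier V" "set bs \<subseteq> carrier V" using Cons.prems by auto
  note U = submoduleD[OF Cons.prems(2)] and L = submoduleD[OF submodule_list_span[OF b(2)]]
  let ?U = "{c \<odot>\<^bsub>V\<^esub> b \<oplus>\<^bsub>V\<^esub> u | c u. c \<in> carrier K \<and> u \<in> U}"
  have U': "submodule ?U K V"
  proof (rule submoduleI)
    show "?U \<subseteq> carrier V" using b U(1) by (auto intro!: smult_closed)
    show "\<zero>\<^bsub>V\<^esub> \<in> ?U" using b U(2) by (auto intro!: exI[of _ "\<zero>\<^bsub>K\<^esub>"] exI[of _ "\<zero>\<^bsub>V\<^esub>"])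
  next
    fix x y assume "x \<in> ?U" "y \<in> ?U"
    then obtain c v d w where x: "x = c \<odot>\<^bsub>V\<^esub> b \<oplus>\<^bsub>V\<^esub> v" "c \<in> carrier K" "v \<in> U"
      and y: "y = d \<odot>\<^bsub>V\<^esub> b \<oplus>\<^bsub>V\<^esub> w" "d \<in> carrier K" "w \<in> U" by auto
    have "v \<in> carrier V" "w \<in> carrier V" using x y U(1) by auto
    then have "x \<oplus>\<^bsub>V\<^esub> y = (c \<oplus>\<^bsub>K\<^esub> d) \<odot>\<^bsub>V\<^esub> b \<oplus>\<^bsub>V\<^esub> (v \<oplus>\<^bsub>V\<^esub> w)"
      using x(1,2) y(1,2) b by (simp add: smult_l_distr smult_closed M.a_ac)
    then show "x \<oplus>\<^bsub>V\<^esub> y \<in> ?U" using x y U(3) by auto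
  next
    fix r x assume r: "r \<in> carrier K" and "x \<in> ?U"
    then obtain c v where x: "x = c \<odot>\<^bsub>V\<^esub> b \<oplus>\<^bsub>V\<^esub> v" "c \<in> carrier K" "v \<in> U" by auto
    have "v \<in> carrier V" using x U(1) by auto
    then have "r \<odot>\<^bsub>V\<^esub> x = (r \<otimes>\<^bsub>K\<^esub> c) \<odot>\<^bsub>V\<^esub> b \<oplus>\<^bsub>V\<^esub> r \<odot>\<^bsub>V\<^esub> v"
      using r x(1,2) b by (simp add: smult_r_distr smult_closed smult_assoc)
    then show "r \<odot>\<^bsub>V\<^esub> x \<in> ?U" using r x U(6) by auto
  qed
  note UD' = submoduleD[OF U']
  have sub: "U \<subseteq> ?U"
  proof
    fix u assume "u \<in> U"
    then show "u \<in> ?U" using b U(1) by (auto intro!: exI[of _ "\<zero>\<^bsub>K\<^esub>"] exI[of _ u])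
  qed
  have "\<exists>s\<in>list_span bs. \<exists>u\<in>?U. v = s \<oplus>\<^bsub>V\<^esub> u" if v: "v \<in> carrier V" for v
  proof -
    obtain c s u where *: "v = (c \<odot>\<^bsub>V\<^esub> b \<oplus>\<^bsub>V\<^esub> s) \<oplus>\<^bsub>V\<^esub> u" "c \<in> carrier K" "s \<in> list_span bs" "u \<in> U"
      using Cons.prems(3)[OF v] by auto
    have "s \<in> carrier V" "u \<in> carrier V" using * L(1) U(1) by auto
    then have "v = s \<oplus>\<^bsub>V\<^esub> (c \<odot>\<^bsub>V\<^esub> b \<oplus>\<^bsub>V\<^esub> u)" using * b by (simp add: M.a_ac smult_closed)
    then show ?thesis using * by blast
  qed
  then obtain n e \<kappa> where coord: "coordinates_mod ?U n e \<kappa>"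
    using Cons.IH[OF b(2) U'] by meson
  then have e: "\<And>i. i < n \<Longrightarrow> e i \<in> carrier V"
    and \<kappa>: "\<And>i. i < n \<Longrightarrow> \<kappa> i \<in> mod_hom K V (regular_module K)"
      "\<And>i u. \<lbrakk>i < n; u \<in> ?U\<rbrakk> \<Longrightarrow> \<kappa> i u = \<zero>\<^bsub>K\<^esub>"
    and rest: "\<And>v. v \<in> carrier V \<Longrightarrow> v \<ominus>\<^bsub>V\<^esub> finsum V (\<lambda>i. \<kappa> i v \<odot>\<^bsub>V\<^esub> e i) {..<n} \<in> ?U"
    by (auto simp only: coordinates_mod_def)
  \<comment> \<open>The part of \<open>v\<close> that the coordinates modulo the enlarged space
    leave over; it lies in \<open>K b + U\<close>.\<close>
  define \<pi> where "\<pi> v = v \<ominus>\<^bsub>V\<^esub> finsum V (\<lambda>i. \<kappa> i v \<odot>\<^bsub>V\<^esub> e i) {..<n}" for v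
  show ?case
  proof (cases "b \<in> U")
    case True
    have "?U \<subseteq> U" using True U by auto
    then have "?U = U" using sub by blast
    then show ?thesis using coord by (metis (no_types))
  next
    case False
    have \<kappa>_U: "\<kappa> i u = \<zero>\<^bsub>K\<^esub>" if "i < n" "u \<in> U" for i u
      using \<kappa>(2)[OF that(1)] that(2) sub by blast
    have \<kappa>_closed: "\<kappa> i v \<in> carrier K" if "i < n" "v \<in> carrier V" for i v
      using mod_hom_closed[OF \<kappa>(1)] that by auto
    have term_closed: "(\<lambda>i. \<kappa> i v \<odot>\<^bsub>V\<^esub> e i) \<in> {..<n} \<rightarrow> carrier V" if "v \<in> carrier V" for v
      using e \<kappa>_closed that by (auto intro!: smult_closed)
    have \<pi>_hom: "\<pi> \<in> mod_hom K V V"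
      unfolding \<pi>_def
    proof (intro mod_hom_diff lmodule_axioms mod_hom_id mod_homI)
      fix v assume v: "v \<in> carrier V"
      show "finsum V (\<lambda>i. \<kappa> i v \<odot>\<^bsub>V\<^esub> e i) {..<n} \<in> carrier V" by (rule M.finsum_closed[OF term_closed[OF v]])
      {
        fix w assume w: "w \<in> carrier V"
        have "finsum V (\<lambda>i. \<kappa> i (v \<oplus>\<^bsub>V\<^esub> w) \<odot>\<^bsub>V\<^esub> e i) {..<n}
          = finsum V (\<lambda>i. \<kappa> i v \<odot>\<^bsub>V\<^esub> e i \<oplus>\<^bsub>V\<^esub> \<kappa> i w \<odot>\<^bsub>V\<^esub> e i) {..<n}"
          by (rule M.finsum_cong')
            (use v w e term_closed in \<open>auto simp: mod_hom_add[OF \<kappa>(1)] smult_l_distr \<kappa>_closed Pi_def\<close>)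
        then show "finsum V (\<lambda>i. \<kappa> i (v \<oplus>\<^bsub>V\<^esub> w) \<odot>\<^bsub>V\<^esub> e i) {..<n}
          = finsum V (\<lambda>i. \<kappa> i v \<odot>\<^bsub>V\<^esub> e i) {..<n} \<oplus>\<^bsub>V\<^esub> finsum V (\<lambda>i. \<kappa> i w \<odot>\<^bsub>V\<^esub> e i) {..<n}"
          using M.finsum_addf[OF term_closed[OF v] term_closed[OF w]] by simp
      next
        fix r assume r: "r \<in> carrier K"
        have "finsum V (\<lambda>i. \<kappa> i (r \<odot>\<^bsub>V\<^esub> v) \<odot>\<^bsub>V\<^esub> e i) {..<n}
          = finsum V (\<lambda>i. r \<odot>\<^bsub>V\<^esub> (\<kappa> i v \<odot>\<^bsub>V\<^esub> e i)) {..<n}"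
          by (rule M.finsum_cong')
            (use v r e term_closed in
              \<open>auto simp: mod_hom_smult[OF \<kappa>(1)] smult_assoc \<kappa>_closed Pi_def intro!: smult_closed\<close>)
        then show "finsum V (\<lambda>i. \<kappa> i (r \<odot>\<^bsub>V\<^esub> v) \<odot>\<^bsub>V\<^esub> e i) {..<n}
          = r \<odot>\<^bsub>V\<^esub> finsum V (\<lambda>i. \<kappa> i v \<odot>\<^bsub>V\<^esub> e i) {..<n}"
          using smult_finsum[OF _ r term_closed[OF v]] by simp
      }
    qed
    \<comment> \<open>Since \<open>b\<close> is not in \<open>U\<close>, the coefficient of
      \<open>b\<close> is determined. Linearity of \<open>\<gamma>\<close> and its vanishing on
      \<open>U\<close> are both read off from this uniqueness.\<close>
    have uniq: "c = d" if h: "c \<in> carrier K" "d \<in> carrier K" "x \<in> carrier V"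
      "x \<ominus>\<^bsub>V\<^esub> c \<odot>\<^bsub>V\<^esub> b \<in> U" "x \<ominus>\<^bsub>V\<^esub> d \<odot>\<^bsub>V\<^esub> b \<in> U" for c d x
    proof (rule ccontr)
      assume "c \<noteq> d"
      then have "d \<ominus>\<^bsub>K\<^esub> c \<noteq> \<zero>\<^bsub>K\<^esub>" using h by (simp add: R.minus_eq_zero_iff)
      then obtain i where i: "i \<in> carrier K" "i \<otimes>\<^bsub>K\<^esub> (d \<ominus>\<^bsub>K\<^esub> c) = \<one>\<^bsub>K\<^esub>"
        using inverse_exists[of "d \<ominus>\<^bsub>K\<^esub> c"] h(1,2) R.minus_closed by blast
      have cd: "c \<odot>\<^bsub>V\<^esub> b \<in> carrier V" "d \<odot>\<^bsub>V\<^esub> b \<in> carrier V" using h b by (auto intro: smult_closed)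
      have "(x \<ominus>\<^bsub>V\<^esub> c \<odot>\<^bsub>V\<^esub> b) \<ominus>\<^bsub>V\<^esub> (x \<ominus>\<^bsub>V\<^esub> d \<odot>\<^bsub>V\<^esub> b) = (d \<ominus>\<^bsub>K\<^esub> c) \<odot>\<^bsub>V\<^esub> b"
        using cd h b by (simp add: M.minus_minus_left_cancel) (simp add: a_minus_def smult_l_distr smult_l_minus)
      then have "(d \<ominus>\<^bsub>K\<^esub> c) \<odot>\<^bsub>V\<^esub> b \<in> U" using U(5)[OF h(4,5)] by simp
      then have "i \<odot>\<^bsub>V\<^esub> ((d \<ominus>\<^bsub>K\<^esub> c) \<odot>\<^bsub>V\<^esub> b) \<in> U" using U(6) i by blast
      then have "b \<in> U" using i b h by (simp add: smult_one flip: smult_assoc)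
      then show False using False by blast
    qed
    have "\<exists>c. c \<in> carrier K \<and> \<pi> v \<ominus>\<^bsub>V\<^esub> c \<odot>\<^bsub>V\<^esub> b \<in> U" if v: "v \<in> carrier V" for v
    proof -
      obtain c u where cu: "\<pi> v = c \<odot>\<^bsub>V\<^esub> b \<oplus>\<^bsub>V\<^esub> u" "c \<in> carrier K" "u \<in> U"
        using rest[OF v] unfolding \<pi>_def by blast
      have "\<pi> v \<ominus>\<^bsub>V\<^esub> c \<odot>\<^bsub>V\<^esub> b = u"
        using cu U(1) b by (auto simp: M.add_minus_cancel smult_closed subset_iff)
      then show ?thesis using cu by auto
    qed
    then obtain \<gamma> where \<gamma>: "\<And>v. v \<in> carrier V \<Longrightarrow> \<gamma> v \<in> carrier K"
      "\<And>v. v \<in> carrier V \<Longrightarrow> \<pi> v \<ominus>\<^bsub>V\<^esub> \<gamma> v \<odot>\<^bsub>V\<^esub> b \<in> U" by metis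
    note \<pi>_closed = mod_hom_closed[OF \<pi>_hom]
    have \<gamma>b: "\<gamma> v \<odot>\<^bsub>V\<^esub> b \<in> carrier V" if "v \<in> carrier V" for v using \<gamma> b that by (auto intro: smult_closed)
    have \<gamma>_hom: "\<gamma> \<in> mod_hom K V (regular_module K)"
    proof (rule mod_homI)
      fix v assume v: "v \<in> carrier V"
      show "\<gamma> v \<in> carrier (regular_module K)" using \<gamma> v by simp
      {
        fix w assume w: "w \<in> carrier V"
        have "(\<pi> v \<ominus>\<^bsub>V\<^esub> \<gamma> v \<odot>\<^bsub>V\<^esub> b) \<oplus>\<^bsub>V\<^esub> (\<pi> w \<ominus>\<^bsub>V\<^esub> \<gamma> w \<odot>\<^bsub>V\<^esub> b)
          = \<pi> (v \<oplus>\<^bsub>V\<^esub> w) \<ominus>\<^bsub>V\<^esub> (\<gamma> v \<oplus>\<^bsub>K\<^esub> \<gamma> w) \<odot>\<^bsub>V\<^esub> b"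
          using v w b \<gamma>(1) \<pi>_closed \<gamma>b
          by (simp add: mod_hom_add[OF \<pi>_hom] smult_l_distr a_minus_def M.minus_add M.a_ac)
        then have "\<pi> (v \<oplus>\<^bsub>V\<^esub> w) \<ominus>\<^bsub>V\<^esub> (\<gamma> v \<oplus>\<^bsub>K\<^esub> \<gamma> w) \<odot>\<^bsub>V\<^esub> b \<in> U"
          using U(3)[OF \<gamma>(2)[OF v] \<gamma>(2)[OF w]] by simp
        then show "\<gamma> (v \<oplus>\<^bsub>V\<^esub> w) = \<gamma> v \<oplus>\<^bsub>regular_module K\<^esub> \<gamma> w"
          using uniq[of "\<gamma> (v \<oplus>\<^bsub>V\<^esub> w)" "\<gamma> v \<oplus>\<^bsub>K\<^esub> \<gamma> w" "\<pi> (v \<oplus>\<^bsub>V\<^esub> w)"] v w \<gamma> \<pi>_closed by simp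
      next
        fix r assume r: "r \<in> carrier K"
        have "r \<odot>\<^bsub>V\<^esub> (\<pi> v \<ominus>\<^bsub>V\<^esub> \<gamma> v \<odot>\<^bsub>V\<^esub> b) = \<pi> (r \<odot>\<^bsub>V\<^esub> v) \<ominus>\<^bsub>V\<^esub> (r \<otimes>\<^bsub>K\<^esub> \<gamma> v) \<odot>\<^bsub>V\<^esub> b"
          using v r b \<gamma>(1) \<pi>_closed \<gamma>b
          by (simp add: mod_hom_smult[OF \<pi>_hom] a_minus_def smult_r_distr smult_r_minus smult_assoc)
        then have "\<pi> (r \<odot>\<^bsub>V\<^esub> v) \<ominus>\<^bsub>V\<^esub> (r \<otimes>\<^bsub>K\<^esub> \<gamma> v) \<odot>\<^bsub>V\<^esub> b \<in> U"
          using U(6)[OF r \<gamma>(2)[OF v]] by simp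
        then show "\<gamma> (r \<odot>\<^bsub>V\<^esub> v) = r \<odot>\<^bsub>regular_module K\<^esub> \<gamma> v"
          using uniq[of "\<gamma> (r \<odot>\<^bsub>V\<^esub> v)" "r \<otimes>\<^bsub>K\<^esub> \<gamma> v" "\<pi> (r \<odot>\<^bsub>V\<^esub> v)"] v r \<gamma> \<pi>_closed smult_closed by simp
      }
    qed
    have \<gamma>_U: "\<gamma> u = \<zero>\<^bsub>K\<^esub>" if u: "u \<in> U" for u
    proof -
      have uV: "u \<in> carrier V" using u U(1) by auto
      have "finsum V (\<lambda>i. \<kappa> i u \<odot>\<^bsub>V\<^esub> e i) {..<n} = finsum V (\<lambda>i. \<zero>\<^bsub>V\<^esub>) {..<n}"
        by (rule M.finsum_cong') (use \<kappa>_U[OF _ u] e in auto)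
      then have "\<pi> u = u" using uV by (simp add: \<pi>_def M.finsum_zero)
      then have "u \<ominus>\<^bsub>V\<^esub> \<gamma> u \<odot>\<^bsub>V\<^esub> b \<in> U" using \<gamma>(2)[OF uV] by simp
      then show ?thesis using uniq[of "\<gamma> u" "\<zero>\<^bsub>K\<^esub>" u] \<gamma>(1)[OF uV] uV u b by simp
    qed
    let ?e = "e(n := b)" and ?\<kappa> = "\<kappa>(n := \<gamma>)"
    have "v \<ominus>\<^bsub>V\<^esub> finsum V (\<lambda>i. ?\<kappa> i v \<odot>\<^bsub>V\<^esub> ?e i) {..<Suc n} \<in> U" if v: "v \<in> carrier V" for v
    proof -
      let ?s = "finsum V (\<lambda>i. \<kappa> i v \<odot>\<^bsub>V\<^esub> e i) {..<n}"
      have s: "?s \<in> carrier V" by (rule M.finsum_closed[OF term_closed[OF v]])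
      have "finsum V (\<lambda>i. ?\<kappa> i v \<odot>\<^bsub>V\<^esub> ?e i) {..<n} = ?s"
        by (rule M.finsum_cong') (use term_closed[OF v] in auto)
      moreover have "(\<lambda>i. ?\<kappa> i v \<odot>\<^bsub>V\<^esub> ?e i) \<in> {..<n} \<rightarrow> carrier V"
        using term_closed[OF v] by (auto simp: Pi_def)
      ultimately have "finsum V (\<lambda>i. ?\<kappa> i v \<odot>\<^bsub>V\<^esub> ?e i) {..<Suc n} = \<gamma> v \<odot>\<^bsub>V\<^esub> b \<oplus>\<^bsub>V\<^esub> ?s"
        using \<gamma>b[OF v] by (simp add: lessThan_Suc)
      then have "v \<ominus>\<^bsub>V\<^esub> finsum V (\<lambda>i. ?\<kappa> i v \<odot>\<^bsub>V\<^esub> ?e i) {..<Suc n} = \<pi> v \<ominus>\<^bsub>V\<^esub> \<gamma> v \<odot>\<^bsub>V\<^esub> b"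
        using v s \<gamma>b[OF v] by (simp add: \<pi>_def a_minus_def M.minus_add M.a_ac)
      then show ?thesis using \<gamma>(2)[OF v] by simp
    qed
    then have "coordinates_mod U (Suc n) ?e ?\<kappa>"
      using e \<kappa>_U b(1) \<kappa>(1) \<gamma>_hom \<gamma>_U by (simp add: coordinates_mod_def less_Suc_eq)
    then show ?thesis by blast
  qed
qed

lemma exists_coordinates_mod:
  assumes "finite_dimensional K V" "submodule U K V"
  obtains n e \<kappa> where "coordinates_mod U n e \<kappa>"
proof -
  obtain bs where bs: "set bs \<subseteq> carrier V" "list_span bs = carrier V"
    by (rule finite_dimensional_list[OF assms(1)])
  have "\<exists>s\<in>list_span bs. \<exists>u\<in>U. v = s \<oplus>\<^bsub>V\<^esub> u" if "v \<in> carrier V" for v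
    using that submoduleD(2)[OF assms(2)] bs(2) by (intro bexI[of _ v] bexI[of _ "\<zero>\<^bsub>V\<^esub>"]) auto
  then show thesis using exists_coordinates_mod_list[OF bs(1) assms(2)] that by blast
qed

end

section \<open>The Jacobson radical of a finite-dimensional algebra\<close>

text \<open>The additive span of the products of \<open>S\<close> and \<open>U\<close>. It serves
  for the powers of \<open>J\<close> as left ideals, for \<open>P J\<close> and \<open>B J\<close>,
  where \<open>S\<close> is the image of \<open>J\<close> under \<open>right_unit\<close>, and for
  \<open>B J\<^sup>k\<close>.\<close>

inductive_set action_span :: "('r, 'm, 'y) module_scheme \<Rightarrow> 'r set \<Rightarrow> 'm set \<Rightarrow> 'm set"
  for M :: "('r, 'm, 'y) module_scheme" and S :: "'r set" and U :: "'m set" where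
  zero: "\<zero>\<^bsub>M\<^esub> \<in> action_span M S U"
| step: "\<lbrakk>s \<in> S; u \<in> U; v \<in> action_span M S U\<rbrakk> \<Longrightarrow> s \<odot>\<^bsub>M\<^esub> u \<oplus>\<^bsub>M\<^esub> v \<in> action_span M S U"

context lmodule
begin

lemma action_span_closed:
  assumes "S \<subseteq> carrier R" "U \<subseteq> carrier M" "x \<in> action_span M S U"
  shows "x \<in> carrier M"
  using assms(3) by induction (use assms(1,2) in \<open>auto intro!: smult_closed\<close>)

lemma action_span_add:
  assumes "S \<subseteq> carrier R" "U \<subseteq> carrier M" "x \<in> action_span M S U" "y \<in> action_span M S U"
  shows "x \<oplus>\<^bsub>M\<^esub> y \<in> action_span M S U"
  using assms(3)
proof induction
  case zero
  show ?case using assms action_span_closed by simp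
next
  case (step s u v)
  have "s \<odot>\<^bsub>M\<^esub> u \<oplus>\<^bsub>M\<^esub> v \<oplus>\<^bsub>M\<^esub> y = s \<odot>\<^bsub>M\<^esub> u \<oplus>\<^bsub>M\<^esub> (v \<oplus>\<^bsub>M\<^esub> y)"
    using step assms action_span_closed by (intro M.a_assoc) (auto intro!: smult_closed)
  then show ?case using action_span.step[OF step(1,2,4)] by simp
qed

lemma action_span_incl:
  assumes "S \<subseteq> carrier R" "U \<subseteq> carrier M" "s \<in> S" "u \<in> U"
  shows "s \<odot>\<^bsub>M\<^esub> u \<in> action_span M S U"
proof -
  have "s \<odot>\<^bsub>M\<^esub> u \<oplus>\<^bsub>M\<^esub> \<zero>\<^bsub>M\<^esub> \<in> action_span M S U"
    by (intro action_span.intros assms)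
  moreover have "s \<odot>\<^bsub>M\<^esub> u \<in> carrier M" using assms by (auto intro: smult_closed)
  ultimately show ?thesis by simp
qed

lemma action_span_smult:
  assumes "S \<subseteq> carrier R" "U \<subseteq> carrier M" "r \<in> carrier R" "x \<in> action_span M S U"
    and step: "\<And>s u. \<lbrakk>s \<in> S; u \<in> U\<rbrakk> \<Longrightarrow> r \<odot>\<^bsub>M\<^esub> (s \<odot>\<^bsub>M\<^esub> u) \<in> action_span M S U"
  shows "r \<odot>\<^bsub>M\<^esub> x \<in> action_span M S U"
  using assms(4)
proof induction
  case zero
  show ?case using assms(3) by (simp add: action_span.zero)
next
  case (step s u v)
  have "r \<odot>\<^bsub>M\<^esub> (s \<odot>\<^bsub>M\<^esub> u \<oplus>\<^bsub>M\<^esub> v) = r \<odot>\<^bsub>M\<^esub> (s \<odot>\<^bsub>M\<^esub> u) \<oplus>\<^bsub>M\<^esub> r \<odot>\<^bsub>M\<^esub> v"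
    using step(1-3) assms(1-3) action_span_closed
    by (intro smult_r_distr) (auto intro!: smult_closed)
  then show ?case
    using action_span_add[OF assms(1,2) assms(5)[OF step(1,2)] step(4)] by simp
qed

lemma submodule_action_span:
  assumes "S \<subseteq> carrier R" "U \<subseteq> carrier M"
    and "\<And>r s u. \<lbrakk>r \<in> carrier R; s \<in> S; u \<in> U\<rbrakk> \<Longrightarrow> r \<odot>\<^bsub>M\<^esub> (s \<odot>\<^bsub>M\<^esub> u) \<in> action_span M S U"
  shows "submodule (action_span M S U) R M"
proof (rule submoduleI)
  show "action_span M S U \<subseteq> carrier M" using action_span_closed[OF assms(1,2)] by blast
  show "r \<odot>\<^bsub>M\<^esub> x \<in> action_span M S U" if "r \<in> carrier R" "x \<in> action_span M S U" for r x
    using action_span_smult[OF assms(1,2) that] assms(3)[OF that(1)] by blast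
qed (simp_all add: action_span.zero action_span_add[OF assms(1,2)])

lemma action_span_subset:
  assumes "submodule W R M" "\<And>s u. \<lbrakk>s \<in> S; u \<in> U\<rbrakk> \<Longrightarrow> s \<odot>\<^bsub>M\<^esub> u \<in> W"
  shows "action_span M S U \<subseteq> W"
proof
  fix x assume "x \<in> action_span M S U"
  then show "x \<in> W"
    by induction (use submoduleD[OF assms(1)] assms(2) in auto)
qed

end

text \<open>With \<open>h\<close> merely additive and \<open>W\<close> merely closed under sums,
  this covers maps that are linear on one side only, such as the right linear retractions.\<close>

lemma additive_action_span:
  assumes "abelian_group M" "abelian_group N"
    and M: "S \<subseteq> carrier R" "U \<subseteq> carrier M" "\<And>s u. \<lbrakk>s \<in> S; u \<in> carrier M\<rbrakk> \<Longrightarrow> s \<odot>\<^bsub>M\<^esub> u \<in> carrier M"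
    and h: "\<And>x. x \<in> carrier M \<Longrightarrow> h x \<in> carrier N"
      "\<And>x y. \<lbrakk>x \<in> carrier M; y \<in> carrier M\<rbrakk> \<Longrightarrow> h (x \<oplus>\<^bsub>M\<^esub> y) = h x \<oplus>\<^bsub>N\<^esub> h y"
    and W: "\<zero>\<^bsub>N\<^esub> \<in> W" "\<And>x y. \<lbrakk>x \<in> W; y \<in> W\<rbrakk> \<Longrightarrow> x \<oplus>\<^bsub>N\<^esub> y \<in> W"
      "\<And>s u. \<lbrakk>s \<in> S; u \<in> U\<rbrakk> \<Longrightarrow> h (s \<odot>\<^bsub>M\<^esub> u) \<in> W"
    and x: "x \<in> action_span M S U"
  shows "h x \<in> W"
proof -
  interpret M: abelian_group M by fact
  have "x \<in> carrier M \<and> h x \<in> W" using x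
  proof induction
    case zero
    show ?case using W(1) additive_zero[OF assms(1,2) h] by simp
  next
    case (step s u v)
    then show ?case using M W h by (simp add: subset_iff)
  qed
  then show ?thesis ..
qed

section \<open>Left ideals, Nakayama's lemma and nilpotency of the radical\<close>

locale fin_dim_algebra = assoc_algebra K A
  for K :: "('k, 'x) ring_scheme" and A :: "('k, 'a, 'y) module_scheme" +
  assumes finite_dim: "finite_dimensional K A"
begin

sublocale V: vector_space K A
  by (intro vector_space.intro module_lmodule Module.module.intro module_axioms K.field_axioms)

sublocale L: lmodule A "regular_module A"
  by (rule lmodule_regular[OF A.ring_axioms])

abbreviation left_ideal :: "'a set \<Rightarrow> bool" where
  "left_ideal I \<equiv> submodule I A (regular_module A)"

lemma left_idealD:
  assumes "left_ideal I"
  shows "I \<subseteq> carrier A" "\<zero>\<^bsub>A\<^esub> \<in> I" "\<And>x y. \<lbrakk>x \<in> I; y \<in> I\<rbrakk> \<Longrightarrow> x \<oplus>\<^bsub>A\<^esub> y \<in> I"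
    "\<And>x y. \<lbrakk>x \<in> I; y \<in> I\<rbrakk> \<Longrightarrow> x \<ominus>\<^bsub>A\<^esub> y \<in> I" "\<And>a x. \<lbrakk>a \<in> carrier A; x \<in> I\<rbrakk> \<Longrightarrow> a \<otimes>\<^bsub>A\<^esub> x \<in> I"
  using L.submoduleD[OF assms] a_inv_cong[of "regular_module A" A] by simp_all

lemma left_idealI:
  assumes "I \<subseteq> carrier A" "\<zero>\<^bsub>A\<^esub> \<in> I" "\<And>x y. \<lbrakk>x \<in> I; y \<in> I\<rbrakk> \<Longrightarrow> x \<oplus>\<^bsub>A\<^esub> y \<in> I"
    "\<And>a x. \<lbrakk>a \<in> carrier A; x \<in> I\<rbrakk> \<Longrightarrow> a \<otimes>\<^bsub>A\<^esub> x \<in> I"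
  shows "left_ideal I"
  by (rule L.submoduleI) (use assms in auto)

lemma scalar_mult: "\<lbrakk>c \<in> carrier K; x \<in> carrier A\<rbrakk> \<Longrightarrow> (c \<odot>\<^bsub>A\<^esub> \<one>\<^bsub>A\<^esub>) \<otimes>\<^bsub>A\<^esub> x = c \<odot>\<^bsub>A\<^esub> x"
  by (simp add: smult_mult_left)

text \<open>Scalars act through the elements \<open>c 1\<close> of \<open>A\<close>, so rank
  arguments apply to left ideals.\<close>

lemma left_ideal_subspace:
  assumes "left_ideal I"
  shows "submodule I K A"
proof (rule V.submoduleI)
  note I = left_idealD[OF assms]
  show "c \<odot>\<^bsub>A\<^esub> x \<in> I" if "c \<in> carrier K" "x \<in> I" for c x
  proof -
    have "(c \<odot>\<^bsub>A\<^esub> \<one>\<^bsub>A\<^esub>) \<otimes>\<^bsub>A\<^esub> x \<in> I" using I that by simp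
    then show ?thesis using scalar_mult[OF that(1) subsetD[OF I(1) that(2)]] by simp
  qed
qed (use left_idealD(1-3)[OF assms] in simp_all)

text \<open>Fixes one of the rank functions that exist for \<open>A\<close> as a vector space; the
  three conjuncts are the conclusions of \<open>rank_exists\<close>.\<close>

definition left_ideal_rank :: "'a set \<Rightarrow> nat" where
  "left_ideal_rank = (SOME rk. (\<exists>n. \<forall>W. rk W \<le> n) \<and> (\<forall>W W'. W' \<subseteq> W \<longrightarrow> rk W' \<le> rk W) \<and>
     (\<forall>W W'. submodule W K A \<and> submodule W' K A \<and> W' \<subseteq> W \<and> rk W' = rk W \<longrightarrow> W' = W))"

lemma left_ideal_rank:
  "\<exists>n. \<forall>W. left_ideal_rank W \<le> n"
  "\<And>W W'. W' \<subseteq> W \<Longrightarrow> left_ideal_rank W' \<le> left_ideal_rank W"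
  "\<And>W W'. \<lbrakk>left_ideal W; left_ideal W'; W' \<subseteq> W; left_ideal_rank W' = left_ideal_rank W\<rbrakk> \<Longrightarrow> W' = W"
proof -
  have "\<exists>rk :: 'a set \<Rightarrow> nat. (\<exists>n. \<forall>W. rk W \<le> n) \<and> (\<forall>W W'. W' \<subseteq> W \<longrightarrow> rk W' \<le> rk W) \<and>
     (\<forall>W W'. submodule W K A \<and> submodule W' K A \<and> W' \<subseteq> W \<and> rk W' = rk W \<longrightarrow> W' = W)"
    by (rule V.rank_exists[OF finite_dim]) metis
  from someI_ex[OF this, folded left_ideal_rank_def]
  show "\<exists>n. \<forall>W. left_ideal_rank W \<le> n"
    "\<And>W W'. W' \<subseteq> W \<Longrightarrow> left_ideal_rank W' \<le> left_ideal_rank W"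
    "\<And>W W'. \<lbrakk>left_ideal W; left_ideal W'; W' \<subseteq> W; left_ideal_rank W' = left_ideal_rank W\<rbrakk> \<Longrightarrow> W' = W"
    by (simp, simp, meson left_ideal_subspace)
qed

text \<open>Ranks are bounded, so some left ideal with the property has the largest rank; strict
  monotonicity of the rank makes it maximal.\<close>

lemma maximal_exists:
  assumes "left_ideal L0" "P L0"
  obtains L where "left_ideal L" "P L" "\<And>N. \<lbrakk>left_ideal N; P N; L \<subseteq> N\<rbrakk> \<Longrightarrow> N = L"
proof -
  obtain n where n: "\<And>W. left_ideal_rank W \<le> n" using left_ideal_rank(1) by blast
  obtain L where L: "left_ideal L \<and> P L"
    "\<And>N. left_ideal N \<and> P N \<Longrightarrow> left_ideal_rank N \<le> left_ideal_rank L"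
    using ex_has_greatest_nat[of "\<lambda>L. left_ideal L \<and> P L" L0 left_ideal_rank "Suc n"] n assms
    by (auto simp: less_Suc_eq_le)
  show thesis
  proof (rule that)
    show "N = L" if "left_ideal N" "P N" "L \<subseteq> N" for N
      using left_ideal_rank(3)[OF that(1) _ that(3)] left_ideal_rank(2)[OF that(3)] L(1) L(2)[of N] that(1,2)
      by (simp add: le_antisym)
  qed (use L(1) in simp_all)
qed

abbreviation "J \<equiv> jacobson_radical A"

text \<open>The annihilator of an element of a simple module \<open>I / L\<close> is a maximal left ideal.\<close>

lemma maximal_left_ideal_quotient:
  assumes I: "left_ideal I" and L: "left_ideal L" "L \<subseteq> I"
    and max: "\<And>N. \<lbrakk>left_ideal N; L \<subseteq> N; N \<subseteq> I\<rbrakk> \<Longrightarrow> N = L \<or> N = I"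
    and x: "x \<in> I" "x \<notin> L"
  shows "maximal_left_ideal A {a \<in> carrier A. a \<otimes>\<^bsub>A\<^esub> x \<in> L}"
proof -
  let ?M = "{a \<in> carrier A. a \<otimes>\<^bsub>A\<^esub> x \<in> L}"
  note ID = left_idealD[OF I] and LD = left_idealD[OF L(1)]
  have xA: "x \<in> carrier A" using x ID by auto
  have M: "left_ideal ?M"
    by (rule left_idealI) (use xA LD in \<open>auto simp: A.l_distr A.m_assoc\<close>)
  have one: "\<one>\<^bsub>A\<^esub> \<notin> ?M" using x xA by auto
  have max': "N = ?M \<or> N = carrier A" if N: "left_ideal N" "?M \<subseteq> N" for N
  proof (rule disjCI, rule ccontr)
    note ND = left_idealD[OF N(1)]
    assume "N \<noteq> carrier A" "N \<noteq> ?M"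
    then obtain y where y: "y \<in> N" "y \<otimes>\<^bsub>A\<^esub> x \<notin> L" using N ND(1) by blast
    then have yA: "y \<in> carrier A" using ND by auto
    \<comment> \<open>This is \<open>L + A y x\<close>. It contains \<open>y x\<close>, which is not
      in \<open>L\<close>, so it equals \<open>I\<close> by simplicity of
      \<open>I / L\<close>.\<close>
    let ?N = "{l \<oplus>\<^bsub>A\<^esub> a \<otimes>\<^bsub>A\<^esub> (y \<otimes>\<^bsub>A\<^esub> x) | l a. l \<in> L \<and> a \<in> carrier A}"
    have yx: "y \<otimes>\<^bsub>A\<^esub> x \<in> I" using ID yA x by auto
    have N': "left_ideal ?N"
    proof (rule left_idealI)
      show "?N \<subseteq> carrier A" using LD(1) yA xA by auto
      show "\<zero>\<^bsub>A\<^esub> \<in> ?N" using LD(2) yA xA by (auto intro!: exI[of _ "\<zero>\<^bsub>A\<^esub>"])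
    next
      fix u v assume "u \<in> ?N" "v \<in> ?N"
      then obtain l a m b where u: "u = l \<oplus>\<^bsub>A\<^esub> a \<otimes>\<^bsub>A\<^esub> (y \<otimes>\<^bsub>A\<^esub> x)" "l \<in> L" "a \<in> carrier A"
        and v: "v = m \<oplus>\<^bsub>A\<^esub> b \<otimes>\<^bsub>A\<^esub> (y \<otimes>\<^bsub>A\<^esub> x)" "m \<in> L" "b \<in> carrier A" by auto
      have "l \<in> carrier A" "m \<in> carrier A" using u v LD by auto
      then have "u \<oplus>\<^bsub>A\<^esub> v = (l \<oplus>\<^bsub>A\<^esub> m) \<oplus>\<^bsub>A\<^esub> (a \<oplus>\<^bsub>A\<^esub> b) \<otimes>\<^bsub>A\<^esub> (y \<otimes>\<^bsub>A\<^esub> x)"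
        using u v yA xA by (simp add: A.l_distr M.a_ac)
      then show "u \<oplus>\<^bsub>A\<^esub> v \<in> ?N" using u v LD(3) by auto
    next
      fix c u assume c: "c \<in> carrier A" and "u \<in> ?N"
      then obtain l a where u: "u = l \<oplus>\<^bsub>A\<^esub> a \<otimes>\<^bsub>A\<^esub> (y \<otimes>\<^bsub>A\<^esub> x)" "l \<in> L" "a \<in> carrier A" by auto
      have "l \<in> carrier A" using u LD by auto
      then have "c \<otimes>\<^bsub>A\<^esub> u = c \<otimes>\<^bsub>A\<^esub> l \<oplus>\<^bsub>A\<^esub> (c \<otimes>\<^bsub>A\<^esub> a) \<otimes>\<^bsub>A\<^esub> (y \<otimes>\<^bsub>A\<^esub> x)"
        using u c yA xA by (simp add: A.r_distr A.m_assoc)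
      then show "c \<otimes>\<^bsub>A\<^esub> u \<in> ?N" using u c LD(5) by auto
    qed
    have N1: "L \<subseteq> ?N"
    proof
      fix l assume "l \<in> L"
      then have "l = l \<oplus>\<^bsub>A\<^esub> \<zero>\<^bsub>A\<^esub> \<otimes>\<^bsub>A\<^esub> (y \<otimes>\<^bsub>A\<^esub> x)" using LD(1) yA xA by auto
      then show "l \<in> ?N" using \<open>l \<in> L\<close> M.zero_closed by blast
    qed
    have N2: "?N \<subseteq> I"
      by (clarify, rule ID(3)) (use L(2) ID(5)[OF _ yx] in blast)+
    have N3: "y \<otimes>\<^bsub>A\<^esub> x \<in> ?N"
    proof -
      have "y \<otimes>\<^bsub>A\<^esub> x = \<zero>\<^bsub>A\<^esub> \<oplus>\<^bsub>A\<^esub> \<one>\<^bsub>A\<^esub> \<otimes>\<^bsub>A\<^esub> (y \<otimes>\<^bsub>A\<^esub> x)" using yA xA by auto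
      then show ?thesis using LD(2) A.one_closed by blast
    qed
    from max[OF N' N1 N2] have "?N = I"
    proof
      assume eq: "?N = L"
      show ?thesis using N3 y(2) unfolding eq by contradiction
    qed
    then have "x \<in> ?N" using x(1) by (simp only:)
    then obtain l a where la: "x = l \<oplus>\<^bsub>A\<^esub> a \<otimes>\<^bsub>A\<^esub> (y \<otimes>\<^bsub>A\<^esub> x)" "l \<in> L" "a \<in> carrier A" by blast
    have lA: "l \<in> carrier A" using la LD by auto
    \<comment> \<open>From \<open>x = l + a y x\<close> it follows that \<open>1 - a y\<close>
      carries \<open>x\<close> into \<open>L\<close>; as \<open>a y\<close> is in \<open>N\<close>,
      so is \<open>1\<close>.\<close>
    have "(\<one>\<^bsub>A\<^esub> \<ominus>\<^bsub>A\<^esub> a \<otimes>\<^bsub>A\<^esub> y) \<otimes>\<^bsub>A\<^esub> x = x \<ominus>\<^bsub>A\<^esub> a \<otimes>\<^bsub>A\<^esub> (y \<otimes>\<^bsub>A\<^esub> x)"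
      using xA yA la(3) by (simp add: a_minus_def A.l_distr A.l_minus A.m_assoc)
    also have "\<dots> = l"
    proof -
      have "a \<otimes>\<^bsub>A\<^esub> (y \<otimes>\<^bsub>A\<^esub> x) \<oplus>\<^bsub>A\<^esub> l \<ominus>\<^bsub>A\<^esub> a \<otimes>\<^bsub>A\<^esub> (y \<otimes>\<^bsub>A\<^esub> x) = l"
        using xA yA la(3) lA by (intro M.add_minus_cancel) auto
      then show ?thesis using la xA yA lA by (metis A.m_closed M.a_comm)
    qed
    finally have "\<one>\<^bsub>A\<^esub> \<ominus>\<^bsub>A\<^esub> a \<otimes>\<^bsub>A\<^esub> y \<in> ?M" using la yA by auto
    then have "\<one>\<^bsub>A\<^esub> \<ominus>\<^bsub>A\<^esub> a \<otimes>\<^bsub>A\<^esub> y \<in> N" using N by blast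
    then have "(\<one>\<^bsub>A\<^esub> \<ominus>\<^bsub>A\<^esub> a \<otimes>\<^bsub>A\<^esub> y) \<oplus>\<^bsub>A\<^esub> a \<otimes>\<^bsub>A\<^esub> y \<in> N" using ND(3,5) y la by blast
    then have "\<one>\<^bsub>A\<^esub> \<in> N" using yA la by simp
    then have "a \<in> N" if "a \<in> carrier A" for a using ND(5)[OF that, of "\<one>\<^bsub>A\<^esub>"] that by simp
    then show False using \<open>N \<noteq> carrier A\<close> ND(1) by blast
  qed
  show ?thesis
    unfolding maximal_left_ideal_def
  proof (intro conjI allI impI M)
    show "?M \<noteq> carrier A" using one A.one_closed by (simp only: set_eq_iff) blast
  qed (elim conjE, rule max')
qed

lemma jacobson_radical_subset: "maximal_left_ideal A I \<Longrightarrow> J \<subseteq> I"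
  unfolding jacobson_radical_def by blast

lemma left_ideal_J: "left_ideal J"
proof (rule left_idealI)
  have D: "left_ideal I" if "maximal_left_ideal A I" for I using that by (simp add: maximal_left_ideal_def)
  show "J \<subseteq> carrier A" by (auto simp: jacobson_radical_def)
  show "\<zero>\<^bsub>A\<^esub> \<in> J" using left_idealD(2)[OF D] by (auto simp: jacobson_radical_def)
  show "x \<oplus>\<^bsub>A\<^esub> y \<in> J" if "x \<in> J" "y \<in> J" for x y
    using that left_idealD(3)[OF D] by (auto simp: jacobson_radical_def)
  show "a \<otimes>\<^bsub>A\<^esub> x \<in> J" if "a \<in> carrier A" "x \<in> J" for a x
    using that left_idealD(5)[OF D] by (auto simp: jacobson_radical_def)
qed

text \<open>For \<open>b\<close> outside a maximal left ideal \<open>I\<close>, the elements that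
  carry \<open>b\<close> into \<open>I\<close> are the annihilator of a nonzero class in the simple
  module \<open>A / I\<close>. They form a maximal left ideal, which contains
  \<open>J\<close>.\<close>

lemma J_mult_right:
  assumes "a \<in> J" "b \<in> carrier A"
  shows "a \<otimes>\<^bsub>A\<^esub> b \<in> J"
proof -
  have a: "a \<in> carrier A" using assms(1) left_idealD(1)[OF left_ideal_J] by auto
  have "a \<otimes>\<^bsub>A\<^esub> b \<in> I" if I: "maximal_left_ideal A I" for I
  proof (cases "b \<in> I")
    case True
    then show ?thesis using left_idealD(5)[of I] I a by (auto simp: maximal_left_ideal_def)
  next
    case False
    have "maximal_left_ideal A {a \<in> carrier A. a \<otimes>\<^bsub>A\<^esub> b \<in> I}"
      by (rule maximal_left_ideal_quotient[of "carrier A" I])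
        (use I False assms left_idealD(1)[of I] L.submodule_carrier in \<open>auto simp: maximal_left_ideal_def\<close>)
    then show ?thesis using jacobson_radical_subset assms(1) by blast
  qed
  then show ?thesis using a assms by (auto simp: jacobson_radical_def)
qed

lemma ideal_J: "ideal J A"
proof (rule idealI[OF A.ring_axioms])
  note JD = left_idealD[OF left_ideal_J]
  show "subgroup J (add_monoid A)"
    using left_ideal_subspace[OF left_ideal_J] by (rule submodule.axioms)
  show "x \<otimes>\<^bsub>A\<^esub> a \<in> J" if "a \<in> J" "x \<in> carrier A" for a x
    by (rule JD(5)[OF that(2,1)])
  show "a \<otimes>\<^bsub>A\<^esub> x \<in> J" if "a \<in> J" "x \<in> carrier A" for a x
    by (rule J_mult_right[OF that])
qed

text \<open>Nakayama's lemma, by way of a maximal left ideal properly contained in \<open>I\<close>.\<close>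

lemma nakayama:
  assumes I: "left_ideal I" and eq: "action_span (regular_module A) J I = I"
  shows "I = {\<zero>\<^bsub>A\<^esub>}"
proof (rule ccontr)
  assume ne: "I \<noteq> {\<zero>\<^bsub>A\<^esub>}"
  note ID = left_idealD[OF I]
  have z: "left_ideal {\<zero>\<^bsub>A\<^esub>}" by (rule left_idealI) auto
  obtain L where L: "left_ideal L" "L \<subseteq> I \<and> L \<noteq> I"
    "\<And>N. \<lbrakk>left_ideal N; N \<subseteq> I \<and> N \<noteq> I; L \<subseteq> N\<rbrakk> \<Longrightarrow> N = L"
    by (rule maximal_exists[OF z, of "\<lambda>L. L \<subseteq> I \<and> L \<noteq> I"]) (use ne ID(2) in auto)
  have "a \<otimes>\<^bsub>A\<^esub> x \<in> L" if a: "a \<in> J" and x: "x \<in> I" for a x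
  proof (cases "x \<in> L")
    case True
    then show ?thesis using left_idealD(5)[OF L(1)] left_idealD(1)[OF left_ideal_J] a by blast
  next
    case False
    have "maximal_left_ideal A {a \<in> carrier A. a \<otimes>\<^bsub>A\<^esub> x \<in> L}"
      by (rule maximal_left_ideal_quotient[OF I L(1) _ _ x False]) (use L in blast)+
    then show ?thesis using jacobson_radical_subset a by blast
  qed
  then have "action_span (regular_module A) J I \<subseteq> L"
    by (intro L.action_span_subset L(1)) simp
  then show False using L(2) eq by blast
qed

text \<open>Products and not their span, since they serve as generators in
  \<open>action_span\<close>. New factors enter on the left, in accordance with a right action:
  \<open>(v j) t = v (j t)\<close>.\<close>

fun radical_products :: "nat \<Rightarrow> 'a set" where
  "radical_products 0 = {\<one>\<^bsub>A\<^esub>}"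
| "radical_products (Suc n) = {a \<otimes>\<^bsub>A\<^esub> x | a x. a \<in> J \<and> x \<in> radical_products n}"

text \<open>The descending chain of powers of \<open>J\<close> becomes stationary at a term of least
  rank; there \<open>J I = I\<close>, and Nakayama's lemma makes it zero.\<close>

lemma J_nilpotent: obtains m where "radical_products m \<subseteq> {\<zero>\<^bsub>A\<^esub>}"
proof -
  define I where "I = rec_nat (carrier A) (\<lambda>_ I. action_span (regular_module A) J I)"
  have I0: "I 0 = carrier A" and IS: "I (Suc n) = action_span (regular_module A) J (I n)" for n
    by (simp_all add: I_def)
  note JD = left_idealD[OF left_ideal_J]
  have I: "left_ideal (I n)" for n
  proof (induction n)
    case 0
    show ?case using L.submodule_carrier by (simp add: I0)
  next
    case (Suc n)
    note D = left_idealD[OF Suc]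
    show ?case unfolding IS
    proof (rule L.submodule_action_span)
      fix r s u assume *: "r \<in> carrier A" "s \<in> J" "u \<in> I n"
      then have "r \<odot>\<^bsub>regular_module A\<^esub> (s \<odot>\<^bsub>regular_module A\<^esub> u) = (r \<otimes>\<^bsub>A\<^esub> s) \<odot>\<^bsub>regular_module A\<^esub> u"
        using JD(1) D(1) by (auto simp: A.m_assoc subset_iff)
      also have "\<dots> \<in> action_span (regular_module A) J (I n)"
        by (rule L.action_span_incl) (use * JD(1,5) D(1) in simp_all)
      finally show "r \<odot>\<^bsub>regular_module A\<^esub> (s \<odot>\<^bsub>regular_module A\<^esub> u) \<in> action_span (regular_module A) J (I n)" .
    qed (use JD(1) D(1) in simp_all)
  qed
  note D = left_idealD[OF I]
  have dec: "I (Suc n) \<subseteq> I n" for n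
    unfolding IS by (rule L.action_span_subset[OF I]) (use JD(1) D(5) in auto)
  obtain m where m: "\<And>n. left_ideal_rank (I m) \<le> left_ideal_rank (I n)"
    using ex_has_least_nat[of "\<lambda>_. True" 0 "\<lambda>n. left_ideal_rank (I n)"] by auto
  have "I (Suc m) = I m"
    by (rule left_ideal_rank(3)[OF I I dec]) (use m left_ideal_rank(2)[OF dec] in \<open>simp add: le_antisym\<close>)
  then have "I m = {\<zero>\<^bsub>A\<^esub>}" using nakayama[OF I] IS by metis
  moreover have "radical_products n \<subseteq> I n" for n
  proof (induction n)
    case (Suc n)
    have "a \<otimes>\<^bsub>A\<^esub> x \<in> I (Suc n)" if "a \<in> J" "x \<in> I n" for a x
      using L.action_span_incl[of J "I n" a x] JD(1) D(1) that by (simp add: IS)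
    then show ?case using Suc by auto
  qed (simp add: I0)
  ultimately show thesis using that by metis
qed

lemma radical_products_closed: "radical_products n \<subseteq> carrier A"
  using left_idealD(1)[OF left_ideal_J] by (induction n) (auto simp: subset_iff)

end

section \<open>Separability idempotents\<close>

context envelope
begin

text \<open>Pushing a homomorphism through the list turns identities for the idempotent into
  identities in the target group.\<close>

lemma add_pair_foldr_hom:
  assumes "comm_group G" "h \<in> hom (tensor_group K A (op_ring A)) G" "set ps \<subseteq> carrier A \<times> carrier A"
  shows "h (foldr (\<lambda>(x, y) v. T.pt x y \<otimes>\<^bsub>T.T\<^esub> v) ps \<one>\<^bsub>T.T\<^esub>)
    = foldr (\<lambda>(x, y) v. h (T.pt x y) \<otimes>\<^bsub>G\<^esub> v) ps \<one>\<^bsub>G\<^esub>"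
proof -
  interpret G: comm_group G by fact
  have cl: "foldr (\<lambda>(x, y) v. T.pt x y \<otimes>\<^bsub>T.T\<^esub> v) qs \<one>\<^bsub>T.T\<^esub> \<in> carrier T.T"
    if "set qs \<subseteq> carrier A \<times> carrier A" for qs
    using that by (induction qs) auto
  show ?thesis using assms(3)
    by (induction ps)
      (auto simp: hom_mult[OF assms(2)] cl hom_one[OF assms(2) T.T.group_axioms G.group_axioms])
qed

text \<open>Semisimplicity splits the multiplication \<open>Ae \<rightarrow> A\<close>, and
  \<open>e\<close> is the component of \<open>1\<close> in a complement \<open>V\<close> of its
  kernel. The elements \<open>(s \<otimes> 1) e\<close> and \<open>(1 \<otimes> s) e\<close> of
  \<open>V\<close> have the same image \<open>s\<close>, so they agree.\<close>

lemma separability_idempotent: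
  assumes "semisimple_ring Ae"
  obtains e where "e \<in> carrier Ae" "e \<odot>\<^bsub>AL\<^esub> \<one>\<^bsub>A\<^esub> = \<one>\<^bsub>A\<^esub>"
    "\<And>s. s \<in> carrier A \<Longrightarrow> left_unit s \<otimes>\<^bsub>Ae\<^esub> e = right_unit s \<otimes>\<^bsub>Ae\<^esub> e"
proof -
  interpret reg: lmodule Ae "regular_module Ae" by (rule lmodule_regular[OF Ae.ring_axioms])
  interpret AL: lmodule Ae AL by (rule lmodule_AL)
  let ?\<mu> = "\<lambda>u. u \<odot>\<^bsub>AL\<^esub> \<one>\<^bsub>A\<^esub>"
  have \<mu>: "?\<mu> \<in> mod_hom Ae (regular_module Ae) AL"
    by (rule mod_homI) (simp_all add: AL_closed AL_l_distr AL_assoc)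
  let ?U = "{u \<in> carrier (regular_module Ae). ?\<mu> u = \<zero>\<^bsub>AL\<^esub>}"
  have "submodule ?U Ae (regular_module Ae)"
    by (rule submodule_kernel[OF reg.lmodule_axioms lmodule_AL \<mu>])
  then obtain V where V: "submodule V Ae (regular_module Ae)" "?U \<inter> V = {\<zero>\<^bsub>Ae\<^esub>}"
    and sum: "?U <+>\<^bsub>regular_module Ae\<^esub> V = carrier Ae"
    using assms unfolding semisimple_ring_def semisimple_module_def by auto
  note VD = reg.submoduleD[OF V(1)]
  have "\<one>\<^bsub>Ae\<^esub> \<in> ?U <+>\<^bsub>regular_module Ae\<^esub> V" using sum by simp
  then obtain u e where u: "u \<in> ?U" and e: "e \<in> V" and ue: "\<one>\<^bsub>Ae\<^esub> = u \<oplus>\<^bsub>Ae\<^esub> e"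
    unfolding set_add_def' by auto
  have eA: "e \<in> carrier Ae" using e VD(1) by auto
  have "?\<mu> \<one>\<^bsub>Ae\<^esub> = \<one>\<^bsub>A\<^esub>" using AL.smult_one[of "\<one>\<^bsub>A\<^esub>"] by simp
  then have \<mu>e: "?\<mu> e = \<one>\<^bsub>A\<^esub>" using u eA by (simp add: ue AL_l_distr AL_closed)
  have "left_unit s \<otimes>\<^bsub>Ae\<^esub> e = right_unit s \<otimes>\<^bsub>Ae\<^esub> e" if s: "s \<in> carrier A" for s
  proof -
    have lr: "left_unit s \<odot>\<^bsub>AL\<^esub> \<one>\<^bsub>A\<^esub> = s" "right_unit s \<odot>\<^bsub>AL\<^esub> \<one>\<^bsub>A\<^esub> = s"
      using AL_smult_unit[of "\<one>\<^bsub>A\<^esub>" s "\<one>\<^bsub>A\<^esub>"] AL_smult_unit[of "\<one>\<^bsub>A\<^esub>" "\<one>\<^bsub>A\<^esub>" s] s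
      by (simp_all add: unit_one)
    let ?x = "left_unit s \<otimes>\<^bsub>Ae\<^esub> e" and ?y = "right_unit s \<otimes>\<^bsub>Ae\<^esub> e"
    have xy: "?x \<in> V" "?y \<in> V" using VD(6) e s by simp_all
    then have xyA: "?x \<in> carrier Ae" "?y \<in> carrier Ae" using VD(1) by auto
    have "?\<mu> ?x = s" "?\<mu> ?y = s" using s eA \<mu>e lr by (simp_all add: AL_assoc)
    then have "?\<mu> (?x \<ominus>\<^bsub>regular_module Ae\<^esub> ?y) = s \<ominus>\<^bsub>AL\<^esub> s"
      using mod_hom_minus(2)[OF reg.lmodule_axioms lmodule_AL \<mu>] xyA by simp
    then have "?x \<ominus>\<^bsub>regular_module Ae\<^esub> ?y \<in> ?U \<inter> V"
      using VD(5)[OF xy] VD(1) s AL.M.minus_self[of s] by auto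
    then have "?x \<ominus>\<^bsub>regular_module Ae\<^esub> ?y = \<zero>\<^bsub>Ae\<^esub>" using V(2) by blast
    then show ?thesis using reg.M.minus_eq_zero_iff[of ?x ?y] xyA by simp
  qed
  then show thesis by (rule that[OF eA \<mu>e])
qed

text \<open>The centrality \<open>\<Sum> s x\<^sub>i \<otimes> y\<^sub>i = \<Sum> x\<^sub>i
  \<otimes> y\<^sub>i s\<close> is tested on balanced maps into \<open>G\<close>, since it will be
  evaluated in a module and not in \<open>Ae\<close>.\<close>

lemma separability_list:
  fixes G :: "('g, 'w) monoid_scheme"
  assumes "semisimple_ring Ae"
  obtains ps where "set ps \<subseteq> carrier A \<times> carrier A"
    "foldr (\<lambda>(x, y) v. x \<otimes>\<^bsub>A\<^esub> y \<oplus>\<^bsub>A\<^esub> v) ps \<zero>\<^bsub>A\<^esub> = \<one>\<^bsub>A\<^esub>"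
    "\<And>\<phi> s. \<lbrakk>comm_group G; balanced K A (op_ring A) G \<phi>; s \<in> carrier A\<rbrakk>
      \<Longrightarrow> foldr (\<lambda>(x, y) v. \<phi> (s \<otimes>\<^bsub>A\<^esub> x, y) \<otimes>\<^bsub>G\<^esub> v) ps \<one>\<^bsub>G\<^esub>
        = foldr (\<lambda>(x, y) v. \<phi> (x, y \<otimes>\<^bsub>A\<^esub> s) \<otimes>\<^bsub>G\<^esub> v) ps \<one>\<^bsub>G\<^esub>"
proof -
  obtain e where e: "e \<in> carrier Ae" "e \<odot>\<^bsub>AL\<^esub> \<one>\<^bsub>A\<^esub> = \<one>\<^bsub>A\<^esub>"
    and comm: "\<And>s. s \<in> carrier A \<Longrightarrow> left_unit s \<otimes>\<^bsub>Ae\<^esub> e = right_unit s \<otimes>\<^bsub>Ae\<^esub> e"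
    by (rule separability_idempotent[OF assms]) blast
  have "e \<in> carrier T.T" using e(1) by (simp add: Ae_eq)
  then obtain ps where ps: "set ps \<subseteq> carrier A \<times> carrier A"
    "e = foldr (\<lambda>(x, y) v. T.pt x y \<otimes>\<^bsub>T.T\<^esub> v) ps \<one>\<^bsub>T.T\<^esub>"
    by (rule T.T_finite_sum) simp
  have cong: "foldr (\<lambda>(x, y) v. f x y \<otimes>\<^bsub>H\<^esub> v) ps \<one>\<^bsub>H\<^esub> = foldr (\<lambda>(x, y) v. g x y \<otimes>\<^bsub>H\<^esub> v) ps \<one>\<^bsub>H\<^esub>"
    if "\<And>x y. \<lbrakk>x \<in> carrier A; y \<in> carrier A\<rbrakk> \<Longrightarrow> f x y = g x y"
    for f g :: "'a \<Rightarrow> 'a \<Rightarrow> 'h" and H :: "('h, 'u) monoid_scheme"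
    by (rule foldr_cong) (use that ps(1) in auto)
  show thesis
  proof (rule that[OF ps(1)])
    have "\<one>\<^bsub>A\<^esub> = foldr (\<lambda>(x, y) v. (T.pt x y \<odot>\<^bsub>AL\<^esub> \<one>\<^bsub>A\<^esub>) \<otimes>\<^bsub>add_monoid A\<^esub> v) ps \<one>\<^bsub>add_monoid A\<^esub>"
      using add_pair_foldr_hom[OF M.a_comm_group AL_smult_hom ps(1), of "\<one>\<^bsub>A\<^esub>"] e(2) ps(2) by simp
    also have "\<dots> = foldr (\<lambda>(x, y) v. (x \<otimes>\<^bsub>A\<^esub> y) \<otimes>\<^bsub>add_monoid A\<^esub> v) ps \<one>\<^bsub>add_monoid A\<^esub>"
      by (rule cong) (simp add: pt_eq_units AL_smult_unit)
    finally show "foldr (\<lambda>(x, y) v. x \<otimes>\<^bsub>A\<^esub> y \<oplus>\<^bsub>A\<^esub> v) ps \<zero>\<^bsub>A\<^esub> = \<one>\<^bsub>A\<^esub>" by simp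
  next
    fix \<phi> s assume G: "comm_group G" and bal: "balanced K A (op_ring A) G \<phi>" and s: "s \<in> carrier A"
    interpret G: comm_group G by fact
    note lift = T.tensor_lift_hom[OF G bal] and lift_pt = T.tensor_lift_pt[OF G bal]
    have TA: "carrier T.T = carrier Ae" "X \<otimes>\<^bsub>T.T\<^esub> Y = X \<oplus>\<^bsub>Ae\<^esub> Y" for X Y by (simp_all add: Ae_eq)
    have "(\<lambda>X. w \<otimes>\<^bsub>Ae\<^esub> X) \<in> hom T.T T.T" if "w \<in> carrier Ae" for w
      using that by (intro homI) (simp_all add: TA Ae.r_distr)
    then have left: "(\<lambda>X. left_unit s \<otimes>\<^bsub>Ae\<^esub> X) \<in> hom T.T T.T" "(\<lambda>X. right_unit s \<otimes>\<^bsub>Ae\<^esub> X) \<in> hom T.T T.T"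
      using s by simp_all
    have pts: "left_unit s \<otimes>\<^bsub>Ae\<^esub> T.pt x y = T.pt (s \<otimes>\<^bsub>A\<^esub> x) y"
      "right_unit s \<otimes>\<^bsub>Ae\<^esub> T.pt x y = T.pt x (y \<otimes>\<^bsub>A\<^esub> s)" if "x \<in> carrier A" "y \<in> carrier A" for x y
      using that s T.E_mult_pt by (simp_all add: left_unit_def right_unit_def Ae_eq)
    let ?h = "tensor_lift G \<phi>"
    have "?h (left_unit s \<otimes>\<^bsub>Ae\<^esub> e)
        = foldr (\<lambda>(x, y) v. ?h (left_unit s \<otimes>\<^bsub>Ae\<^esub> T.pt x y) \<otimes>\<^bsub>G\<^esub> v) ps \<one>\<^bsub>G\<^esub>"
      using add_pair_foldr_hom[OF G hom_compose[OF left(1) lift] ps(1)] ps(2) by (simp add: o_def)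
    also have "\<dots> = foldr (\<lambda>(x, y) v. \<phi> (s \<otimes>\<^bsub>A\<^esub> x, y) \<otimes>\<^bsub>G\<^esub> v) ps \<one>\<^bsub>G\<^esub>"
      by (rule cong) (use s in \<open>simp add: pts lift_pt\<close>)
    finally have 1: "?h (left_unit s \<otimes>\<^bsub>Ae\<^esub> e) = \<dots>" .
    have "?h (right_unit s \<otimes>\<^bsub>Ae\<^esub> e)
        = foldr (\<lambda>(x, y) v. ?h (right_unit s \<otimes>\<^bsub>Ae\<^esub> T.pt x y) \<otimes>\<^bsub>G\<^esub> v) ps \<one>\<^bsub>G\<^esub>"
      using add_pair_foldr_hom[OF G hom_compose[OF left(2) lift] ps(1)] ps(2) by (simp add: o_def)
    also have "\<dots> = foldr (\<lambda>(x, y) v. \<phi> (x, y \<otimes>\<^bsub>A\<^esub> s) \<otimes>\<^bsub>G\<^esub> v) ps \<one>\<^bsub>G\<^esub>"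
      by (rule cong) (use s in \<open>simp add: pts lift_pt\<close>)
    finally show "foldr (\<lambda>(x, y) v. \<phi> (s \<otimes>\<^bsub>A\<^esub> x, y) \<otimes>\<^bsub>G\<^esub> v) ps \<one>\<^bsub>G\<^esub>
        = foldr (\<lambda>(x, y) v. \<phi> (x, y \<otimes>\<^bsub>A\<^esub> s) \<otimes>\<^bsub>G\<^esub> v) ps \<one>\<^bsub>G\<^esub>"
      using 1 comm[OF s] by simp
  qed
qed

end

section \<open>The idempotent of \<open>A / J\<close> transferred to \<open>A\<close>\<close>

locale separable_quotient = fin_dim_algebra K A
  for K :: "('k, 'x) ring_scheme" and A :: "('k, 'a, 'y) module_scheme" +
  assumes separable: "separable_algebra K (quotient_algebra A (jacobson_radical A))"
begin

sublocale J: ideal J A by (rule ideal_J)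

abbreviation "S \<equiv> quotient_algebra A J"
abbreviation "cls a \<equiv> J +>\<^bsub>A\<^esub> a"

lemma S_simps: "carrier S = cls ` carrier A" "\<one>\<^bsub>S\<^esub> = cls \<one>\<^bsub>A\<^esub>" "\<zero>\<^bsub>S\<^esub> = J"
  "monoid.mult S = monoid.mult (A Quot J)" "add S = add (A Quot J)"
  "smult S = (\<lambda>c X. \<Union>x\<in>X. cls (c \<odot>\<^bsub>A\<^esub> x))"
  by (auto simp: quotient_algebra_def ring.defs module.defs FactRing_def A_RCOSETS_def' a_r_coset_def')

lemma cls_eq_iff: "\<lbrakk>a \<in> carrier A; b \<in> carrier A\<rbrakk> \<Longrightarrow> cls a = cls b \<longleftrightarrow> a \<ominus>\<^bsub>A\<^esub> b \<in> J"
  using A.quotient_eq_iff_same_a_r_cos[OF ideal_J] by blast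

lemma cls_mult: "\<lbrakk>a \<in> carrier A; b \<in> carrier A\<rbrakk> \<Longrightarrow> cls (a \<otimes>\<^bsub>A\<^esub> b) = cls a \<otimes>\<^bsub>S\<^esub> cls b"
  using ring_hom_mult[OF J.rcos_ring_hom] by (simp add: S_simps)

lemma cls_add: "\<lbrakk>a \<in> carrier A; b \<in> carrier A\<rbrakk> \<Longrightarrow> cls (a \<oplus>\<^bsub>A\<^esub> b) = cls a \<oplus>\<^bsub>S\<^esub> cls b"
  using ring_hom_add[OF J.rcos_ring_hom] by (simp add: S_simps)

lemma cls_zero: "cls \<zero>\<^bsub>A\<^esub> = \<zero>\<^bsub>S\<^esub>"
  using abelian_group.a_coset_add_zero[OF A.is_abelian_group, of J] left_idealD(1)[OF left_ideal_J] by (simp add: S_simps)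

lemma cls_smult:
  assumes "c \<in> carrier K" "a \<in> carrier A"
  shows "cls (c \<odot>\<^bsub>A\<^esub> a) = c \<odot>\<^bsub>S\<^esub> cls a"
proof -
  note JD = V.submoduleD[OF left_ideal_subspace[OF left_ideal_J]]
  have mem: "x \<in> carrier A \<and> x \<ominus>\<^bsub>A\<^esub> a \<in> J" if "x \<in> cls a" for x
  proof -
    obtain j where j: "j \<in> J" "x = j \<oplus>\<^bsub>A\<^esub> a" using \<open>x \<in> cls a\<close> by (auto simp: a_r_coset_def')
    then show ?thesis using assms(2) JD(1) M.add_minus_cancel[of a j] by (auto simp: M.a_comm subset_iff)
  qed
  have "cls (c \<odot>\<^bsub>A\<^esub> x) = cls (c \<odot>\<^bsub>A\<^esub> a)" if "x \<in> cls a" for x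
  proof -
    have "c \<odot>\<^bsub>A\<^esub> x \<ominus>\<^bsub>A\<^esub> c \<odot>\<^bsub>A\<^esub> a = c \<odot>\<^bsub>A\<^esub> (x \<ominus>\<^bsub>A\<^esub> a)"
      using mem[OF that] assms by (simp add: a_minus_def smult_r_distr smult_r_minus)
    also have "\<dots> \<in> J" using mem[OF that] assms(1) JD(6) by blast
    finally show ?thesis using mem[OF that] assms by (simp add: cls_eq_iff)
  qed
  moreover have "a \<in> cls a" by (rule J.a_rcos_self[OF assms(2)])
  ultimately show ?thesis unfolding S_simps(6) by blast
qed

text \<open>The pairs are representatives of pairs over \<open>A / J\<close>. So their products sum
  to \<open>1\<close> only modulo \<open>J\<close>, and centrality is claimed for the maps that
  factor through \<open>A / J\<close> in both variables, namely those vanishing once an argument is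
  in \<open>J\<close>.\<close>

lemma separability_list_radical:
  fixes G :: "('g, 'w) monoid_scheme"
  obtains ps where "set ps \<subseteq> carrier A \<times> carrier A"
    "foldr (\<lambda>(x, y) v. x \<otimes>\<^bsub>A\<^esub> y \<oplus>\<^bsub>A\<^esub> v) ps \<zero>\<^bsub>A\<^esub> \<ominus>\<^bsub>A\<^esub> \<one>\<^bsub>A\<^esub> \<in> J"
    "\<And>\<phi> s. \<lbrakk>comm_group G; balanced K A (op_ring A) G \<phi>;
        \<And>x y. \<lbrakk>x \<in> carrier A; y \<in> carrier A; x \<in> J \<or> y \<in> J\<rbrakk> \<Longrightarrow> \<phi> (x, y) = \<one>\<^bsub>G\<^esub>; s \<in> carrier A\<rbrakk>
      \<Longrightarrow> foldr (\<lambda>(x, y) v. \<phi> (s \<otimes>\<^bsub>A\<^esub> x, y) \<otimes>\<^bsub>G\<^esub> v) ps \<one>\<^bsub>G\<^esub>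
        = foldr (\<lambda>(x, y) v. \<phi> (x, y \<otimes>\<^bsub>A\<^esub> s) \<otimes>\<^bsub>G\<^esub> v) ps \<one>\<^bsub>G\<^esub>"
proof -
  interpret S: envelope K S
    using separable unfolding separable_algebra_def by (intro envelope.intro) simp
  have ss: "semisimple_ring (enveloping_algebra K S)"
    using separable by (simp add: separable_algebra_def enveloping_algebra_def)
  obtain ps where ps: "set ps \<subseteq> carrier S \<times> carrier S"
    and one: "foldr (\<lambda>(x, y) v. x \<otimes>\<^bsub>S\<^esub> y \<oplus>\<^bsub>S\<^esub> v) ps \<zero>\<^bsub>S\<^esub> = \<one>\<^bsub>S\<^esub>"
    and comm: "\<And>\<phi> s. \<lbrakk>comm_group G; balanced K S (op_ring S) G \<phi>; s \<in> carrier S\<rbrakk>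
      \<Longrightarrow> foldr (\<lambda>(x, y) v. \<phi> (s \<otimes>\<^bsub>S\<^esub> x, y) \<otimes>\<^bsub>G\<^esub> v) ps \<one>\<^bsub>G\<^esub>
        = foldr (\<lambda>(x, y) v. \<phi> (x, y \<otimes>\<^bsub>S\<^esub> s) \<otimes>\<^bsub>G\<^esub> v) ps \<one>\<^bsub>G\<^esub>"
    using S.separability_list[OF ss, where G = G] by blast
  define rep where "rep X = inv_into (carrier A) (\<lambda>a. cls a) X" for X
  have rep: "rep X \<in> carrier A" "cls (rep X) = X" if "X \<in> carrier S" for X
    using that by (auto simp: S_simps rep_def inv_into_into f_inv_into_f)
  define qs where "qs = map (\<lambda>(X, Y). (rep X, rep Y)) ps"
  have qs: "set qs \<subseteq> carrier A \<times> carrier A" using ps rep(1) by (auto simp: qs_def)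
  have ps_qs: "ps = map (\<lambda>(x, y). (cls x, cls y)) qs"
    unfolding qs_def map_map by (rule sym, rule map_idI) (use ps rep(2) in auto)
  have closed: "foldr (\<lambda>(x, y) v. x \<otimes>\<^bsub>A\<^esub> y \<oplus>\<^bsub>A\<^esub> v) rs \<zero>\<^bsub>A\<^esub> \<in> carrier A"
    if "set rs \<subseteq> carrier A \<times> carrier A" for rs
    using that by (induction rs) auto
  have "cls (foldr (\<lambda>(x, y) v. x \<otimes>\<^bsub>A\<^esub> y \<oplus>\<^bsub>A\<^esub> v) rs \<zero>\<^bsub>A\<^esub>)
      = foldr (\<lambda>(x, y) v. x \<otimes>\<^bsub>S\<^esub> y \<oplus>\<^bsub>S\<^esub> v) (map (\<lambda>(x, y). (cls x, cls y)) rs) \<zero>\<^bsub>S\<^esub>"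
    if "set rs \<subseteq> carrier A \<times> carrier A" for rs
    using that by (induction rs) (auto simp: cls_zero cls_add cls_mult closed)
  from this[OF qs] have "cls (foldr (\<lambda>(x, y) v. x \<otimes>\<^bsub>A\<^esub> y \<oplus>\<^bsub>A\<^esub> v) qs \<zero>\<^bsub>A\<^esub>) = cls \<one>\<^bsub>A\<^esub>"
    using one by (simp add: ps_qs S_simps)
  then have qs_one: "foldr (\<lambda>(x, y) v. x \<otimes>\<^bsub>A\<^esub> y \<oplus>\<^bsub>A\<^esub> v) qs \<zero>\<^bsub>A\<^esub> \<ominus>\<^bsub>A\<^esub> \<one>\<^bsub>A\<^esub> \<in> J"
    using closed[OF qs] by (simp add: cls_eq_iff)
  show thesis
  proof (rule that[OF qs qs_one])
    fix \<phi> s assume G: "comm_group G" and bal: "balanced K A (op_ring A) G \<phi>"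
      and van: "\<And>x y. \<lbrakk>x \<in> carrier A; y \<in> carrier A; x \<in> J \<or> y \<in> J\<rbrakk> \<Longrightarrow> \<phi> (x, y) = \<one>\<^bsub>G\<^esub>"
      and s: "s \<in> carrier A"
    interpret G: comm_group G by fact
    have \<phi>_closed: "\<phi> (x, y) \<in> carrier G" if "x \<in> carrier A" "y \<in> carrier A" for x y
      using bal that by (simp add: balanced_def)
    have \<phi>_add: "\<phi> (x \<oplus>\<^bsub>A\<^esub> x', y) = \<phi> (x, y) \<otimes>\<^bsub>G\<^esub> \<phi> (x', y)" "\<phi> (y, x \<oplus>\<^bsub>A\<^esub> x') = \<phi> (y, x) \<otimes>\<^bsub>G\<^esub> \<phi> (y, x')"
      if "x \<in> carrier A" "x' \<in> carrier A" "y \<in> carrier A" for x x' y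
      using bal that by (simp_all add: balanced_def)
    have \<phi>_smult: "\<phi> (c \<odot>\<^bsub>A\<^esub> x, y) = \<phi> (x, c \<odot>\<^bsub>A\<^esub> y)" if "c \<in> carrier K" "x \<in> carrier A" "y \<in> carrier A" for c x y
      using bal that by (simp add: balanced_def)
    define \<phi>' where "\<phi>' = (\<lambda>(X, Y). \<phi> (rep X, rep Y))"
    \<comment> \<open>Independence of the representatives: changing an argument by an element of
      \<open>J\<close> multiplies the value of \<open>\<phi>\<close> by the neutral element.\<close>
    have \<phi>': "\<phi>' (cls a, cls b) = \<phi> (a, b)" if a: "a \<in> carrier A" and b: "b \<in> carrier A" for a b
    proof -
      let ?a = "rep (cls a)" and ?b = "rep (cls b)"
      have ab: "?a \<in> carrier A" "?b \<in> carrier A" "?a \<ominus>\<^bsub>A\<^esub> a \<in> J" "?b \<ominus>\<^bsub>A\<^esub> b \<in> J"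
        using a b rep[of "cls a"] rep[of "cls b"] by (auto simp: S_simps cls_eq_iff[symmetric])
      have "\<phi> (?a, ?b) = \<phi> ((?a \<ominus>\<^bsub>A\<^esub> a) \<oplus>\<^bsub>A\<^esub> a, ?b)" using ab a by simp
      also have "\<dots> = \<phi> (a, ?b)"
        using ab a by (subst \<phi>_add(1)) (simp_all add: van \<phi>_closed)
      also have "\<dots> = \<phi> (a, (?b \<ominus>\<^bsub>A\<^esub> b) \<oplus>\<^bsub>A\<^esub> b)" using ab b by simp
      also have "\<dots> = \<phi> (a, b)"
        using ab a b by (subst \<phi>_add(2)) (simp_all add: van \<phi>_closed)
      finally show ?thesis by (simp add: \<phi>'_def)
    qed
    have bal': "balanced K S (op_ring S) G \<phi>'"
      unfolding balanced_def op_ring_simps smult_op_ring S_simps(1)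
      by (intro conjI ballI; (elim imageE)?; hypsubst)
        (simp_all add: \<phi>' \<phi>_closed \<phi>_add \<phi>_smult cls_add[symmetric] cls_smult[symmetric])
    have cs: "cls s \<in> carrier S" using s by (simp add: S_simps)
    have "foldr (\<lambda>(x, y) v. \<phi>' (cls s \<otimes>\<^bsub>S\<^esub> x, y) \<otimes>\<^bsub>G\<^esub> v) ps \<one>\<^bsub>G\<^esub>
        = foldr (\<lambda>(x, y) v. \<phi> (s \<otimes>\<^bsub>A\<^esub> x, y) \<otimes>\<^bsub>G\<^esub> v) qs \<one>\<^bsub>G\<^esub>"
      unfolding ps_qs foldr_map
      by (rule foldr_cong) (use qs s in \<open>auto simp: cls_mult[symmetric] \<phi>'\<close>)
    moreover have "foldr (\<lambda>(x, y) v. \<phi>' (x, y \<otimes>\<^bsub>S\<^esub> cls s) \<otimes>\<^bsub>G\<^esub> v) ps \<one>\<^bsub>G\<^esub>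
        = foldr (\<lambda>(x, y) v. \<phi> (x, y \<otimes>\<^bsub>A\<^esub> s) \<otimes>\<^bsub>G\<^esub> v) qs \<one>\<^bsub>G\<^esub>"
      unfolding ps_qs foldr_map
      by (rule foldr_cong) (use qs s in \<open>auto simp: cls_mult[symmetric] \<phi>'\<close>)
    ultimately show "foldr (\<lambda>(x, y) v. \<phi> (s \<otimes>\<^bsub>A\<^esub> x, y) \<otimes>\<^bsub>G\<^esub> v) qs \<one>\<^bsub>G\<^esub>
        = foldr (\<lambda>(x, y) v. \<phi> (x, y \<otimes>\<^bsub>A\<^esub> s) \<otimes>\<^bsub>G\<^esub> v) qs \<one>\<^bsub>G\<^esub>"
      using comm[OF G bal' cs] by simp
  qed
qed

end

declare free_module_simps [simp del]

section \<open>Restriction of scalars\<close>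

definition restrict_scalars :: "('s \<Rightarrow> 'r) \<Rightarrow> ('r, 'm, 'y) module_scheme \<Rightarrow> ('s, 'm) module" where
  "restrict_scalars f M = \<lparr>carrier = carrier M, monoid.mult = undefined, one = undefined,
     ring.zero = \<zero>\<^bsub>M\<^esub>, add = add M, smult = (\<lambda>b x. f b \<odot>\<^bsub>M\<^esub> x)\<rparr>"

lemma restrict_scalars_simps [simp]:
  "carrier (restrict_scalars f M) = carrier M" "\<zero>\<^bsub>restrict_scalars f M\<^esub> = \<zero>\<^bsub>M\<^esub>"
  "add (restrict_scalars f M) = add M" "smult (restrict_scalars f M) = (\<lambda>b x. f b \<odot>\<^bsub>M\<^esub> x)"
  by (simp_all add: restrict_scalars_def)

lemma lmodule_restrict_scalars:
  assumes "ring B" "f \<in> ring_hom B R" "lmodule R M"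
  shows "lmodule B (restrict_scalars f M)"
proof -
  interpret lmodule R M by fact
  have "abelian_group (restrict_scalars f M)"
    by (rule abelian_group_cong[OF M.abelian_group_axioms]) simp_all
  then show ?thesis
    using assms(1) ring_hom_closed[OF assms(2)] ring_hom_add[OF assms(2)] ring_hom_mult[OF assms(2)]
      ring_hom_one[OF assms(2)]
    by (intro lmoduleI) (simp_all add: smult_closed smult_l_distr smult_r_distr smult_assoc smult_one)
qed

lemma mod_hom_restrict_scalars:
  assumes "f \<in> ring_hom B R" "h \<in> mod_hom R M N"
  shows "h \<in> mod_hom B (restrict_scalars f M) (restrict_scalars f N)"
  using ring_hom_closed[OF assms(1)] mod_homD[OF assms(2)] by (intro mod_homI) simp_all

text \<open>
  The elements \<open>e j\<close> generate \<open>R\<close> over \<open>B\<close> modulo the right ideal generated by \<open>S\<close>, with coordinates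
  \<open>\<kappa> j\<close>; so \<open>F / S F\<close> is a free \<open>B\<close>-module for every free \<open>R\<close>-module \<open>F\<close>.
\<close>

lemma projective_restrict_scalars_quotient:
  fixes P :: "('r, 'p, 'y) module_scheme" and Q :: "('b, 'q, 'z) module_scheme"
    and n :: nat
  assumes "ring B" and f: "f \<in> ring_hom B R" and P: "projective_module R P" and S: "S \<subseteq> carrier R"
    and Q: "lmodule B Q" and p: "p \<in> mod_hom B (restrict_scalars f P) Q" "p ` carrier P = carrier Q"
    and ker: "\<And>x. x \<in> carrier P \<Longrightarrow> p x = \<zero>\<^bsub>Q\<^esub> \<longleftrightarrow> x \<in> action_span P S (carrier P)"
    and e: "\<And>j. j < n \<Longrightarrow> e j \<in> carrier R"
    and \<kappa>: "\<And>j u. \<lbrakk>j < n; u \<in> carrier R\<rbrakk> \<Longrightarrow> \<kappa> j u \<in> carrier B"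
      "\<And>j u v. \<lbrakk>j < n; u \<in> carrier R; v \<in> carrier R\<rbrakk> \<Longrightarrow> \<kappa> j (u \<oplus>\<^bsub>R\<^esub> v) = \<kappa> j u \<oplus>\<^bsub>B\<^esub> \<kappa> j v"
      "\<And>j b u. \<lbrakk>j < n; b \<in> carrier B; u \<in> carrier R\<rbrakk> \<Longrightarrow> \<kappa> j (f b \<otimes>\<^bsub>R\<^esub> u) = b \<otimes>\<^bsub>B\<^esub> \<kappa> j u"
      "\<And>j s u. \<lbrakk>j < n; s \<in> S; u \<in> carrier R\<rbrakk> \<Longrightarrow> \<kappa> j (s \<otimes>\<^bsub>R\<^esub> u) = \<zero>\<^bsub>B\<^esub>"
    and gen: "\<And>u. u \<in> carrier R \<Longrightarrow>
      u \<ominus>\<^bsub>R\<^esub> finsum R (\<lambda>j. f (\<kappa> j u) \<otimes>\<^bsub>R\<^esub> e j) {..<n} \<in> action_span (regular_module R) S (carrier R)"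
  shows "projective_module B Q"
proof -
  from P obtain X :: "'p set" and i q where i: "i \<in> mod_hom R P (free_module R X)"
    and q: "q \<in> mod_hom R (free_module R X) P" and qi: "\<And>x. x \<in> carrier P \<Longrightarrow> q (i x) = x"
    and P': "lmodule R P"
    unfolding projective_module_def by blast
  let ?F = "free_module R X"
  interpret P: lmodule R P by fact
  interpret B: ring B by fact
  interpret Q: lmodule B Q by fact
  interpret F: lmodule R ?F by (rule P.R.lmodule_free)
  interpret reg: lmodule R "regular_module R" by (rule lmodule_regular[OF P.R.ring_axioms])
  interpret PB: lmodule B "restrict_scalars f P" by (rule lmodule_restrict_scalars[OF \<open>ring B\<close> f P'])
  interpret FB: lmodule B "restrict_scalars f ?F"
    by (rule lmodule_restrict_scalars[OF \<open>ring B\<close> f F.lmodule_axioms])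
  note f_closed = ring_hom_closed[OF f]
  have pD: "p x \<in> carrier Q" "p (x \<oplus>\<^bsub>P\<^esub> y) = p x \<oplus>\<^bsub>Q\<^esub> p y"
    if "x \<in> carrier P" "y \<in> carrier P" for x y
    using mod_homD(1,2)[OF p(1)] that by simp_all
  have \<kappa>_zero: "\<kappa> j \<zero>\<^bsub>R\<^esub> = \<zero>\<^bsub>B\<^esub>" if "j < n" for j
    using additive_zero[OF P.R.is_abelian_group B.is_abelian_group, of "\<kappa> j"] \<kappa>(1,2) that by blast
  have i_carrier: "i a x \<in> carrier R" "x \<notin> X \<Longrightarrow> i a x = \<zero>\<^bsub>R\<^esub>" "finite {x. i a x \<noteq> \<zero>\<^bsub>R\<^esub>}"
    if "a \<in> carrier P" for a x
    using mod_hom_closed[OF i that] by (auto simp: P.R.free_module_carrier)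
  let ?Y = "X \<times> {..<n}"
  let ?FB = "free_module B ?Y"
  \<comment> \<open>Coordinates over \<open>B\<close> on the free module: the entry at
    \<open>(x, j)\<close> is the \<open>j\<close>-th coordinate of the coefficient at
    \<open>x\<close>.\<close>
  define K where "K g = (\<lambda>(x, j). if j < n then \<kappa> j (g x) else \<zero>\<^bsub>B\<^esub>)" for g :: "'p \<Rightarrow> 'r"
  have K_carrier: "K g \<in> carrier ?FB" if g: "g \<in> carrier ?F" for g
  proof -
    have *: "g x \<in> carrier R" "x \<notin> X \<Longrightarrow> g x = \<zero>\<^bsub>R\<^esub>" for x using g by (auto simp: P.R.free_module_carrier)
    have "{y. K g y \<noteq> \<zero>\<^bsub>B\<^esub>} \<subseteq> {x. g x \<noteq> \<zero>\<^bsub>R\<^esub>} \<times> {..<n}"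
      using \<kappa>_zero by (auto simp: K_def split: if_splits)
    moreover have "finite {x. g x \<noteq> \<zero>\<^bsub>R\<^esub>}" using g by (simp add: P.R.free_module_carrier)
    ultimately have "finite {y. K g y \<noteq> \<zero>\<^bsub>B\<^esub>}" by (meson finite_SigmaI finite_lessThan finite_subset)
    then show ?thesis
      using * \<kappa>(1) \<kappa>_zero by (auto simp: B.free_module_carrier K_def)
  qed
  have K_add: "K (g \<oplus>\<^bsub>?F\<^esub> h) = K g \<oplus>\<^bsub>?FB\<^esub> K h" if "g \<in> carrier ?F" "h \<in> carrier ?F" for g h
    using that \<kappa>(2) by (auto simp: K_def fun_eq_iff P.R.free_module_carrier free_module_simps)
  have K_smult: "K (f b \<odot>\<^bsub>?F\<^esub> g) = b \<odot>\<^bsub>?FB\<^esub> K g" if "b \<in> carrier B" "g \<in> carrier ?F" for b g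
    using that \<kappa>(3) by (auto simp: K_def fun_eq_iff P.R.free_module_carrier free_module_simps)
  have K_hom: "K \<in> mod_hom B (restrict_scalars f ?F) ?FB"
    by (rule mod_homI) (simp_all only: restrict_scalars_simps K_carrier K_add K_smult)
  define pq where "pq g = p (q g)" for g
  have pq: "pq \<in> mod_hom B (restrict_scalars f ?F) Q"
    unfolding pq_def by (rule mod_hom_compose[OF mod_hom_restrict_scalars[OF f q] p(1)])
  \<comment> \<open>The images in \<open>Q\<close> of the \<open>e j\<close> multiples of the basis
    vectors, which are to generate \<open>Q\<close> over \<open>B\<close>.\<close>
  define v where "v = (\<lambda>(x, j). pq (e j \<odot>\<^bsub>?F\<^esub> basis_vector R x))"
  have ej: "e j \<odot>\<^bsub>?F\<^esub> basis_vector R x \<in> carrier ?F" if "j < n" "x \<in> X" for j x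
    using that e by (intro F.smult_closed P.R.basis_vector_closed)
  have v: "v \<in> ?Y \<rightarrow> carrier Q"
    using mod_hom_closed[OF pq] ej by (auto simp: v_def)
  define q' where "q' = free_lift B Q v"
  have q': "q' \<in> mod_hom B ?FB Q" unfolding q'_def by (rule Q.free_lift_hom[OF v])
  \<comment> \<open>Passing to coordinates and back loses only the remainder in \<open>gen\<close>.
    It lies in the right ideal generated by \<open>S\<close>, so it contributes an element of
    \<open>S P\<close>, which \<open>p\<close> kills.\<close>
  have K_basis: "q' (K (u \<odot>\<^bsub>?F\<^esub> basis_vector R x)) = pq (u \<odot>\<^bsub>?F\<^esub> basis_vector R x)"
    if u: "u \<in> carrier R" and x: "x \<in> X" for u x
  proof -
    let ?\<delta> = "basis_vector R x"
    have \<delta>: "?\<delta> \<in> carrier ?F" by (rule P.R.basis_vector_closed[OF x])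
    have u\<delta>: "w \<odot>\<^bsub>?F\<^esub> ?\<delta> \<in> carrier ?F" if "w \<in> carrier R" for w by (rule F.smult_closed[OF that \<delta>])
    have Ku: "K (u \<odot>\<^bsub>?F\<^esub> ?\<delta>) = (\<lambda>(y, j). if y = x \<and> j < n then \<kappa> j u else \<zero>\<^bsub>B\<^esub>)"
      using u \<kappa>_zero by (auto simp: K_def fun_eq_iff basis_vector_def free_module_simps)
    have t: "(\<lambda>j. \<kappa> j u \<odot>\<^bsub>Q\<^esub> v (x, j)) \<in> {..<n} \<rightarrow> carrier Q"
      using v x u \<kappa>(1) by (auto intro!: Q.smult_closed)
    have c: "f (\<kappa> j u) \<otimes>\<^bsub>R\<^esub> e j \<in> carrier R" if "j < n" for j using that u \<kappa>(1) e f_closed by simp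
    have "q' (K (u \<odot>\<^bsub>?F\<^esub> ?\<delta>)) = finsum Q (\<lambda>y. K (u \<odot>\<^bsub>?F\<^esub> ?\<delta>) y \<odot>\<^bsub>Q\<^esub> v y) (Pair x ` {..<n})"
      unfolding q'_def
      by (rule Q.free_lift_superset[OF K_carrier[OF u\<delta>[OF u]] v])
        (use x in \<open>auto simp: Ku split: if_splits\<close>)
    also have "\<dots> = finsum Q (\<lambda>j. K (u \<odot>\<^bsub>?F\<^esub> ?\<delta>) (x, j) \<odot>\<^bsub>Q\<^esub> v (x, j)) {..<n}"
      by (rule Q.M.finsum_reindex) (use t in \<open>auto simp: Ku inj_on_def\<close>)
    also have "\<dots> = finsum Q (\<lambda>j. \<kappa> j u \<odot>\<^bsub>Q\<^esub> v (x, j)) {..<n}"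
      by (rule Q.M.finsum_cong') (use t in \<open>auto simp: Ku\<close>)
    also have "\<dots> = finsum Q (\<lambda>j. pq ((f (\<kappa> j u) \<otimes>\<^bsub>R\<^esub> e j) \<odot>\<^bsub>?F\<^esub> ?\<delta>)) {..<n}"
    proof (rule Q.M.finsum_cong'[OF refl])
      fix j assume "j \<in> {..<n}"
      then have j: "j < n" by simp
      have "pq ((f (\<kappa> j u) \<otimes>\<^bsub>R\<^esub> e j) \<odot>\<^bsub>?F\<^esub> ?\<delta>) = pq (f (\<kappa> j u) \<odot>\<^bsub>?F\<^esub> (e j \<odot>\<^bsub>?F\<^esub> ?\<delta>))"
        using F.smult_assoc[OF f_closed[OF \<kappa>(1)[OF j u]] e[OF j] \<delta>] by simp
      then show "\<kappa> j u \<odot>\<^bsub>Q\<^esub> v (x, j) = pq ((f (\<kappa> j u) \<otimes>\<^bsub>R\<^esub> e j) \<odot>\<^bsub>?F\<^esub> ?\<delta>)"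
        using mod_hom_smult[OF pq \<kappa>(1)[OF j u]] ej[OF j x] by (simp add: v_def)
    qed (use mod_hom_closed[OF pq] u\<delta> c in auto)
    also have "\<dots> = pq (finsum (restrict_scalars f ?F) (\<lambda>j. (f (\<kappa> j u) \<otimes>\<^bsub>R\<^esub> e j) \<odot>\<^bsub>?F\<^esub> ?\<delta>) {..<n})"
      by (rule mod_hom_finsum[OF FB.lmodule_axioms Q pq, symmetric]) (use u\<delta> c in auto)
    also have "finsum (restrict_scalars f ?F) (\<lambda>j. (f (\<kappa> j u) \<otimes>\<^bsub>R\<^esub> e j) \<odot>\<^bsub>?F\<^esub> ?\<delta>) {..<n}
        = finsum ?F (\<lambda>j. (f (\<kappa> j u) \<otimes>\<^bsub>R\<^esub> e j) \<odot>\<^bsub>?F\<^esub> ?\<delta>) {..<n}"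
      by (subst finsum_cong_group[of _ ?F]) simp_all
    also have "\<dots> = finsum (regular_module R) (\<lambda>j. f (\<kappa> j u) \<otimes>\<^bsub>R\<^esub> e j) {..<n} \<odot>\<^bsub>?F\<^esub> ?\<delta>"
    proof (rule mod_hom_finsum[OF reg.lmodule_axioms F.lmodule_axioms _ _, symmetric])
      show "(\<lambda>w. w \<odot>\<^bsub>?F\<^esub> ?\<delta>) \<in> mod_hom R (regular_module R) ?F"
        using u\<delta> \<delta> F.smult_l_distr[OF _ _ \<delta>] F.smult_assoc[OF _ _ \<delta>] by (intro mod_homI) simp_all
    qed (use c in auto)
    also have "finsum (regular_module R) (\<lambda>j. f (\<kappa> j u) \<otimes>\<^bsub>R\<^esub> e j) {..<n} = finsum R (\<lambda>j. f (\<kappa> j u) \<otimes>\<^bsub>R\<^esub> e j) {..<n}"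
      (is "_ = ?s")
      by (subst finsum_cong_group[of _ R]) simp_all
    finally have 1: "q' (K (u \<odot>\<^bsub>?F\<^esub> ?\<delta>)) = pq (?s \<odot>\<^bsub>?F\<^esub> ?\<delta>)" .
    have s: "?s \<in> carrier R" by (rule P.R.finsum_closed) (use c in auto)
    have "q ((u \<ominus>\<^bsub>R\<^esub> ?s) \<odot>\<^bsub>?F\<^esub> ?\<delta>) \<in> action_span P S (carrier P)"
    proof (rule additive_action_span[where h = "\<lambda>w. q (w \<odot>\<^bsub>?F\<^esub> ?\<delta>)" and M = "regular_module R" and N = P
          and R = R and S = S and U = "carrier R"])
      show "q ((w \<oplus>\<^bsub>regular_module R\<^esub> w') \<odot>\<^bsub>?F\<^esub> ?\<delta>) = q (w \<odot>\<^bsub>?F\<^esub> ?\<delta>) \<oplus>\<^bsub>P\<^esub> q (w' \<odot>\<^bsub>?F\<^esub> ?\<delta>)"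
        if "w \<in> carrier (regular_module R)" "w' \<in> carrier (regular_module R)" for w w'
        using that F.smult_l_distr[OF _ _ \<delta>] mod_hom_add[OF q u\<delta> u\<delta>] by simp
      show "q ((s \<odot>\<^bsub>regular_module R\<^esub> w) \<odot>\<^bsub>?F\<^esub> ?\<delta>) \<in> action_span P S (carrier P)"
        if "s \<in> S" "w \<in> carrier R" for s w
      proof -
        have sR: "s \<in> carrier R" using S that by auto
        have "q ((s \<otimes>\<^bsub>R\<^esub> w) \<odot>\<^bsub>?F\<^esub> ?\<delta>) = s \<odot>\<^bsub>P\<^esub> q (w \<odot>\<^bsub>?F\<^esub> ?\<delta>)"
          using F.smult_assoc[OF sR that(2) \<delta>] mod_hom_smult[OF q sR u\<delta>[OF that(2)]] by simp
        then show ?thesis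
          using P.action_span_incl[OF S subset_refl that(1) mod_hom_closed[OF q u\<delta>[OF that(2)]]] by simp
      qed
    qed (use S gen[OF u] u\<delta> mod_hom_closed[OF q] P.action_span_add[OF S subset_refl] in
        \<open>auto simp: action_span.zero reg.M.abelian_group_axioms P.M.abelian_group_axioms\<close>)
    then have "pq ((u \<ominus>\<^bsub>R\<^esub> ?s) \<odot>\<^bsub>?F\<^esub> ?\<delta>) = \<zero>\<^bsub>Q\<^esub>"
      using ker mod_hom_closed[OF q u\<delta>[of "u \<ominus>\<^bsub>R\<^esub> ?s"]] u s by (simp add: pq_def)
    moreover have "u \<odot>\<^bsub>?F\<^esub> ?\<delta> = ((u \<ominus>\<^bsub>R\<^esub> ?s) \<odot>\<^bsub>?F\<^esub> ?\<delta>) \<oplus>\<^bsub>?F\<^esub> (?s \<odot>\<^bsub>?F\<^esub> ?\<delta>)"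
      using F.smult_l_distr[of "u \<ominus>\<^bsub>R\<^esub> ?s" ?s, OF _ s \<delta>] u s P.R.minus_add_cancel[OF u s] by simp
    ultimately have "pq (u \<odot>\<^bsub>?F\<^esub> ?\<delta>) = pq (?s \<odot>\<^bsub>?F\<^esub> ?\<delta>)"
      using mod_hom_add[OF pq, of "(u \<ominus>\<^bsub>R\<^esub> ?s) \<odot>\<^bsub>?F\<^esub> ?\<delta>" "?s \<odot>\<^bsub>?F\<^esub> ?\<delta>"] mod_hom_closed[OF pq, of "?s \<odot>\<^bsub>?F\<^esub> ?\<delta>"]
        u\<delta> u s by simp
    then show ?thesis using 1 by simp
  qed
  have K_lift: "q' (K g) = pq g" if "g \<in> carrier ?F" for g
    using that
  proof (induction rule: P.R.free_module_induct)
    case zero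
    have "q' (K \<zero>\<^bsub>?F\<^esub>) = \<zero>\<^bsub>Q\<^esub>" "pq \<zero>\<^bsub>?F\<^esub> = \<zero>\<^bsub>Q\<^esub>"
      using mod_hom_zero[OF FB.lmodule_axioms Q mod_hom_compose[OF K_hom q']] mod_hom_zero[OF FB.lmodule_axioms Q pq]
      by simp_all
    then show ?case by (simp add: free_module_simps)
  next
    case (add g u x)
    have u\<delta>: "u \<odot>\<^bsub>?F\<^esub> basis_vector R x \<in> carrier ?F"
      using add by (intro F.smult_closed P.R.basis_vector_closed)
    have "q' (K (g \<oplus>\<^bsub>?F\<^esub> u \<odot>\<^bsub>?F\<^esub> basis_vector R x)) = q' (K g) \<oplus>\<^bsub>Q\<^esub> q' (K (u \<odot>\<^bsub>?F\<^esub> basis_vector R x))"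
      using mod_hom_add[OF mod_hom_compose[OF K_hom q'], of g "u \<odot>\<^bsub>?F\<^esub> basis_vector R x"] add(1) u\<delta> by simp
    also have "\<dots> = pq g \<oplus>\<^bsub>Q\<^esub> pq (u \<odot>\<^bsub>?F\<^esub> basis_vector R x)"
      using add K_basis by simp
    also have "\<dots> = pq (g \<oplus>\<^bsub>?F\<^esub> u \<odot>\<^bsub>?F\<^esub> basis_vector R x)"
      using mod_hom_add[OF pq, of g "u \<odot>\<^bsub>?F\<^esub> basis_vector R x"] add(1) u\<delta> by simp
    finally show ?case .
  qed
  have iB: "i \<in> mod_hom B (restrict_scalars f P) (restrict_scalars f ?F)"
    by (rule mod_hom_restrict_scalars[OF f i])
  have Ki: "(\<lambda>a. K (i a)) \<in> mod_hom B (restrict_scalars f P) ?FB"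
    by (rule mod_hom_compose[OF iB K_hom])
  \<comment> \<open>Coordinates vanish on products with a left factor in \<open>S\<close>, so
    \<open>K i\<close> descends to \<open>Q = P / S P\<close>.\<close>
  have K_span: "K (i a) = \<zero>\<^bsub>?FB\<^esub>" if "a \<in> action_span P S (carrier P)" for a
  proof -
    have "K (i a) \<in> {\<zero>\<^bsub>?FB\<^esub>}"
    proof (rule additive_action_span[where h = "\<lambda>a. K (i a)" and M = P and N = ?FB
          and R = R and S = S and U = "carrier P"])
      interpret FB': lmodule B ?FB by (rule B.lmodule_free)
      show "abelian_group ?FB" by (rule FB'.M.abelian_group_axioms)
      show "x \<oplus>\<^bsub>?FB\<^esub> y \<in> {\<zero>\<^bsub>?FB\<^esub>}" if "x \<in> {\<zero>\<^bsub>?FB\<^esub>}" "y \<in> {\<zero>\<^bsub>?FB\<^esub>}" for x y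
        using that by (simp add: fun_eq_iff free_module_simps)
      show "K (i (s \<odot>\<^bsub>P\<^esub> a)) \<in> {\<zero>\<^bsub>?FB\<^esub>}" if "s \<in> S" "a \<in> carrier P" for s a
      proof -
        have "i (s \<odot>\<^bsub>P\<^esub> a) = (\<lambda>x. s \<otimes>\<^bsub>R\<^esub> i a x)"
          using mod_hom_smult[OF i] that S by (auto simp: free_module_simps)
        then show ?thesis using that \<kappa>(4) i_carrier(1)[OF that(2)] by (auto simp: K_def fun_eq_iff free_module_simps)
      qed
    qed (use mod_homD(1,2)[OF Ki] S that in \<open>auto simp: P.M.abelian_group_axioms intro!: P.smult_closed\<close>)
    then show ?thesis by simp
  qed
  define rep where "rep y = inv_into (carrier P) p y" for y
  have rep: "rep y \<in> carrier P" "p (rep y) = y" if "y \<in> carrier Q" for y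
    using that p(2) by (auto simp: rep_def inv_into_into f_inv_into_f)
  have Ki_rep: "K (i (rep (p a))) = K (i a)" if a: "a \<in> carrier P" for a
  proof -
    have r: "rep (p a) \<in> carrier P" "p (rep (p a)) = p a" using rep[of "p a"] pD(1)[OF a a] by auto
    have "p (rep (p a) \<ominus>\<^bsub>P\<^esub> a) = p (rep (p a)) \<ominus>\<^bsub>Q\<^esub> p a"
      using mod_hom_minus(2)[OF PB.lmodule_axioms Q p(1)] r a a_inv_cong(2)[of "restrict_scalars f P" P] by simp
    then have "p (rep (p a) \<ominus>\<^bsub>P\<^esub> a) = \<zero>\<^bsub>Q\<^esub>" using r pD(1)[OF a a] by simp
    then have "K (i (rep (p a) \<ominus>\<^bsub>P\<^esub> a)) = \<zero>\<^bsub>?FB\<^esub>" using ker r a K_span by simp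
    moreover have "K (i (rep (p a) \<ominus>\<^bsub>P\<^esub> a \<oplus>\<^bsub>P\<^esub> a)) = K (i (rep (p a) \<ominus>\<^bsub>P\<^esub> a)) \<oplus>\<^bsub>?FB\<^esub> K (i a)"
      using mod_hom_add[OF Ki, of "rep (p a) \<ominus>\<^bsub>P\<^esub> a" a] r a by (simp del: P.M.minus_add_cancel)
    ultimately have "K (i (rep (p a))) = \<zero>\<^bsub>?FB\<^esub> \<oplus>\<^bsub>?FB\<^esub> K (i a)"
      using r a P.M.minus_add_cancel[of "rep (p a)" a] by simp
    moreover have "K (i a) y \<in> carrier B" for y
      using mod_hom_closed[OF Ki, of a] a by (cases y) (simp add: B.free_module_carrier)
    ultimately show ?thesis by (simp add: fun_eq_iff free_module_simps)
  qed
  show ?thesis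
  \<comment> \<open>The section sends a class to the coordinates of a representative;
    \<open>K_lift\<close> and \<open>q i = 1\<close> show that \<open>q'\<close> is a left inverse
    of it.\<close>
  proof (rule projective_moduleI[OF Q _ q'])
    show "(\<lambda>y. K (i (rep y))) \<in> mod_hom B Q ?FB"
    proof (rule mod_homI)
      fix y assume "y \<in> carrier Q"
      then obtain a where a: "a \<in> carrier P" "y = p a" using p(2) by auto
      show "K (i (rep y)) \<in> carrier ?FB" using mod_hom_closed[OF Ki, of a] a by (simp add: Ki_rep)
      {
        fix z assume "z \<in> carrier Q"
        then obtain b where b: "b \<in> carrier P" "z = p b" using p(2) by auto
        show "K (i (rep (y \<oplus>\<^bsub>Q\<^esub> z))) = K (i (rep y)) \<oplus>\<^bsub>?FB\<^esub> K (i (rep z))"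
          using mod_hom_add[OF Ki, of a b] a b by (simp add: Ki_rep pD(2)[symmetric])
      next
        fix c assume c: "c \<in> carrier B"
        have "c \<odot>\<^bsub>Q\<^esub> y = p (f c \<odot>\<^bsub>P\<^esub> a)" using mod_hom_smult[OF p(1) c, of a] a by simp
        moreover have "f c \<odot>\<^bsub>P\<^esub> a \<in> carrier P" using c a f_closed by (intro P.smult_closed)
        ultimately show "K (i (rep (c \<odot>\<^bsub>Q\<^esub> y))) = c \<odot>\<^bsub>?FB\<^esub> K (i (rep y))"
          using mod_hom_smult[OF Ki c, of a] a by (simp add: Ki_rep)
      }
    qed
    show "q' (K (i (rep y))) = y" if "y \<in> carrier Q" for y
      using K_lift[OF mod_hom_closed[OF i rep(1)[OF that]]] rep[OF that] by (simp add: pq_def qi)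
  qed
qed

lemma additive_finsum:
  assumes "abelian_group M" "abelian_group N"
    and h: "\<And>x. x \<in> carrier M \<Longrightarrow> h x \<in> carrier N"
      "\<And>x y. \<lbrakk>x \<in> carrier M; y \<in> carrier M\<rbrakk> \<Longrightarrow> h (x \<oplus>\<^bsub>M\<^esub> y) = h x \<oplus>\<^bsub>N\<^esub> h y"
    and "finite I" "f \<in> I \<rightarrow> carrier M"
  shows "h (finsum M f I) = finsum N (\<lambda>i. h (f i)) I"
proof -
  interpret M: abelian_group M by fact
  interpret N: abelian_group N by fact
  show ?thesis using assms(5,6)
    by (induction I rule: finite_induct) (auto simp: Pi_def h additive_zero[OF assms(1,2) h])
qed

lemma action_span_empty: "action_span M {} U = {\<zero>\<^bsub>M\<^esub>}"
  by (auto elim: action_span.cases intro: action_span.zero)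

section \<open>Bimodules over a finite-dimensional algebra\<close>

context fin_dim_algebra
begin

sublocale envelope K A
  by (intro envelope.intro assoc_algebra_axioms)

lemma left_unit_ring_hom: "left_unit \<in> ring_hom A Ae"
  by (rule ring_hom_memI) (simp_all add: left_unit_mult left_unit_add unit_one)

lemma right_unit_ring_hom: "right_unit \<in> ring_hom (op_ring A) Ae"
  by (rule ring_hom_memI) (simp_all add: right_unit_mult right_unit_add unit_one)

abbreviation "left_mod M \<equiv> restrict_scalars left_unit M"
abbreviation "right_mod M \<equiv> restrict_scalars right_unit M"

lemma unit_tensor:
  "\<lbrakk>a \<in> carrier A; b \<in> carrier A\<rbrakk> \<Longrightarrow> left_unit a \<otimes>\<^bsub>Ae\<^esub> right_unit b = T.pt a b"
  by (simp add: pt_eq_units)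

lemma right_unit_mult_tensor:
  assumes "a \<in> carrier A" "b \<in> carrier A" "c \<in> carrier A"
  shows "right_unit c \<otimes>\<^bsub>Ae\<^esub> (left_unit a \<otimes>\<^bsub>Ae\<^esub> right_unit b) = T.pt a (b \<otimes>\<^bsub>A\<^esub> c)"
proof -
  have "right_unit c \<otimes>\<^bsub>Ae\<^esub> (left_unit a \<otimes>\<^bsub>Ae\<^esub> right_unit b) = (left_unit a \<otimes>\<^bsub>Ae\<^esub> right_unit c) \<otimes>\<^bsub>Ae\<^esub> right_unit b"
    using assms by (simp add: units_commute Ae.m_assoc)
  also have "\<dots> = left_unit a \<otimes>\<^bsub>Ae\<^esub> right_unit (b \<otimes>\<^bsub>A\<^esub> c)"
    using assms by (simp add: right_unit_mult Ae.m_assoc)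
  finally show ?thesis using assms by (simp add: unit_tensor)
qed

lemma pt_add:
  assumes "a \<in> carrier A" "b \<in> carrier A" "c \<in> carrier A"
  shows "T.pt a (b \<oplus>\<^bsub>A\<^esub> c) = T.pt a b \<oplus>\<^bsub>Ae\<^esub> T.pt a c" "T.pt (b \<oplus>\<^bsub>A\<^esub> c) a = T.pt b a \<oplus>\<^bsub>Ae\<^esub> T.pt c a"
  using T.pt_add_left T.pt_add_right assms by (simp_all add: Ae_eq)

lemma pt_Ae: "\<lbrakk>a \<in> carrier A; b \<in> carrier A\<rbrakk> \<Longrightarrow> T.pt a b \<in> carrier Ae"
  by (simp add: pt_eq_units)

lemma Ae_lift:
  assumes bal: "balanced K A (op_ring A) (add_monoid A) \<phi>"
  shows "u \<in> carrier Ae \<Longrightarrow> tensor_lift (add_monoid A) \<phi> u \<in> carrier A"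
    and "\<lbrakk>u \<in> carrier Ae; v \<in> carrier Ae\<rbrakk> \<Longrightarrow> tensor_lift (add_monoid A) \<phi> (u \<oplus>\<^bsub>Ae\<^esub> v)
      = tensor_lift (add_monoid A) \<phi> u \<oplus>\<^bsub>A\<^esub> tensor_lift (add_monoid A) \<phi> v"
    and "\<lbrakk>a \<in> carrier A; b \<in> carrier A\<rbrakk> \<Longrightarrow> tensor_lift (add_monoid A) \<phi> (T.pt a b) = \<phi> (a, b)"
  using hom_in_carrier[OF T.tensor_lift_hom[OF M.a_comm_group bal]]
    hom_mult[OF T.tensor_lift_hom[OF M.a_comm_group bal]] T.tensor_lift_pt[OF M.a_comm_group bal]
  by (simp_all add: Ae_eq)

text \<open>The remainder is additive in \<open>u\<close>, so membership in an additively closed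
  \<open>W\<close> is checked on pure tensors.\<close>

lemma coordinates_induct:
  assumes u: "u \<in> carrier Ae" and W: "\<And>x y. \<lbrakk>x \<in> W; y \<in> W\<rbrakk> \<Longrightarrow> x \<oplus>\<^bsub>Ae\<^esub> y \<in> W"
    and t: "\<And>j u. \<lbrakk>j < n; u \<in> carrier Ae\<rbrakk> \<Longrightarrow> t j u \<in> carrier Ae"
      "\<And>j u v. \<lbrakk>j < n; u \<in> carrier Ae; v \<in> carrier Ae\<rbrakk> \<Longrightarrow> t j (u \<oplus>\<^bsub>Ae\<^esub> v) = t j u \<oplus>\<^bsub>Ae\<^esub> t j v"
    and pt: "\<And>a b. \<lbrakk>a \<in> carrier A; b \<in> carrier A\<rbrakk>
      \<Longrightarrow> T.pt a b \<ominus>\<^bsub>Ae\<^esub> finsum Ae (\<lambda>j. t j (T.pt a b)) {..<n::nat} \<in> W"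
  shows "u \<ominus>\<^bsub>Ae\<^esub> finsum Ae (\<lambda>j. t j u) {..<n} \<in> W"
  using u
proof (induction rule: Ae_induct)
  case (unit a b)
  then show ?case using pt by (simp add: unit_tensor)
next
  case (add u v)
  have c: "(\<lambda>j. t j w) \<in> {..<n} \<rightarrow> carrier Ae" if "w \<in> carrier Ae" for w using t(1) that by auto
  have "finsum Ae (\<lambda>j. t j (u \<oplus>\<^bsub>Ae\<^esub> v)) {..<n} = finsum Ae (\<lambda>j. t j u \<oplus>\<^bsub>Ae\<^esub> t j v) {..<n}"
    by (rule Ae.finsum_cong') (use c[OF add(1)] c[OF add(2)] add t(2) in auto)
  also have "\<dots> = finsum Ae (\<lambda>j. t j u) {..<n} \<oplus>\<^bsub>Ae\<^esub> finsum Ae (\<lambda>j. t j v) {..<n}"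
    by (rule Ae.finsum_addf[OF c[OF add(1)] c[OF add(2)]])
  finally have "(u \<oplus>\<^bsub>Ae\<^esub> v) \<ominus>\<^bsub>Ae\<^esub> finsum Ae (\<lambda>j. t j (u \<oplus>\<^bsub>Ae\<^esub> v)) {..<n}
    = (u \<ominus>\<^bsub>Ae\<^esub> finsum Ae (\<lambda>j. t j u) {..<n}) \<oplus>\<^bsub>Ae\<^esub> (v \<ominus>\<^bsub>Ae\<^esub> finsum Ae (\<lambda>j. t j v) {..<n})"
    using add(1,2) Ae.finsum_closed[OF c[OF add(1)]] Ae.finsum_closed[OF c[OF add(2)]]
    by (simp add: a_minus_def Ae.minus_add Ae.a_ac)
  then show ?case using W[OF add(3,4)] by simp
qed

text \<open>Modulo the right action of \<open>J\<close> the enveloping algebra becomes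
  \<open>A \<otimes> (A / J)\<close>, a free left \<open>A\<close>-module on a basis of
  \<open>A / J\<close>.\<close>

lemma projective_left_quotient:
  assumes P: "projective_module Ae P" and Q: "lmodule A Q"
    and p: "p \<in> mod_hom A (left_mod P) Q" "p ` carrier P = carrier Q"
    and ker: "\<And>x. x \<in> carrier P \<Longrightarrow> p x = \<zero>\<^bsub>Q\<^esub> \<longleftrightarrow> x \<in> action_span P (right_unit ` J) (carrier P)"
  shows "projective_module A Q"
proof -
  note JD = V.submoduleD[OF left_ideal_subspace[OF left_ideal_J]]
  obtain n e \<kappa> where "V.coordinates_mod J n e \<kappa>"
    by (rule V.exists_coordinates_mod[OF finite_dim left_ideal_subspace[OF left_ideal_J]])
  then have e: "\<And>j. j < n \<Longrightarrow> e j \<in> carrier A"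
    and \<kappa>: "\<And>j. j < n \<Longrightarrow> \<kappa> j \<in> mod_hom K A (regular_module K)"
    and \<kappa>J: "\<And>j u. \<lbrakk>j < n; u \<in> J\<rbrakk> \<Longrightarrow> \<kappa> j u = \<zero>\<^bsub>K\<^esub>"
    and gen: "\<And>v. v \<in> carrier A \<Longrightarrow> v \<ominus>\<^bsub>A\<^esub> finsum A (\<lambda>j. \<kappa> j v \<odot>\<^bsub>A\<^esub> e j) {..<n} \<in> J"
    unfolding V.coordinates_mod_def by auto
  have \<kappa>K: "\<kappa> j a \<in> carrier K" "\<kappa> j (a \<oplus>\<^bsub>A\<^esub> b) = \<kappa> j a \<oplus>\<^bsub>K\<^esub> \<kappa> j b"
    "c \<in> carrier K \<Longrightarrow> \<kappa> j (c \<odot>\<^bsub>A\<^esub> a) = c \<otimes>\<^bsub>K\<^esub> \<kappa> j a"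
    if "j < n" "a \<in> carrier A" "b \<in> carrier A" for j a b c
    using mod_homD[OF \<kappa>[OF that(1)]] that by simp_all
  \<comment> \<open>The \<open>j\<close>-th coordinate of \<open>a \<otimes> b\<close>: the scalar
    \<open>\<kappa> j b\<close> is moved to the left factor.\<close>
  define \<phi> where "\<phi> j = (\<lambda>(a, b). \<kappa> j b \<odot>\<^bsub>A\<^esub> a)" for j
  have bal: "balanced K A (op_ring A) (add_monoid A) (\<phi> j)" if "j < n" for j
    using that
    by (auto simp: balanced_def \<phi>_def \<kappa>K smult_l_distr smult_r_distr smult_assoc1 K.m_comm
        simp flip: smult_assoc1)
  define k where "k j = tensor_lift (add_monoid A) (\<phi> j)" for j
  note k = Ae_lift[OF bal, folded k_def]
  have k_left: "k j (left_unit c \<otimes>\<^bsub>Ae\<^esub> u) = c \<otimes>\<^bsub>A\<^esub> k j u"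
    if "j < n" "c \<in> carrier A" "u \<in> carrier Ae" for j c u
    using that(3)
  proof (induction rule: Ae_induct)
    case (unit a b)
    have "left_unit c \<otimes>\<^bsub>Ae\<^esub> (left_unit a \<otimes>\<^bsub>Ae\<^esub> right_unit b) = T.pt (c \<otimes>\<^bsub>A\<^esub> a) b"
      using unit that by (simp add: pt_eq_units left_unit_mult Ae.m_assoc)
    then show ?case using unit that by (simp add: unit_tensor k \<phi>_def smult_mult_right \<kappa>K)
  qed (use that in \<open>simp_all add: k Ae.r_distr A.r_distr\<close>)
  have k_J: "k j (right_unit i \<otimes>\<^bsub>Ae\<^esub> u) = \<zero>\<^bsub>A\<^esub>" if "j < n" "i \<in> J" "i \<in> carrier A" "u \<in> carrier Ae" for j i u
    using that(4)
  proof (induction rule: Ae_induct)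
    case (unit a b)
    then show ?case
      using that left_idealD(5)[OF left_ideal_J, of b i]
      by (simp add: right_unit_mult_tensor k \<phi>_def \<kappa>J)
  qed (use that in \<open>simp_all add: k Ae.r_distr\<close>)
  have k_S: "k j (s \<otimes>\<^bsub>Ae\<^esub> u) = \<zero>\<^bsub>A\<^esub>" if "j < n" "s \<in> right_unit ` J" "u \<in> carrier Ae" for j s u
    using that k_J JD(1) by auto
  show ?thesis
  proof (rule projective_restrict_scalars_quotient[OF A.ring_axioms left_unit_ring_hom P _ Q p ker,
        where n = n and e = "\<lambda>j. right_unit (e j)" and \<kappa> = k])
    show "right_unit ` J \<subseteq> carrier Ae" using JD(1) by auto
    fix u assume u: "u \<in> carrier Ae"
    interpret reg: lmodule Ae "regular_module Ae" by (rule lmodule_regular[OF Ae.ring_axioms])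
    have SJ: "right_unit ` J \<subseteq> carrier Ae" using JD(1) by auto
    show "u \<ominus>\<^bsub>Ae\<^esub> finsum Ae (\<lambda>j. left_unit (k j u) \<otimes>\<^bsub>Ae\<^esub> right_unit (e j)) {..<n}
      \<in> action_span (regular_module Ae) (right_unit ` J) (carrier Ae)"
    proof (rule coordinates_induct[OF u])
      show "x \<oplus>\<^bsub>Ae\<^esub> y \<in> action_span (regular_module Ae) (right_unit ` J) (carrier Ae)"
        if "x \<in> action_span (regular_module Ae) (right_unit ` J) (carrier Ae)"
          "y \<in> action_span (regular_module Ae) (right_unit ` J) (carrier Ae)" for x y
        using reg.action_span_add[OF SJ _ that] by simp
      fix a b assume a: "a \<in> carrier A" and b: "b \<in> carrier A"
      let ?s = "finsum A (\<lambda>j. \<kappa> j b \<odot>\<^bsub>A\<^esub> e j) {..<n}"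
      have c: "(\<lambda>j. \<kappa> j b \<odot>\<^bsub>A\<^esub> e j) \<in> {..<n} \<rightarrow> carrier A" using e \<kappa>K b by auto
      have "finsum Ae (\<lambda>j. left_unit (k j (T.pt a b)) \<otimes>\<^bsub>Ae\<^esub> right_unit (e j)) {..<n}
        = finsum Ae (\<lambda>j. T.pt a (\<kappa> j b \<odot>\<^bsub>A\<^esub> e j)) {..<n}"
      proof (rule Ae.finsum_cong'[OF refl])
        fix j assume "j \<in> {..<n}"
        then have j: "j < n" by simp
        have "left_unit (k j (T.pt a b)) \<otimes>\<^bsub>Ae\<^esub> right_unit (e j) = T.pt (\<kappa> j b \<odot>\<^bsub>A\<^esub> a) (e j)"
          using j a b e \<kappa>K by (simp add: k \<phi>_def unit_tensor)
        then show "left_unit (k j (T.pt a b)) \<otimes>\<^bsub>Ae\<^esub> right_unit (e j) = T.pt a (\<kappa> j b \<odot>\<^bsub>A\<^esub> e j)"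
          using T.pt_smult[of "\<kappa> j b" a "e j"] j a b e \<kappa>K by simp
      qed (use c a pt_Ae in auto)
      also have "\<dots> = T.pt a ?s"
        by (rule additive_finsum[OF A.is_abelian_group Ae.is_abelian_group, symmetric])
          (use a c in \<open>simp_all add: pt_Ae pt_add\<close>)
      finally have "T.pt a b \<ominus>\<^bsub>Ae\<^esub> finsum Ae (\<lambda>j. left_unit (k j (T.pt a b)) \<otimes>\<^bsub>Ae\<^esub> right_unit (e j)) {..<n}
        = T.pt a b \<ominus>\<^bsub>Ae\<^esub> T.pt a ?s" by simp
      also have "\<dots> = T.pt a (b \<ominus>\<^bsub>A\<^esub> ?s)"
        by (rule additive_minus(2)[OF A.is_abelian_group Ae.is_abelian_group, symmetric])
          (use a b M.finsum_closed[OF c] in \<open>simp_all add: pt_Ae pt_add\<close>)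
      also have "\<dots> = right_unit (b \<ominus>\<^bsub>A\<^esub> ?s) \<otimes>\<^bsub>Ae\<^esub> left_unit a"
        using a b M.finsum_closed[OF c] by (simp add: pt_eq_units units_commute)
      also have "\<dots> \<in> action_span (regular_module Ae) (right_unit ` J) (carrier Ae)"
        using reg.action_span_incl[OF SJ, of "carrier Ae" "right_unit (b \<ominus>\<^bsub>A\<^esub> ?s)" "left_unit a"] gen[OF b] a by simp
      finally show "T.pt a b \<ominus>\<^bsub>Ae\<^esub> finsum Ae (\<lambda>j. left_unit (k j (T.pt a b)) \<otimes>\<^bsub>Ae\<^esub> right_unit (e j)) {..<n}
        \<in> action_span (regular_module Ae) (right_unit ` J) (carrier Ae)" .
    qed (use k e in \<open>simp_all add: left_unit_add Ae.l_distr\<close>)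
  qed (use e k k_left k_S in auto)
qed

text \<open>\<open>Ae\<close> is free over \<open>op_ring A\<close> on a basis of \<open>A\<close>.
  As nothing is divided out, \<open>S\<close> is empty and the coordinates are taken modulo the zero
  subspace.\<close>

lemma projective_right:
  assumes P: "projective_module Ae P"
  shows "projective_module (op_ring A) (right_mod P)"
proof -
  have z: "submodule {\<zero>\<^bsub>A\<^esub>} K A"
    by (rule V.submoduleI) auto
  note OA = ring_op_ring[OF A.ring_axioms]
  obtain n e \<kappa> where "V.coordinates_mod {\<zero>\<^bsub>A\<^esub>} n e \<kappa>"
    by (rule V.exists_coordinates_mod[OF finite_dim z])
  then have e: "\<And>j. j < n \<Longrightarrow> e j \<in> carrier A"
    and \<kappa>: "\<And>j. j < n \<Longrightarrow> \<kappa> j \<in> mod_hom K A (regular_module K)"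
    and gen: "\<And>v. v \<in> carrier A \<Longrightarrow> v \<ominus>\<^bsub>A\<^esub> finsum A (\<lambda>j. \<kappa> j v \<odot>\<^bsub>A\<^esub> e j) {..<n} = \<zero>\<^bsub>A\<^esub>"
    unfolding V.coordinates_mod_def by auto
  have \<kappa>K: "\<kappa> j a \<in> carrier K" "\<kappa> j (a \<oplus>\<^bsub>A\<^esub> b) = \<kappa> j a \<oplus>\<^bsub>K\<^esub> \<kappa> j b"
    "c \<in> carrier K \<Longrightarrow> \<kappa> j (c \<odot>\<^bsub>A\<^esub> a) = c \<otimes>\<^bsub>K\<^esub> \<kappa> j a"
    if "j < n" "a \<in> carrier A" "b \<in> carrier A" for j a b c
    using mod_homD[OF \<kappa>[OF that(1)]] that by simp_all
  define \<phi> where "\<phi> j = (\<lambda>(a, b). \<kappa> j a \<odot>\<^bsub>A\<^esub> b)" for j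
  have bal: "balanced K A (op_ring A) (add_monoid A) (\<phi> j)" if "j < n" for j
    using that
    by (auto simp: balanced_def \<phi>_def \<kappa>K smult_l_distr smult_r_distr smult_assoc1 K.m_comm
        simp flip: smult_assoc1)
  define k where "k j = tensor_lift (add_monoid A) (\<phi> j)" for j
  note k = Ae_lift[OF bal, folded k_def]
  have k_right: "k j (right_unit c \<otimes>\<^bsub>Ae\<^esub> u) = k j u \<otimes>\<^bsub>A\<^esub> c"
    if "j < n" "c \<in> carrier A" "u \<in> carrier Ae" for j c u
    using that(3)
  proof (induction rule: Ae_induct)
    case (unit a b)
    then show ?case
      using that by (simp add: right_unit_mult_tensor) (simp add: unit_tensor k \<phi>_def smult_mult_left \<kappa>K)
  qed (use that in \<open>simp_all add: k Ae.r_distr A.l_distr\<close>)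
  interpret P: lmodule Ae P by (rule projective_module_lmodule[OF P])
  show ?thesis
  proof (rule projective_restrict_scalars_quotient[OF OA right_unit_ring_hom P _ _ mod_hom_id,
        where n = n and e = "\<lambda>j. left_unit (e j)" and \<kappa> = k and S = "{}"])
    show "lmodule (op_ring A) (right_mod P)"
      by (rule lmodule_restrict_scalars[OF OA right_unit_ring_hom P.lmodule_axioms])
    fix u assume u: "u \<in> carrier Ae"
    show "u \<ominus>\<^bsub>Ae\<^esub> finsum Ae (\<lambda>j. right_unit (k j u) \<otimes>\<^bsub>Ae\<^esub> left_unit (e j)) {..<n}
      \<in> action_span (regular_module Ae) {} (carrier Ae)"
      unfolding action_span_empty
    proof (rule coordinates_induct[OF u])
      fix a b assume a: "a \<in> carrier A" and b: "b \<in> carrier A"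
      let ?s = "finsum A (\<lambda>j. \<kappa> j a \<odot>\<^bsub>A\<^esub> e j) {..<n}"
      have c: "(\<lambda>j. \<kappa> j a \<odot>\<^bsub>A\<^esub> e j) \<in> {..<n} \<rightarrow> carrier A" using e \<kappa>K a by auto
      have "finsum Ae (\<lambda>j. right_unit (k j (T.pt a b)) \<otimes>\<^bsub>Ae\<^esub> left_unit (e j)) {..<n}
        = finsum Ae (\<lambda>j. T.pt (\<kappa> j a \<odot>\<^bsub>A\<^esub> e j) b) {..<n}"
      proof (rule Ae.finsum_cong'[OF refl])
        fix j assume "j \<in> {..<n}"
        then have j: "j < n" by simp
        have "right_unit (k j (T.pt a b)) \<otimes>\<^bsub>Ae\<^esub> left_unit (e j) = T.pt (e j) (\<kappa> j a \<odot>\<^bsub>A\<^esub> b)"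
          using j a b e \<kappa>K by (simp add: k \<phi>_def) (simp add: unit_tensor flip: units_commute)
        then show "right_unit (k j (T.pt a b)) \<otimes>\<^bsub>Ae\<^esub> left_unit (e j) = T.pt (\<kappa> j a \<odot>\<^bsub>A\<^esub> e j) b"
          using T.pt_smult[of "\<kappa> j a" "e j" b] j a b e \<kappa>K by simp
      qed (use c b pt_Ae in auto)
      also have "\<dots> = T.pt ?s b"
        by (rule additive_finsum[OF A.is_abelian_group Ae.is_abelian_group, symmetric])
          (use b c in \<open>simp_all add: pt_Ae pt_add\<close>)
      also have "?s = a" using gen[OF a] a M.finsum_closed[OF c] by (simp add: M.minus_eq_zero_iff)
      finally show "T.pt a b \<ominus>\<^bsub>Ae\<^esub> finsum Ae (\<lambda>j. right_unit (k j (T.pt a b)) \<otimes>\<^bsub>Ae\<^esub> left_unit (e j)) {..<n}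
        \<in> {\<zero>\<^bsub>regular_module Ae\<^esub>}" using a b pt_Ae by simp
    qed (use k e in \<open>simp_all add: right_unit_add Ae.l_distr\<close>)
  qed (use e k k_right in \<open>simp_all add: action_span_empty\<close>)
qed

text \<open>\<open>(u j) b = u (j b)\<close> with \<open>j b\<close> in the two-sided ideal
  \<open>J\<close>, and the left action commutes with the right one.\<close>

lemma submodule_action_span_J:
  assumes "lmodule Ae M" "submodule U Ae M"
  shows "submodule (action_span M (right_unit ` J) U) Ae M"
proof -
  interpret lmodule Ae M by fact
  note U = submoduleD[OF assms(2)]
  have SJ: "right_unit ` J \<subseteq> carrier Ae" using left_idealD(1)[OF left_ideal_J] by auto
  show ?thesis
  proof (rule submodule_action_span[OF SJ U(1)])
    fix r s u assume r: "r \<in> carrier Ae" and "s \<in> right_unit ` J" and u: "u \<in> U"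
    then obtain i where i: "i \<in> J" "i \<in> carrier A" "s = right_unit i" using left_idealD(1)[OF left_ideal_J] by auto
    have uM: "u \<in> carrier M" using u U(1) by auto
    have sM: "s \<in> carrier Ae" using i by simp
    show "r \<odot>\<^bsub>M\<^esub> (s \<odot>\<^bsub>M\<^esub> u) \<in> action_span M (right_unit ` J) U" using r
    proof (induction rule: Ae_induct)
      case (unit a b)
      have "left_unit a \<otimes>\<^bsub>Ae\<^esub> right_unit b \<otimes>\<^bsub>Ae\<^esub> s = left_unit a \<otimes>\<^bsub>Ae\<^esub> right_unit (i \<otimes>\<^bsub>A\<^esub> b)"
        using unit i by (simp add: right_unit_mult Ae.m_assoc)
      also have "\<dots> = right_unit (i \<otimes>\<^bsub>A\<^esub> b) \<otimes>\<^bsub>Ae\<^esub> left_unit a"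
        using unit i by (simp add: units_commute)
      finally have "(left_unit a \<otimes>\<^bsub>Ae\<^esub> right_unit b) \<odot>\<^bsub>M\<^esub> (s \<odot>\<^bsub>M\<^esub> u) = right_unit (i \<otimes>\<^bsub>A\<^esub> b) \<odot>\<^bsub>M\<^esub> (left_unit a \<odot>\<^bsub>M\<^esub> u)"
        using unit i uM sM by (simp flip: smult_assoc)
      also have "\<dots> \<in> action_span M (right_unit ` J) U"
        by (rule action_span_incl[OF SJ U(1)]) (use unit i u U(6) J_mult_right in auto)
      finally show ?case .
    next
      case (add v w)
      then show ?case
        using action_span_add[OF SJ U(1) add(3,4)] uM sM smult_closed by (simp add: smult_l_distr)
    qed
  qed
qed

lemma mod_hom_AeI:
  assumes "lmodule Ae M" "lmodule Ae N"
    and h: "h \<in> mod_hom A (left_mod M) (left_mod N)"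
    and r: "\<And>b x. \<lbrakk>b \<in> carrier A; x \<in> carrier M\<rbrakk> \<Longrightarrow> h (right_unit b \<odot>\<^bsub>M\<^esub> x) = right_unit b \<odot>\<^bsub>N\<^esub> h x"
  shows "h \<in> mod_hom Ae M N"
proof (rule mod_homI)
  interpret M: lmodule Ae M by fact
  interpret N: lmodule Ae N by fact
  have hD: "x \<in> carrier M \<Longrightarrow> h x \<in> carrier N"
    "\<lbrakk>x \<in> carrier M; y \<in> carrier M\<rbrakk> \<Longrightarrow> h (x \<oplus>\<^bsub>M\<^esub> y) = h x \<oplus>\<^bsub>N\<^esub> h y"
    "\<lbrakk>a \<in> carrier A; x \<in> carrier M\<rbrakk> \<Longrightarrow> h (left_unit a \<odot>\<^bsub>M\<^esub> x) = left_unit a \<odot>\<^bsub>N\<^esub> h x" for x y a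
    using mod_homD[OF h] by simp_all
  fix x assume x: "x \<in> carrier M"
  show "h x \<in> carrier N" using hD x by simp
  show "h (x \<oplus>\<^bsub>M\<^esub> y) = h x \<oplus>\<^bsub>N\<^esub> h y" if "y \<in> carrier M" for y using hD x that by simp
  fix u assume "u \<in> carrier Ae"
  then show "h (u \<odot>\<^bsub>M\<^esub> x) = u \<odot>\<^bsub>N\<^esub> h x"
  proof (induction rule: Ae_induct)
    case (unit a b)
    have "h ((left_unit a \<otimes>\<^bsub>Ae\<^esub> right_unit b) \<odot>\<^bsub>M\<^esub> x) = h (left_unit a \<odot>\<^bsub>M\<^esub> (right_unit b \<odot>\<^bsub>M\<^esub> x))"
      using unit x by (simp add: M.smult_assoc)
    also have "\<dots> = left_unit a \<odot>\<^bsub>N\<^esub> (right_unit b \<odot>\<^bsub>N\<^esub> h x)"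
      using unit x M.smult_closed[of "right_unit b" x] by (simp add: hD r)
    also have "\<dots> = (left_unit a \<otimes>\<^bsub>Ae\<^esub> right_unit b) \<odot>\<^bsub>N\<^esub> h x"
      using unit x hD(1) by (simp add: N.smult_assoc)
    finally show ?case .
  next
    case (add u v)
    then show ?case
      using x hD(1,2) M.smult_closed by (simp add: M.smult_l_distr N.smult_l_distr)
  qed
qed

end

section \<open>Bimodule resolutions of \<open>A\<close>\<close>

locale bimodule_resolution = separable_quotient K A
  for K :: "('k, 'x) ring_scheme" and A :: "('k, 'a, 'y) module_scheme" +
  fixes P :: "nat \<Rightarrow> (('a \<times> 'a \<Rightarrow>\<^sub>0 int) set, 'p) module" and d :: "nat \<Rightarrow> 'p \<Rightarrow> 'p" and \<epsilon> :: "'p \<Rightarrow> 'a"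
  assumes resolution_P: "proj_resolution (enveloping_algebra K A) (bimodule_left A) P d \<epsilon>"
begin

sublocale res: resolution Ae AL P d \<epsilon>
  by (intro resolution.intro lmodule_AL resolution_axioms.intro resolution_P)

abbreviation "B n \<equiv> d n ` carrier (P (Suc n))"
abbreviation "SJ \<equiv> right_unit ` J"
abbreviation "PJ n \<equiv> action_span (P n) SJ (carrier (P n))"

lemma SJ: "SJ \<subseteq> carrier Ae"
  using left_idealD(1)[OF left_ideal_J] by auto

lemma J_carrier: "j \<in> J \<Longrightarrow> j \<in> carrier A"
  using left_idealD(1)[OF left_ideal_J] by auto

lemma abelian_group_AL: "abelian_group AL"
  using lmodule_AL by (simp add: lmodule_def)

lemma AL_units:
  assumes "a \<in> carrier A" "x \<in> carrier A"
  shows "left_unit a \<odot>\<^bsub>AL\<^esub> x = a \<otimes>\<^bsub>A\<^esub> x" "right_unit a \<odot>\<^bsub>AL\<^esub> x = x \<otimes>\<^bsub>A\<^esub> a"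
  using AL_smult_unit[of x a "\<one>\<^bsub>A\<^esub>"] AL_smult_unit[of x "\<one>\<^bsub>A\<^esub>" a] assms by (simp_all add: unit_one)

lemma unit_preimage: obtains p0 where "p0 \<in> carrier (P 0)" "\<epsilon> p0 = \<one>\<^bsub>A\<^esub>"
proof -
  have "\<one>\<^bsub>A\<^esub> \<in> \<epsilon> ` carrier (P 0)" using res.\<epsilon>_surj by simp
  then show thesis using that by auto
qed

section \<open>The splitting on the right and its consequences\<close>

lemma right_resolution: "resolution (op_ring A) (right_mod AL) (\<lambda>n. right_mod (P n)) d \<epsilon>"
proof (intro resolution.intro resolution_axioms.intro)
  show "lmodule (op_ring A) (right_mod AL)"
    by (rule lmodule_restrict_scalars[OF ring_op_ring[OF A.ring_axioms] right_unit_ring_hom lmodule_AL])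
  show "proj_resolution (op_ring A) (right_mod AL) (\<lambda>n. right_mod (P n)) d \<epsilon>"
    unfolding proj_resolution_def
  proof (intro conjI allI)
    show "projective_module (op_ring A) (right_mod (P n))" for n
      by (rule projective_right[OF res.projective])
    show "d n \<in> mod_hom (op_ring A) (right_mod (P (Suc n))) (right_mod (P n))" for n
      by (rule mod_hom_restrict_scalars[OF right_unit_ring_hom res.d_hom])
    show "\<epsilon> \<in> mod_hom (op_ring A) (right_mod (P 0)) (right_mod AL)"
      by (rule mod_hom_restrict_scalars[OF right_unit_ring_hom res.\<epsilon>_hom])
  qed (use res.\<epsilon>_surj res.exact_0 res.exact_Suc in \<open>simp_all add: kernel_def\<close>)
qed

text \<open>The resolution splits on the right because \<open>A\<close> is free as a right module.\<close>

lemma right_retraction: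
  obtains \<rho> where "retraction_at (op_ring A) (\<lambda>n. right_mod (P n)) d n \<rho>"
proof -
  interpret r: resolution "op_ring A" "right_mod AL" "\<lambda>n. right_mod (P n)" d \<epsilon> by (rule right_resolution)
  interpret P0: lmodule Ae "P 0" by (rule res.lmodule_P)
  interpret P0r: lmodule "op_ring A" "right_mod (P 0)" by (rule r.lmodule_P)
  obtain p0 where p0: "p0 \<in> carrier (P 0)" "\<epsilon> p0 = \<one>\<^bsub>A\<^esub>" by (rule unit_preimage)
  \<comment> \<open>\<open>a \<mapsto> p0 a\<close> is a right linear section of
    \<open>\<epsilon>\<close>, so \<open>1 - s \<epsilon>\<close> retracts \<open>P 0\<close> onto
    the kernel of \<open>\<epsilon>\<close>. Higher degrees inherit a retraction from degree
    0.\<close>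
  let ?s = "\<lambda>a. right_unit a \<odot>\<^bsub>P 0\<^esub> p0"
  have s: "?s \<in> mod_hom (op_ring A) (right_mod AL) (right_mod (P 0))"
    by (rule mod_homI)
      (use p0 in \<open>simp_all add: P0.smult_closed right_unit_add P0.smult_l_distr AL_units right_unit_mult P0.smult_assoc\<close>)
  let ?\<rho> = "\<lambda>x. x \<ominus>\<^bsub>right_mod (P 0)\<^esub> ?s (\<epsilon> x)"
  note s_closed = mod_hom_closed[OF s] and \<epsilon>_closed = mod_hom_closed[OF r.\<epsilon>_hom]
  have \<rho>: "?\<rho> \<in> mod_hom (op_ring A) (right_mod (P 0)) (right_mod (P 0))"
    by (rule mod_hom_diff[OF r.lmodule_P mod_hom_id mod_hom_compose[OF r.\<epsilon>_hom s]])
  have \<epsilon>s: "\<epsilon> (?s a) = a" if "a \<in> carrier A" for a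
    using mod_hom_smult[OF res.\<epsilon>_hom, of "right_unit a" p0] that p0 by (simp add: AL_units)
  have "\<epsilon> (?\<rho> x) = \<zero>\<^bsub>A\<^esub>" if "x \<in> carrier (P 0)" for x
    using mod_hom_minus(2)[OF r.lmodule_P r.M.lmodule_axioms r.\<epsilon>_hom, of x "?s (\<epsilon> x)"] that s_closed \<epsilon>_closed \<epsilon>s
      r.M.M.minus_self[of "\<epsilon> x"] by simp
  moreover have "?\<rho> z = z" if "z \<in> carrier (P 0)" "\<epsilon> z = \<zero>\<^bsub>A\<^esub>" for z
    using that mod_hom_zero[OF r.M.lmodule_axioms r.lmodule_P s] P0r.M.minus_zero_right[of z] by simp
  ultimately have "retraction_at (op_ring A) (\<lambda>n. right_mod (P n)) d 0 ?\<rho>"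
    unfolding retraction_at_def r.exact_0 using \<rho> mod_hom_closed[OF \<rho>] by auto
  then show thesis using r.retraction_mono[of 0 _ n] that by blast
qed

text \<open>A right linear retraction onto \<open>B n\<close> fixes \<open>z\<close> and maps
  \<open>P J\<close> into \<open>B J\<close>.\<close>

lemma boundary_Int_PJ:
  assumes "z \<in> B n" "z \<in> PJ n"
  shows "z \<in> action_span (P n) SJ (B n)"
proof -
  obtain \<rho> where r: "retraction_at (op_ring A) (\<lambda>n. right_mod (P n)) d n \<rho>" by (rule right_retraction)
  have \<rho>: "\<rho> \<in> mod_hom (op_ring A) (right_mod (P n)) (right_mod (P n))"
    "\<rho> ` carrier (P n) \<subseteq> B n" "\<And>z. z \<in> B n \<Longrightarrow> \<rho> z = z"
    using r unfolding retraction_at_def restrict_scalars_simps by blast+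
  interpret Pn: lmodule Ae "P n" by (rule res.lmodule_P)
  have B: "B n \<subseteq> carrier (P n)" by (rule res.boundary_subset)
  have "\<rho> z \<in> action_span (P n) SJ (B n)"
  proof (rule additive_action_span[where h = \<rho> and x = z,
        OF Pn.M.abelian_group_axioms Pn.M.abelian_group_axioms SJ subset_refl])
    show "\<rho> (s \<odot>\<^bsub>P n\<^esub> u) \<in> action_span (P n) SJ (B n)" if "s \<in> SJ" "u \<in> carrier (P n)" for s u
    proof -
      obtain j where j: "j \<in> J" "s = right_unit j" using \<open>s \<in> SJ\<close> by auto
      have "\<rho> (s \<odot>\<^bsub>P n\<^esub> u) = s \<odot>\<^bsub>P n\<^esub> \<rho> u"
        using mod_hom_smult[OF \<rho>(1), of j u] j J_carrier that by simp
      then show ?thesis using Pn.action_span_incl[OF SJ B that(1)] \<rho>(2) that(2) by auto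
    qed
  qed (use mod_homD(1,2)[OF \<rho>(1)] assms(2) Pn.action_span_add[OF SJ B] SJ in
      \<open>auto simp: action_span.zero intro: Pn.smult_closed\<close>)
  then show ?thesis using \<rho>(3)[OF assms(1)] by simp
qed

text \<open>By linearity \<open>B J\<close> is contained in \<open>d (P J)\<close>; this supplies
  the corrections from \<open>P J\<close> that make \<open>P / P J\<close> exact.\<close>

lemma action_span_boundary:
  assumes "z \<in> action_span (P n) SJ (B n)"
  shows "z \<in> d n ` PJ (Suc n)"
proof -
  interpret P1: lmodule Ae "P (Suc n)" by (rule res.lmodule_P)
  show ?thesis using assms
  proof induction
    case zero
    show ?case using mod_hom_zero[OF res.lmodule_P res.lmodule_P res.d_hom[of n]] action_span.zero
      by (metis image_eqI)
  next
    case (step s u v)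
    then obtain x y where x: "x \<in> carrier (P (Suc n))" "u = d n x" and y: "y \<in> PJ (Suc n)" "v = d n y" by auto
    have yP: "y \<in> carrier (P (Suc n))" by (rule P1.action_span_closed[OF SJ subset_refl y(1)])
    have s: "s \<in> carrier Ae" using SJ step(1) by auto
    have "s \<odot>\<^bsub>P n\<^esub> u \<oplus>\<^bsub>P n\<^esub> v = d n (s \<odot>\<^bsub>P (Suc n)\<^esub> x \<oplus>\<^bsub>P (Suc n)\<^esub> y)"
      using mod_hom_add[OF res.d_hom P1.smult_closed[OF s x(1)] yP] mod_hom_smult[OF res.d_hom s x(1)] x y by simp
    then show ?case using action_span.step[OF step(1) x(1) y(1)] by blast
  qed
qed

lemma submodule_PJ: "submodule (PJ n) Ae (P n)"
proof -
  interpret Pn: lmodule Ae "P n" by (rule res.lmodule_P)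
  show ?thesis by (rule submodule_action_span_J[OF res.lmodule_P Pn.submodule_carrier])
qed

text \<open>For \<open>h = d n\<close> it lets the differentials descend to \<open>P / P J\<close>,
  as the next lemma does for the augmentation onto \<open>A / J\<close>.\<close>

lemma hom_PJ:
  assumes "h \<in> mod_hom Ae (P n) (P m)" "x \<in> PJ n"
  shows "h x \<in> PJ m"
proof -
  interpret Pn: lmodule Ae "P n" by (rule res.lmodule_P)
  interpret Pm: lmodule Ae "P m" by (rule res.lmodule_P)
  show ?thesis
  proof (rule additive_action_span[where h = h and x = x,
        OF Pn.M.abelian_group_axioms Pm.M.abelian_group_axioms SJ subset_refl])
    show "h (s \<odot>\<^bsub>P n\<^esub> u) \<in> PJ m" if "s \<in> SJ" "u \<in> carrier (P n)" for s u
      using Pm.action_span_incl[OF SJ subset_refl that(1) mod_hom_closed[OF assms(1) that(2)]]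
        mod_hom_smult[OF assms(1)] SJ that by auto
  qed (use mod_homD(1,2)[OF assms(1)] assms(2) Pm.action_span_add[OF SJ subset_refl] SJ in
      \<open>auto simp: action_span.zero intro: Pn.smult_closed\<close>)
qed

lemma \<epsilon>_PJ:
  assumes "x \<in> PJ 0"
  shows "\<epsilon> x \<in> J"
proof -
  interpret P0: lmodule Ae "P 0" by (rule res.lmodule_P)
  show ?thesis
  proof (rule additive_action_span[where h = \<epsilon> and x = x,
        OF P0.M.abelian_group_axioms abelian_group_AL SJ subset_refl])
    show "\<epsilon> (s \<odot>\<^bsub>P 0\<^esub> u) \<in> J" if "s \<in> SJ" "u \<in> carrier (P 0)" for s u
    proof -
      obtain j where j: "j \<in> J" "s = right_unit j" using \<open>s \<in> SJ\<close> by auto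
      have eu: "\<epsilon> u \<in> carrier A" using mod_hom_closed[OF res.\<epsilon>_hom that(2)] by simp
      have "\<epsilon> (s \<odot>\<^bsub>P 0\<^esub> u) = \<epsilon> u \<otimes>\<^bsub>A\<^esub> j"
        using mod_hom_smult[OF res.\<epsilon>_hom, of s u] SJ that j J_carrier eu by (auto simp: AL_units)
      then show ?thesis using left_idealD(5)[OF left_ideal_J eu j(1)] by simp
    qed
    show "x \<oplus>\<^bsub>AL\<^esub> y \<in> J" if "x \<in> J" "y \<in> J" for x y
      using left_idealD(3)[OF left_ideal_J that] by simp
  qed (use mod_homD(1,2)[OF res.\<epsilon>_hom] assms left_idealD(2)[OF left_ideal_J] SJ in
      \<open>auto intro: P0.smult_closed\<close>)
qed

lemma submodule_J_AL: "submodule J Ae AL"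
proof -
  note JD = left_idealD[OF left_ideal_J]
  show ?thesis
  proof (rule lmodule.submoduleI[OF lmodule_AL])
    show "r \<odot>\<^bsub>AL\<^esub> x \<in> J" if "r \<in> carrier Ae" "x \<in> J" for r x
      using that(1)
    proof (induction rule: Ae_induct)
      case (unit a b)
      have "a \<otimes>\<^bsub>A\<^esub> x \<otimes>\<^bsub>A\<^esub> b \<in> J" using JD(5)[OF unit(1) that(2)] J_mult_right unit(2) by blast
      then show ?case using unit J_carrier[OF that(2)] by (simp add: AL_smult_unit)
    next
      case (add u v)
      then show ?case using JD(3) J_carrier[OF that(2)] by (simp add: AL_l_distr)
    qed
  qed (use JD in auto)
qed

text \<open>The retraction is recorded as a map on \<open>P m\<close> that vanishes on
  \<open>PJ m\<close>: averaging applies it to right multiples of elements of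
  \<open>P m\<close>.\<close>

lemma left_linear_retraction:
  assumes "gldim A < \<infinity>"
  obtains m p \<rho> where "module_quotient Ae (P m) (PJ m) p"
    "\<rho> \<in> mod_hom A (left_mod (P m)) (left_mod (image_module (P m) p))"
    "\<And>x. x \<in> PJ m \<Longrightarrow> \<rho> x = \<zero>\<^bsub>image_module (P m) p\<^esub>"
    "\<rho> ` carrier (P m) \<subseteq> p ` B m" "\<And>z. z \<in> B m \<Longrightarrow> \<rho> z = (p z :: 'p)"
proof -
  have "\<exists>p :: 'p \<Rightarrow> 'p. module_quotient Ae (P n) (PJ n) p" for n
  proof -
    interpret Pn: lmodule Ae "P n" by (rule res.lmodule_P)
    show ?thesis using Pn.module_quotient_exists[OF submodule_PJ] by metis
  qed
  then obtain p :: "nat \<Rightarrow> 'p \<Rightarrow> 'p" where p: "\<And>n. module_quotient Ae (P n) (PJ n) (p n)" by metis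
  interpret q: module_quotient Ae "P n" "PJ n" "p n" for n by (rule p)
  obtain p0 :: "'a \<Rightarrow> 'a" where p0: "module_quotient Ae AL J p0"
    by (rule lmodule.module_quotient_exists[OF lmodule_AL submodule_J_AL])
  \<comment> \<open>\<open>gldim\<close> ranges over modules with elements in
    \<open>'a list set\<close>; singletons carry the chosen representatives of \<open>A / J\<close>
    there.\<close>
  define pM :: "'a \<Rightarrow> 'a list set" where "pM x = {[p0 x]}" for x
  interpret qM: module_quotient Ae AL J pM
    using p0 unfolding module_quotient_def module_quotient_axioms_def pM_def by simp
  let ?Q = "\<lambda>n. image_module (P n) (p n)" and ?M = "image_module AL pM"
  have "\<exists>h. h \<in> mod_hom Ae (?Q (Suc n)) (?Q n) \<and> (\<forall>x\<in>carrier (P (Suc n)). h (p (Suc n) x) = p n (d n x))" for n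
  proof -
    have van: "p n (d n x) = \<zero>\<^bsub>?Q n\<^esub>" if "x \<in> PJ (Suc n)" for x
    proof -
      have "d n x \<in> PJ n" by (rule hom_PJ[OF res.d_hom that])
      moreover have "d n x \<in> carrier (P n)"
        using calculation q.action_span_closed[OF SJ subset_refl] by blast
      ultimately show ?thesis by (simp add: q.p_eq_zero_iff)
    qed
    show ?thesis
      by (rule q.factor_hom[OF q.lmodule_Q mod_hom_compose[OF res.d_hom q.p_hom] van]) auto
  qed
  then obtain D where D: "\<And>n. D n \<in> mod_hom Ae (?Q (Suc n)) (?Q n)"
    "\<And>n x. x \<in> carrier (P (Suc n)) \<Longrightarrow> D n (p (Suc n) x) = p n (d n x)" by metis
  have van: "pM (\<epsilon> x) = \<zero>\<^bsub>?M\<^esub>" if "x \<in> PJ 0" for x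
    using \<epsilon>_PJ[OF that] J_carrier by (simp add: qM.p_eq_zero_iff)
  obtain e where e: "e \<in> mod_hom Ae (?Q 0) ?M" "\<And>x. x \<in> carrier (P 0) \<Longrightarrow> e (p 0 x) = pM (\<epsilon> x)"
    by (rule q.factor_hom[OF qM.lmodule_Q mod_hom_compose[OF res.\<epsilon>_hom qM.p_hom] van]) auto
  let ?R = "\<lambda>n. left_mod (?Q n)" and ?N = "left_mod ?M"
  note l_hom = left_unit_ring_hom
  have lN: "lmodule A ?N" by (rule lmodule_restrict_scalars[OF A.ring_axioms l_hom qM.lmodule_Q])
  have lR: "lmodule A (?R n)" for n by (rule lmodule_restrict_scalars[OF A.ring_axioms l_hom q.lmodule_Q])
  have pR: "p n \<in> mod_hom A (left_mod (P n)) (?R n)" for n by (rule mod_hom_restrict_scalars[OF l_hom q.p_hom])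
  have d_closed: "d n x \<in> carrier (P n)" if "x \<in> carrier (P (Suc n))" for n x
    using mod_hom_closed[OF res.d_hom that] .
  have \<epsilon>_closed: "\<epsilon> x \<in> carrier A" if "x \<in> carrier (P 0)" for x using mod_hom_closed[OF res.\<epsilon>_hom that] by simp
  have p_cong: "p n x = p n w" if "x \<in> carrier (P n)" "w \<in> carrier (P n)" "x \<ominus>\<^bsub>P n\<^esub> w \<in> PJ n" for n x w
    using that q.p_eq_iff by blast
  have "proj_resolution A ?N ?R D e"
    unfolding proj_resolution_def kernel_def
  proof (intro conjI allI)
    show "projective_module A (?R n)" for n
    proof (rule projective_left_quotient[OF res.projective lR pR])
      show "p n x = \<zero>\<^bsub>?R n\<^esub> \<longleftrightarrow> x \<in> PJ n" if "x \<in> carrier (P n)" for x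
        using q.p_eq_zero_iff[OF that] by simp
    qed simp
    show "D n \<in> mod_hom A (?R (Suc n)) (?R n)" for n by (rule mod_hom_restrict_scalars[OF l_hom D(1)])
    show "e \<in> mod_hom A (?R 0) ?N" by (rule mod_hom_restrict_scalars[OF l_hom e(1)])
    have "e ` p 0 ` carrier (P 0) = pM ` \<epsilon> ` carrier (P 0)"
      unfolding image_image by (rule image_cong) (simp_all add: e(2))
    then show "e ` carrier (?R 0) = carrier ?N"
      using res.\<epsilon>_surj by simp
    have De: "D n ` p (Suc n) ` carrier (P (Suc n)) = p n ` B n" for n
      unfolding image_image by (rule image_cong) (simp_all add: D(2))
    have "p 0 ` B 0 = {y \<in> p 0 ` carrier (P 0). e y = \<zero>\<^bsub>?M\<^esub>}"
    proof (intro subset_antisym subsetI)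
      fix y assume "y \<in> p 0 ` B 0"
      then obtain x where x: "x \<in> carrier (P (Suc 0))" "y = p 0 (d 0 x)" by auto
      then have "e y = pM \<zero>\<^bsub>A\<^esub>" using e(2)[OF d_closed[OF x(1)]] res.\<epsilon>_d[OF x(1)] by simp
      then show "y \<in> {y \<in> p 0 ` carrier (P 0). e y = \<zero>\<^bsub>?M\<^esub>}"
        using x d_closed by (simp add: qM.zero_Q)
    next
      fix y assume "y \<in> {y \<in> p 0 ` carrier (P 0). e y = \<zero>\<^bsub>?M\<^esub>}"
      then obtain x where x: "x \<in> carrier (P 0)" "y = p 0 x" "pM (\<epsilon> x) = \<zero>\<^bsub>?M\<^esub>" using e(2) by auto
      then have \<epsilon>J: "\<epsilon> x \<in> J" using qM.p_eq_zero_iff[of "\<epsilon> x"] \<epsilon>_closed by simp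
      obtain u where u: "u \<in> carrier (P 0)" "\<epsilon> u = \<one>\<^bsub>A\<^esub>" by (rule unit_preimage)
      \<comment> \<open>An \<open>x\<close> with \<open>\<epsilon> x\<close> in \<open>J\<close> is
        corrected by \<open>u (\<epsilon> x)\<close>, which lies in \<open>P J\<close> and has the
        same image under \<open>\<epsilon>\<close>.\<close>
      let ?w = "right_unit (\<epsilon> x) \<odot>\<^bsub>P 0\<^esub> u"
      have w: "?w \<in> PJ 0" by (rule q.action_span_incl[OF SJ subset_refl _ u(1)]) (use \<epsilon>J in blast)
      have wP: "?w \<in> carrier (P 0)" by (rule q.action_span_closed[OF SJ subset_refl w])
      have \<epsilon>w: "\<epsilon> ?w = \<epsilon> x"
        using mod_hom_smult[OF res.\<epsilon>_hom _ u(1), of "right_unit (\<epsilon> x)"] u \<epsilon>_closed[OF x(1)] by (simp add: AL_units)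
      have "\<epsilon> (x \<ominus>\<^bsub>P 0\<^esub> ?w) = \<epsilon> x \<ominus>\<^bsub>AL\<^esub> \<epsilon> x"
        using mod_hom_minus(2)[OF res.lmodule_P lmodule_AL res.\<epsilon>_hom x(1) wP] \<epsilon>w by simp
      then have "\<epsilon> (x \<ominus>\<^bsub>P 0\<^esub> ?w) = \<zero>\<^bsub>AL\<^esub>" using abelian_group.minus_self[OF abelian_group_AL, of "\<epsilon> x"] \<epsilon>_closed[OF x(1)] by simp
      then have "x \<ominus>\<^bsub>P 0\<^esub> ?w \<in> B 0" unfolding res.exact_0 using x(1) wP q.M.minus_closed[of x 0 ?w] by simp
      moreover have "p 0 (x \<ominus>\<^bsub>P 0\<^esub> ?w) = p 0 x"
      proof (rule sym, rule p_cong[OF x(1)])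
        have "x \<ominus>\<^bsub>P 0\<^esub> (x \<ominus>\<^bsub>P 0\<^esub> ?w) = ?w"
          using q.M.minus_minus_left_cancel[OF x(1) q.M.zero_closed wP] x(1) wP by simp
        then show "x \<ominus>\<^bsub>P 0\<^esub> (x \<ominus>\<^bsub>P 0\<^esub> ?w) \<in> PJ 0" using w by simp
      qed (use x(1) wP q.M.minus_closed in blast)
      ultimately show "y \<in> p 0 ` B 0" using x(2) by (metis image_eqI)
    qed
    then show "D 0 ` carrier (?R 1) = {x \<in> carrier (add_monoid (?R 0)). e x = \<one>\<^bsub>add_monoid ?N\<^esub>}"
      using De[of 0] by simp
    fix n
    have "p (Suc n) ` B (Suc n) = {y \<in> p (Suc n) ` carrier (P (Suc n)). D n y = \<zero>\<^bsub>?Q n\<^esub>}"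
    proof (intro subset_antisym subsetI)
      fix y assume "y \<in> p (Suc n) ` B (Suc n)"
      then obtain x where x: "x \<in> carrier (P (Suc (Suc n)))" "y = p (Suc n) (d (Suc n) x)" by auto
      then have "D n y = p n \<zero>\<^bsub>P n\<^esub>" using D(2)[OF d_closed[OF x(1)]] res.d_d[OF x(1)] by simp
      then show "y \<in> {y \<in> p (Suc n) ` carrier (P (Suc n)). D n y = \<zero>\<^bsub>?Q n\<^esub>}"
        using x d_closed by (simp add: q.zero_Q)
    next
      fix y assume "y \<in> {y \<in> p (Suc n) ` carrier (P (Suc n)). D n y = \<zero>\<^bsub>?Q n\<^esub>}"
      then obtain x where x: "x \<in> carrier (P (Suc n))" "y = p (Suc n) x" "p n (d n x) = \<zero>\<^bsub>?Q n\<^esub>" using D(2) by auto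
      \<comment> \<open>\<open>d x\<close> is a boundary in \<open>P J\<close>, hence in
        \<open>B J\<close>, hence in \<open>d (P J)\<close>. Subtracting the \<open>w\<close> found
        there turns \<open>x\<close> into a cycle without changing its class.\<close>
      then have "d n x \<in> PJ n" using q.p_eq_zero_iff[OF d_closed[OF x(1)]] by simp
      then have "d n x \<in> d n ` PJ (Suc n)"
        using x(1) by (intro action_span_boundary boundary_Int_PJ) auto
      then obtain w where w: "w \<in> PJ (Suc n)" "d n x = d n w" by auto
      have wP: "w \<in> carrier (P (Suc n))" by (rule q.action_span_closed[OF SJ subset_refl w(1)])
      have "d n (x \<ominus>\<^bsub>P (Suc n)\<^esub> w) = \<zero>\<^bsub>P n\<^esub>"
        using mod_hom_minus(2)[OF res.lmodule_P res.lmodule_P res.d_hom x(1) wP] w(2) d_closed[OF wP] by simp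
      then have "x \<ominus>\<^bsub>P (Suc n)\<^esub> w \<in> B (Suc n)"
        unfolding res.exact_Suc using q.M.minus_closed[OF x(1) wP] by simp
      moreover have "p (Suc n) (x \<ominus>\<^bsub>P (Suc n)\<^esub> w) = p (Suc n) x"
      proof (rule sym, rule p_cong[OF x(1)])
        have "x \<ominus>\<^bsub>P (Suc n)\<^esub> (x \<ominus>\<^bsub>P (Suc n)\<^esub> w) = w"
          using q.M.minus_minus_left_cancel[OF x(1) q.M.zero_closed wP] x(1) wP by simp
        then show "x \<ominus>\<^bsub>P (Suc n)\<^esub> (x \<ominus>\<^bsub>P (Suc n)\<^esub> w) \<in> PJ (Suc n)" using w by simp
      qed (use x(1) wP q.M.minus_closed in blast)
      ultimately show "y \<in> p (Suc n) ` B (Suc n)" using x(2) by (metis image_eqI)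
    qed
    then show "D (Suc n) ` carrier (?R (Suc (Suc n)))
        = {x \<in> carrier (add_monoid (?R (Suc n))). D n x = \<one>\<^bsub>add_monoid (?R n)\<^esub>}"
      using De[of "Suc n"] by simp
  qed
  then have res_R: "resolution A ?N ?R D e" by (intro resolution.intro resolution_axioms.intro lN)
  interpret R: resolution A ?N ?R D e by (rule res_R)
  have "proj_dim A ?N \<le> gldim A"
    unfolding gldim_def by (rule SUP_upper) (use lN in simp)
  then have "proj_dim A ?N < \<infinity>" using assms by (rule le_less_trans)
  \<comment> \<open>The infimum of the empty set is \<open>\<infinity>\<close>, so a finite value
    provides a resolution of finite length.\<close>
  then have "{enat n | n. \<exists>(P :: nat \<Rightarrow> ('a, ('a, 'a list set) res) module) d \<epsilon>. proj_resolution A ?N P d \<epsilon> \<and>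
       (\<forall>i>n. carrier (P i) = {\<zero>\<^bsub>P i\<^esub>})} \<noteq> {}"
    unfolding proj_dim_def by (auto simp: Inf_enat_def split: if_splits)
  then obtain n and P' :: "nat \<Rightarrow> ('a, ('a, 'a list set) res) module" and d' \<epsilon>'
    where P': "proj_resolution A ?N P' d' \<epsilon>'" "\<And>i. i > n \<Longrightarrow> carrier (P' i) = {\<zero>\<^bsub>P' i\<^esub>}" by blast
  have "resolution A ?N P' d' \<epsilon>'" by (intro resolution.intro resolution_axioms.intro lN P'(1))
  \<comment> \<open>\<open>P'\<close> is known to vanish only beyond \<open>n\<close>, whence the
    degree \<open>Suc n\<close>.\<close>
  then obtain \<rho>' where \<rho>': "retraction_at A ?R D (Suc n) \<rho>'"
    by (rule retraction_if_finite_resolution[OF res_R _ P'(2)]) auto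
  let ?m = "Suc n"
  have \<rho>'_hom: "\<rho>' \<in> mod_hom A (?R ?m) (?R ?m)" using \<rho>' by (simp add: retraction_at_def)
  have DB: "D ?m ` carrier (?R (Suc ?m)) = p ?m ` B ?m"
    by (simp add: image_image) (rule image_cong, simp_all add: D(2))
  show thesis
  proof (rule that[OF p, of "\<lambda>x. \<rho>' (p ?m x)"])
    show "(\<lambda>x. \<rho>' (p ?m x)) \<in> mod_hom A (left_mod (P ?m)) (?R ?m)"
      by (rule mod_hom_compose[OF pR \<rho>'_hom])
    show "\<rho>' (p ?m x) = \<zero>\<^bsub>?Q ?m\<^esub>" if "x \<in> PJ ?m" for x
    proof -
      have "x \<in> carrier (P ?m)" by (rule q.action_span_closed[OF SJ subset_refl that])
      then have "p ?m x = \<zero>\<^bsub>?R ?m\<^esub>" using that by (simp add: q.p_eq_zero_iff)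
      then show ?thesis using mod_hom_zero[OF lR lR \<rho>'_hom] by simp
    qed
    show "(\<lambda>x. \<rho>' (p ?m x)) ` carrier (P ?m) \<subseteq> p ?m ` B ?m"
      using \<rho>' unfolding retraction_at_def DB by auto
    show "\<rho>' (p ?m z) = p ?m z" if "z \<in> B ?m" for z
      using \<rho>' that unfolding retraction_at_def DB by blast
  qed
qed

text \<open>
  Averaging the left linear map \<open>\<rho>\<close> with a separability idempotent \<open>\<Sum> x\<^sub>i \<otimes> y\<^sub>i\<close> of \<open>A / J\<close>:
  the map \<open>v \<mapsto> \<Sum> \<rho> (v x\<^sub>i) y\<^sub>i\<close> is a bimodule homomorphism.
\<close>

lemma bimodule_retraction_mod:
  fixes p :: "'p \<Rightarrow> 'p"
  assumes p: "module_quotient Ae (P m) (PJ m) p"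
    and \<rho>: "\<rho> \<in> mod_hom A (left_mod (P m)) (left_mod (image_module (P m) p))"
    and \<rho>_PJ: "\<And>x. x \<in> PJ m \<Longrightarrow> \<rho> x = \<zero>\<^bsub>image_module (P m) p\<^esub>"
    and \<rho>_B: "\<rho> ` carrier (P m) \<subseteq> p ` B m" "\<And>z. z \<in> B m \<Longrightarrow> \<rho> z = p z"
  obtains \<rho>' where "\<rho>' \<in> mod_hom Ae (P m) (image_module (P m) p)"
    "\<rho>' ` carrier (P m) \<subseteq> p ` B m" "\<And>z. z \<in> B m \<Longrightarrow> \<rho>' z = p z"
proof -
  interpret q: module_quotient Ae "P m" "PJ m" p by (rule p)
  let ?Q = "image_module (P m) p"
  interpret Q: lmodule Ae ?Q by (rule q.lmodule_Q)
  have sub_B: "submodule (B m) Ae (P m)"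
    by (rule submodule_image[OF res.lmodule_P res.lmodule_P res.d_hom])
  have BD: "B m \<subseteq> carrier (P m)" "\<And>u z. \<lbrakk>u \<in> carrier Ae; z \<in> B m\<rbrakk> \<Longrightarrow> u \<odot>\<^bsub>P m\<^esub> z \<in> B m"
    using q.submoduleD(1,6)[OF sub_B] by blast+
  have lQ: "left_unit a \<odot>\<^bsub>?Q\<^esub> w \<in> carrier ?Q" "right_unit a \<odot>\<^bsub>?Q\<^esub> w \<in> carrier ?Q"
    if "a \<in> carrier A" "w \<in> carrier ?Q" for a w
    using that by (simp_all only: Q.smult_closed unit_closed)
  have lP: "left_unit a \<odot>\<^bsub>P m\<^esub> v \<in> carrier (P m)" "right_unit a \<odot>\<^bsub>P m\<^esub> v \<in> carrier (P m)"
    if "a \<in> carrier A" "v \<in> carrier (P m)" for a v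
    using that by (simp_all only: q.smult_closed unit_closed)
  have \<rho>D: "v \<in> carrier (P m) \<Longrightarrow> \<rho> v \<in> carrier ?Q"
    "\<lbrakk>v \<in> carrier (P m); w \<in> carrier (P m)\<rbrakk> \<Longrightarrow> \<rho> (v \<oplus>\<^bsub>P m\<^esub> w) = \<rho> v \<oplus>\<^bsub>?Q\<^esub> \<rho> w"
    "\<lbrakk>a \<in> carrier A; v \<in> carrier (P m)\<rbrakk> \<Longrightarrow> \<rho> (left_unit a \<odot>\<^bsub>P m\<^esub> v) = left_unit a \<odot>\<^bsub>?Q\<^esub> \<rho> v" for v w a
    using mod_homD[OF \<rho>] by (simp_all del: q.carrier_Q)
  \<comment> \<open>\<open>J\<close> acts as zero from the right on \<open>Q\<close>, so the right
    action there is one of \<open>A / J\<close> and an idempotent of \<open>A / J\<close> can be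
    applied.\<close>
  have JQ: "right_unit j \<odot>\<^bsub>?Q\<^esub> w = \<zero>\<^bsub>?Q\<^esub>" if jw: "j \<in> J" "w \<in> carrier ?Q" for j w
  proof -
    obtain v where v: "v \<in> carrier (P m)" "w = p v" using jw(2) by auto
    have "right_unit j \<odot>\<^bsub>P m\<^esub> v \<in> PJ m" by (rule q.action_span_incl[OF SJ subset_refl _ v(1)]) (use jw in blast)
    then show ?thesis using v jw J_carrier lP by (simp add: q.p_smult[symmetric] q.p_eq_zero_iff del: q.carrier_Q)
  qed
  define \<Phi> where "\<Phi> v = (\<lambda>(x, y). right_unit y \<odot>\<^bsub>?Q\<^esub> \<rho> (right_unit x \<odot>\<^bsub>P m\<^esub> v))" for v
  have \<Phi>_closed: "\<Phi> v (x, y) \<in> carrier ?Q" if "v \<in> carrier (P m)" "x \<in> carrier A" "y \<in> carrier A" for v x y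
    using that by (simp add: \<Phi>_def lQ lP \<rho>D del: q.carrier_Q)
  have bal: "balanced K A (op_ring A) (add_monoid ?Q) (\<Phi> v)" if v: "v \<in> carrier (P m)" for v
    unfolding balanced_def op_ring_simps smult_op_ring monoid_record_simps partial_object.simps
  proof (intro conjI ballI)
    fix x y x' assume x: "x \<in> carrier A" and y: "y \<in> carrier A" and x': "x' \<in> carrier A"
    show "\<Phi> v (x, y) \<in> carrier ?Q" by (rule \<Phi>_closed[OF v x y])
    show "\<Phi> v (x \<oplus>\<^bsub>A\<^esub> y, x') = \<Phi> v (x, x') \<oplus>\<^bsub>?Q\<^esub> \<Phi> v (y, x')"
      using v x y x' by (simp add: \<Phi>_def right_unit_add q.smult_l_distr Q.smult_r_distr lP lQ \<rho>D del: q.carrier_Q)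
    show "\<Phi> v (x, y \<oplus>\<^bsub>A\<^esub> x') = \<Phi> v (x, y) \<oplus>\<^bsub>?Q\<^esub> \<Phi> v (x, x')"
      using v x y x' by (simp add: \<Phi>_def right_unit_add Q.smult_l_distr lP lQ \<rho>D del: q.carrier_Q)
  next
    \<comment> \<open>A scalar travels from the first slot to the second through the left action,
      for which \<open>\<rho>\<close> is linear; \<open>unit_scalar\<close> switches sides before
      and after.\<close>
    fix c x y assume c: "c \<in> carrier K" and x: "x \<in> carrier A" and y: "y \<in> carrier A"
    let ?c = "c \<odot>\<^bsub>A\<^esub> \<one>\<^bsub>A\<^esub>"
    have cA: "?c \<in> carrier A" using c by simp
    have cx: "c \<odot>\<^bsub>A\<^esub> x = x \<otimes>\<^bsub>A\<^esub> ?c" "c \<odot>\<^bsub>A\<^esub> y = ?c \<otimes>\<^bsub>A\<^esub> y"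
      using c x y by (simp_all add: smult_mult_left smult_mult_right)
    have "\<Phi> v (c \<odot>\<^bsub>A\<^esub> x, y) = right_unit y \<odot>\<^bsub>?Q\<^esub> \<rho> (left_unit ?c \<odot>\<^bsub>P m\<^esub> (right_unit x \<odot>\<^bsub>P m\<^esub> v))"
      unfolding \<Phi>_def cx prod.case using c x v cA
      by (simp add: right_unit_mult q.smult_assoc unit_scalar)
    also have "\<dots> = right_unit y \<odot>\<^bsub>?Q\<^esub> (right_unit ?c \<odot>\<^bsub>?Q\<^esub> \<rho> (right_unit x \<odot>\<^bsub>P m\<^esub> v))"
      using \<rho>D(3)[OF cA lP(2)[OF x v]] c by (simp add: unit_scalar)
    also have "\<dots> = \<Phi> v (x, c \<odot>\<^bsub>A\<^esub> y)"
      unfolding \<Phi>_def cx prod.case using y cA \<rho>D(1)[OF lP(2)[OF x v]]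
      by (simp add: right_unit_mult Q.smult_assoc del: q.carrier_Q)
    finally show "\<Phi> v (c \<odot>\<^bsub>A\<^esub> x, y) = \<Phi> v (x, c \<odot>\<^bsub>A\<^esub> y)" .
  qed
  have van: "\<Phi> v (x, y) = \<zero>\<^bsub>?Q\<^esub>"
    if v: "v \<in> carrier (P m)" and x: "x \<in> carrier A" and y: "y \<in> carrier A" and J: "x \<in> J \<or> y \<in> J" for v x y
    using J
  proof
    assume "x \<in> J"
    then have "right_unit x \<odot>\<^bsub>P m\<^esub> v \<in> PJ m"
      by (intro q.action_span_incl[OF SJ subset_refl _ v]) blast
    then show ?thesis using y by (simp add: \<Phi>_def \<rho>_PJ)
  qed (use JQ \<rho>D(1)[OF lP(2)[OF x v]] in \<open>simp add: \<Phi>_def\<close>)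
  obtain ps where ps: "set ps \<subseteq> carrier A \<times> carrier A"
    and one: "foldr (\<lambda>(x, y) v. x \<otimes>\<^bsub>A\<^esub> y \<oplus>\<^bsub>A\<^esub> v) ps \<zero>\<^bsub>A\<^esub> \<ominus>\<^bsub>A\<^esub> \<one>\<^bsub>A\<^esub> \<in> J"
    and central: "\<And>\<phi> s. \<lbrakk>comm_group (add_monoid ?Q); balanced K A (op_ring A) (add_monoid ?Q) \<phi>;
        \<And>x y. \<lbrakk>x \<in> carrier A; y \<in> carrier A; x \<in> J \<or> y \<in> J\<rbrakk> \<Longrightarrow> \<phi> (x, y) = \<one>\<^bsub>add_monoid ?Q\<^esub>; s \<in> carrier A\<rbrakk>
      \<Longrightarrow> foldr (\<lambda>(x, y) v. \<phi> (s \<otimes>\<^bsub>A\<^esub> x, y) \<otimes>\<^bsub>add_monoid ?Q\<^esub> v) ps \<one>\<^bsub>add_monoid ?Q\<^esub>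
        = foldr (\<lambda>(x, y) v. \<phi> (x, y \<otimes>\<^bsub>A\<^esub> s) \<otimes>\<^bsub>add_monoid ?Q\<^esub> v) ps \<one>\<^bsub>add_monoid ?Q\<^esub>"
    by (rule separability_list_radical[where G = "add_monoid ?Q"]) blast
  \<comment> \<open>Defined for arbitrary lists: additivity, left linearity and the values on
    \<open>B m\<close> hold for each list and are shown by induction. Right linearity belongs to the
    idempotent \<open>ps\<close>.\<close>
  define avg where "avg qs v = foldr (\<lambda>(x, y) w. \<Phi> v (x, y) \<oplus>\<^bsub>?Q\<^esub> w) qs \<zero>\<^bsub>?Q\<^esub>" for qs v
  have avg_simps: "avg [] v = \<zero>\<^bsub>?Q\<^esub>" "avg ((x, y) # qs) v = \<Phi> v (x, y) \<oplus>\<^bsub>?Q\<^esub> avg qs v" for v x y qs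
    by (simp_all add: avg_def)
  have avg_closed: "avg qs v \<in> carrier ?Q" if "set qs \<subseteq> carrier A \<times> carrier A" "v \<in> carrier (P m)" for qs v
    using that by (induction qs) (auto simp: avg_simps \<Phi>_closed simp del: q.carrier_Q)
  have avg_add: "avg qs (v \<oplus>\<^bsub>P m\<^esub> w) = avg qs v \<oplus>\<^bsub>?Q\<^esub> avg qs w"
    if "set qs \<subseteq> carrier A \<times> carrier A" "v \<in> carrier (P m)" "w \<in> carrier (P m)" for qs v w
    using that(1)
  proof (induction qs)
    case (Cons z qs)
    obtain x y where z: "z = (x, y)" "x \<in> carrier A" "y \<in> carrier A" using Cons.prems by (cases z) auto
    have "\<Phi> (v \<oplus>\<^bsub>P m\<^esub> w) (x, y) = \<Phi> v (x, y) \<oplus>\<^bsub>?Q\<^esub> \<Phi> w (x, y)"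
      using z that by (simp add: \<Phi>_def q.smult_r_distr Q.smult_r_distr lP lQ \<rho>D del: q.carrier_Q)
    then show ?case
      using Cons z that by (simp add: avg_simps \<Phi>_closed avg_closed Q.M.a_ac del: q.carrier_Q)
  qed (simp add: avg_simps del: q.carrier_Q)
  have avg_left: "avg qs (left_unit a \<odot>\<^bsub>P m\<^esub> v) = left_unit a \<odot>\<^bsub>?Q\<^esub> avg qs v"
    if "set qs \<subseteq> carrier A \<times> carrier A" "a \<in> carrier A" "v \<in> carrier (P m)" for qs a v
    using that(1)
  proof (induction qs)
    case (Cons z qs)
    obtain x y where z: "z = (x, y)" "x \<in> carrier A" "y \<in> carrier A" using Cons.prems by (cases z) auto
    have "right_unit x \<odot>\<^bsub>P m\<^esub> (left_unit a \<odot>\<^bsub>P m\<^esub> v) = left_unit a \<odot>\<^bsub>P m\<^esub> (right_unit x \<odot>\<^bsub>P m\<^esub> v)"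
      using z that by (simp add: units_commute flip: q.smult_assoc)
    moreover have "right_unit y \<odot>\<^bsub>?Q\<^esub> (left_unit a \<odot>\<^bsub>?Q\<^esub> w) = left_unit a \<odot>\<^bsub>?Q\<^esub> (right_unit y \<odot>\<^bsub>?Q\<^esub> w)" if "w \<in> carrier ?Q" for w
      using z that \<open>a \<in> carrier A\<close> by (simp add: units_commute flip: Q.smult_assoc del: q.carrier_Q)
    ultimately have "\<Phi> (left_unit a \<odot>\<^bsub>P m\<^esub> v) (x, y) = left_unit a \<odot>\<^bsub>?Q\<^esub> \<Phi> v (x, y)"
      using z that by (simp add: \<Phi>_def lP \<rho>D del: q.carrier_Q)
    then show ?case
      using Cons z that by (simp add: avg_simps \<Phi>_closed avg_closed Q.smult_r_distr del: q.carrier_Q)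
  qed (use that in \<open>simp add: avg_simps\<close>)
  have avg_right: "avg ps (right_unit s \<odot>\<^bsub>P m\<^esub> v) = right_unit s \<odot>\<^bsub>?Q\<^esub> avg ps v"
    if s: "s \<in> carrier A" and v: "v \<in> carrier (P m)" for s v
  proof -
    \<comment> \<open>Acting by \<open>s\<close> first puts \<open>s\<close> in front of each
      \<open>x\<^sub>i\<close>. Centrality moves it behind each \<open>y\<^sub>i\<close>, where it
      acts on the result.\<close>
    have 1: "avg ps (right_unit s \<odot>\<^bsub>P m\<^esub> v) = foldr (\<lambda>(x, y) w. \<Phi> v (s \<otimes>\<^bsub>A\<^esub> x, y) \<oplus>\<^bsub>?Q\<^esub> w) ps \<zero>\<^bsub>?Q\<^esub>"
      unfolding avg_def
      by (rule foldr_cong)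
        (use ps s v in \<open>auto simp: \<Phi>_def right_unit_mult q.smult_assoc simp del: q.carrier_Q\<close>)
    have "foldr (\<lambda>(x, y) w. \<Phi> v (x, y \<otimes>\<^bsub>A\<^esub> s) \<oplus>\<^bsub>?Q\<^esub> w) qs \<zero>\<^bsub>?Q\<^esub> = right_unit s \<odot>\<^bsub>?Q\<^esub> avg qs v"
      if "set qs \<subseteq> carrier A \<times> carrier A" for qs
      using that
    proof (induction qs)
      case (Cons z qs)
      obtain x y where z: "z = (x, y)" "x \<in> carrier A" "y \<in> carrier A" using Cons.prems by (cases z) auto
      have "\<Phi> v (x, y \<otimes>\<^bsub>A\<^esub> s) = right_unit s \<odot>\<^bsub>?Q\<^esub> \<Phi> v (x, y)"
        using z s v by (simp add: \<Phi>_def right_unit_mult Q.smult_assoc lP \<rho>D del: q.carrier_Q)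
      then show ?case
        using Cons z s v by (simp add: avg_simps \<Phi>_closed avg_closed Q.smult_r_distr del: q.carrier_Q)
    qed (use s in \<open>simp add: avg_simps\<close>)
    then show ?thesis using 1 ps central[OF Q.M.a_comm_group bal[OF v] _ s] van[OF v] by simp
  qed
  \<comment> \<open>On \<open>B m\<close> the map \<open>\<rho>\<close> agrees with
    \<open>p\<close>, which is right linear, so averaging is right multiplication by
    \<open>\<Sum> x\<^sub>i y\<^sub>i\<close>.\<close>
  have avg_B: "avg qs z = right_unit (foldr (\<lambda>(x, y) v. x \<otimes>\<^bsub>A\<^esub> y \<oplus>\<^bsub>A\<^esub> v) qs \<zero>\<^bsub>A\<^esub>) \<odot>\<^bsub>?Q\<^esub> p z
      \<and> foldr (\<lambda>(x, y) v. x \<otimes>\<^bsub>A\<^esub> y \<oplus>\<^bsub>A\<^esub> v) qs \<zero>\<^bsub>A\<^esub> \<in> carrier A"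
    if "set qs \<subseteq> carrier A \<times> carrier A" and z: "z \<in> B m" for qs z
    using that(1)
  proof (induction qs)
    case Nil
    have "right_unit \<zero>\<^bsub>A\<^esub> = \<zero>\<^bsub>Ae\<^esub>"
      by (rule additive_zero[OF A.is_abelian_group Ae.is_abelian_group]) (simp_all add: right_unit_add)
    then show ?case using z BD(1) by (simp add: avg_simps subset_iff)
  next
    case (Cons w qs)
    obtain x y where w: "w = (x, y)" "x \<in> carrier A" "y \<in> carrier A" using Cons.prems by (cases w) auto
    have zP: "z \<in> carrier (P m)" using z BD(1) by auto
    have pz: "p z \<in> carrier ?Q" by (rule q.p_closed[OF zP])
    have "\<Phi> z (x, y) = right_unit y \<odot>\<^bsub>?Q\<^esub> p (right_unit x \<odot>\<^bsub>P m\<^esub> z)"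
      using \<rho>_B(2)[OF BD(2)[OF _ z], of "right_unit x"] w by (simp add: \<Phi>_def)
    also have "\<dots> = right_unit y \<odot>\<^bsub>?Q\<^esub> (right_unit x \<odot>\<^bsub>?Q\<^esub> p z)"
      using w zP by (simp add: q.p_smult del: q.carrier_Q)
    also have "\<dots> = right_unit (x \<otimes>\<^bsub>A\<^esub> y) \<odot>\<^bsub>?Q\<^esub> p z"
      using w pz by (simp add: right_unit_mult Q.smult_assoc del: q.carrier_Q)
    finally show ?case
      using Cons w pz by (simp add: avg_simps right_unit_add Q.smult_l_distr del: q.carrier_Q)
  qed
  have avg_hom: "avg ps \<in> mod_hom Ae (P m) ?Q"
  proof (rule mod_hom_AeI[OF res.lmodule_P q.lmodule_Q])
    show "avg ps \<in> mod_hom A (left_mod (P m)) (left_mod ?Q)"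
      by (rule mod_homI) (simp_all add: avg_closed[OF ps] avg_add[OF ps] avg_left[OF ps] del: q.carrier_Q)
  qed (rule avg_right)
  show thesis
  proof (rule that[OF avg_hom])
    show "avg ps z = p z" if z: "z \<in> B m" for z
    proof -
      let ?t = "foldr (\<lambda>(x, y) v. x \<otimes>\<^bsub>A\<^esub> y \<oplus>\<^bsub>A\<^esub> v) ps \<zero>\<^bsub>A\<^esub>"
      have t: "avg ps z = right_unit ?t \<odot>\<^bsub>?Q\<^esub> p z" "?t \<in> carrier A" using avg_B[OF ps z] by blast+
      have pz: "p z \<in> carrier ?Q" using z BD(1) by (intro q.p_closed) auto
      \<comment> \<open>The sum \<open>\<Sum> x\<^sub>i y\<^sub>i\<close> is \<open>1\<close> plus
        an element of \<open>J\<close>, and that element acts as zero on \<open>Q\<close>.\<close>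
      have "right_unit ((?t \<ominus>\<^bsub>A\<^esub> \<one>\<^bsub>A\<^esub>) \<oplus>\<^bsub>A\<^esub> \<one>\<^bsub>A\<^esub>) = right_unit (?t \<ominus>\<^bsub>A\<^esub> \<one>\<^bsub>A\<^esub>) \<oplus>\<^bsub>Ae\<^esub> right_unit \<one>\<^bsub>A\<^esub>"
        by (rule right_unit_add) (use t in auto)
      then have "right_unit ?t = right_unit (?t \<ominus>\<^bsub>A\<^esub> \<one>\<^bsub>A\<^esub>) \<oplus>\<^bsub>Ae\<^esub> \<one>\<^bsub>Ae\<^esub>"
        using t(2) by (simp add: unit_one)
      then have "avg ps z = right_unit (?t \<ominus>\<^bsub>A\<^esub> \<one>\<^bsub>A\<^esub>) \<odot>\<^bsub>?Q\<^esub> p z \<oplus>\<^bsub>?Q\<^esub> \<one>\<^bsub>Ae\<^esub> \<odot>\<^bsub>?Q\<^esub> p z"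
        unfolding t(1) using Q.smult_l_distr[OF _ _ pz, of "right_unit (?t \<ominus>\<^bsub>A\<^esub> \<one>\<^bsub>A\<^esub>)" "\<one>\<^bsub>Ae\<^esub>"] t(2) by simp
      then show ?thesis using JQ[OF one pz] pz by (simp add: Q.smult_one del: q.carrier_Q)
    qed
    have sub_pB: "submodule (p ` B m) Ae ?Q"
    proof -
      have "p \<in> mod_hom Ae (P m\<lparr>carrier := B m\<rparr>) ?Q"
        using mod_homD[OF q.p_hom] BD(1) by (intro mod_homI) (auto simp: subset_iff)
      from submodule_image[OF q.lmodule_restrict_carrier[OF sub_B] q.lmodule_Q this] show ?thesis by simp
    qed
    note pBD = Q.submoduleD[OF sub_pB]
    have "avg qs v \<in> p ` B m" if "set qs \<subseteq> carrier A \<times> carrier A" "v \<in> carrier (P m)" for qs v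
      using that
    proof (induction qs)
      case (Cons z qs)
      obtain x y where z: "z = (x, y)" "x \<in> carrier A" "y \<in> carrier A" using Cons.prems by (cases z) auto
      have "\<rho> (right_unit x \<odot>\<^bsub>P m\<^esub> v) \<in> p ` B m" using \<rho>_B(1) lP(2)[OF z(2) Cons.prems(2)] by blast
      then have "\<Phi> v (x, y) \<in> p ` B m" using pBD(6) z by (simp add: \<Phi>_def)
      then show ?case using Cons z pBD(3) by (simp add: avg_simps)
    qed (use pBD(2) in \<open>simp add: avg_simps\<close>)
    then show "avg ps ` carrier (P m) \<subseteq> p ` B m" using ps by blast
  qed
qed

lemma radical_products_Suc_right:
  assumes "j \<in> J" "t \<in> radical_products k"
  shows "j \<otimes>\<^bsub>A\<^esub> t \<in> radical_products (Suc k)"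
  using assms by auto

text \<open>
  A bimodule endomorphism \<open>r\<close> with values in \<open>B = B m\<close> that is the identity on \<open>B\<close> modulo \<open>B J\<close>
  is improved to one that is the identity modulo \<open>B J\<^sup>k\<close>.
\<close>

lemma bimodule_retraction:
  assumes r: "r \<in> mod_hom Ae (P m) (P m)" "r ` carrier (P m) \<subseteq> B m"
    and rB: "\<And>z. z \<in> B m \<Longrightarrow> z \<ominus>\<^bsub>P m\<^esub> r z \<in> action_span (P m) SJ (B m)"
  obtains \<rho> where "retraction_at Ae P d m \<rho>"
proof -
  interpret Pm: lmodule Ae "P m" by (rule res.lmodule_P)
  have sub_B: "submodule (B m) Ae (P m)"
    by (rule submodule_image[OF res.lmodule_P res.lmodule_P res.d_hom])
  note BD = Pm.submoduleD[OF sub_B]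
  let ?N = "\<lambda>k. action_span (P m) (right_unit ` radical_products k) (B m)"
  have Sk: "right_unit ` radical_products k \<subseteq> carrier Ae" for k
    using radical_products_closed[of k] by auto
  have N_B: "?N k \<subseteq> B m" for k
    by (rule Pm.action_span_subset[OF sub_B]) (use Sk BD(6) in blast)
  define h where "h f z = z \<ominus>\<^bsub>P m\<^esub> f z" for f z
  \<comment> \<open>\<open>1 - r\<close> is right linear and maps \<open>B\<close> into
    \<open>B J\<close>. So it sends \<open>u t\<close>, with \<open>t\<close> a product of
    \<open>k\<close> elements of \<open>J\<close>, into \<open>B J t\<close>, which lies in
    \<open>B J\<^sup>k\<^sup>+\<^sup>1\<close>.\<close>
  have step: "h r w \<in> ?N (Suc k)" if w: "w \<in> ?N k" for w k
  proof (rule additive_action_span[where h = "h r" and x = w and M = "P m" and N = "P m", OF _ _ Sk BD(1)])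
    have h: "h r \<in> mod_hom Ae (P m) (P m)"
      unfolding h_def by (rule mod_hom_diff[OF res.lmodule_P mod_hom_id r(1)])
    show "h r x \<in> carrier (P m)" if "x \<in> carrier (P m)" for x using mod_hom_closed[OF h that] .
    show "h r (x \<oplus>\<^bsub>P m\<^esub> y) = h r x \<oplus>\<^bsub>P m\<^esub> h r y" if "x \<in> carrier (P m)" "y \<in> carrier (P m)" for x y
      using mod_hom_add[OF h that] .
    show "x \<oplus>\<^bsub>P m\<^esub> y \<in> ?N (Suc k)" if "x \<in> ?N (Suc k)" "y \<in> ?N (Suc k)" for x y
      by (rule Pm.action_span_add[OF Sk BD(1) that])
    show "h r (s \<odot>\<^bsub>P m\<^esub> u) \<in> ?N (Suc k)" if s: "s \<in> right_unit ` radical_products k" and u: "u \<in> B m" for s u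
    proof -
      obtain t where t: "t \<in> radical_products k" "t \<in> carrier A" "s = right_unit t"
        using s radical_products_closed[of k] by auto
      have uP: "u \<in> carrier (P m)" using u BD(1) by auto
      have "h r (s \<odot>\<^bsub>P m\<^esub> u) = right_unit t \<odot>\<^bsub>P m\<^esub> h r u"
        using mod_hom_smult[OF h _ uP, of s] t by simp
      also have "\<dots> \<in> ?N (Suc k)"
      proof (rule additive_action_span[where h = "\<lambda>v. right_unit t \<odot>\<^bsub>P m\<^esub> v" and x = "h r u"
            and M = "P m" and N = "P m", OF _ _ SJ BD(1)])
        show "h r u \<in> action_span (P m) SJ (B m)" using rB[OF u] by (simp add: h_def)
        show "right_unit t \<odot>\<^bsub>P m\<^esub> (x \<oplus>\<^bsub>P m\<^esub> y) = right_unit t \<odot>\<^bsub>P m\<^esub> x \<oplus>\<^bsub>P m\<^esub> right_unit t \<odot>\<^bsub>P m\<^esub> y"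
          if "x \<in> carrier (P m)" "y \<in> carrier (P m)" for x y
          using that t by (simp add: Pm.smult_r_distr)
        show "x \<oplus>\<^bsub>P m\<^esub> y \<in> ?N (Suc k)" if "x \<in> ?N (Suc k)" "y \<in> ?N (Suc k)" for x y
          by (rule Pm.action_span_add[OF Sk BD(1) that])
        show "right_unit t \<odot>\<^bsub>P m\<^esub> (s' \<odot>\<^bsub>P m\<^esub> v) \<in> ?N (Suc k)" if s': "s' \<in> SJ" and v: "v \<in> B m" for s' v
        proof -
          obtain j where j: "j \<in> J" "j \<in> carrier A" "s' = right_unit j" using s' J_carrier by auto
          have "v \<in> carrier (P m)" using v BD(1) by auto
          then have "right_unit t \<odot>\<^bsub>P m\<^esub> (s' \<odot>\<^bsub>P m\<^esub> v) = right_unit (j \<otimes>\<^bsub>A\<^esub> t) \<odot>\<^bsub>P m\<^esub> v"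
            using t j by (simp add: right_unit_mult Pm.smult_assoc)
          also have "\<dots> \<in> ?N (Suc k)"
            by (rule Pm.action_span_incl[OF Sk BD(1) _ v]) (use radical_products_Suc_right[OF j(1) t(1)] in blast)
          finally show ?thesis .
        qed
      qed (use t SJ in \<open>auto simp: Pm.M.abelian_group_axioms action_span.zero intro: Pm.smult_closed\<close>)
      finally show ?thesis .
    qed
  qed (use w Sk[of k] in \<open>auto simp: Pm.M.abelian_group_axioms action_span.zero intro: Pm.smult_closed\<close>)
  have "\<exists>f\<in>mod_hom Ae (P m) (P m). f ` carrier (P m) \<subseteq> B m \<and> (\<forall>z\<in>B m. h f z \<in> ?N k)" for k
  proof (induction k)
    case 0
    \<comment> \<open>\<open>radical_products 0\<close> consists of \<open>1\<close>, so
      \<open>?N 0\<close> is all of \<open>B m\<close>.\<close>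
    have "z \<in> ?N 0" if "z \<in> B m" for z
      using Pm.action_span_incl[OF Sk[of 0] BD(1) _ that, of "right_unit \<one>\<^bsub>A\<^esub>"] that BD(1)
      by (auto simp: unit_one Pm.smult_one)
    moreover have "h r z \<in> B m" if "z \<in> B m" for z
    proof -
      have "r z \<in> B m" using r(2) BD(1) that by blast
      then show ?thesis using BD(5)[OF that] by (simp add: h_def)
    qed
    ultimately show ?case using r by blast
  next
    case (Suc k)
    then obtain f where f: "f \<in> mod_hom Ae (P m) (P m)" "f ` carrier (P m) \<subseteq> B m" "\<And>z. z \<in> B m \<Longrightarrow> h f z \<in> ?N k"
      by blast
    \<comment> \<open>Chosen so that \<open>1 - g = (1 - r) (1 - f)\<close>: each round gains one
      power of \<open>J\<close>, and both summands have their values in \<open>B m\<close>.\<close>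
    let ?g = "\<lambda>x. f x \<oplus>\<^bsub>P m\<^esub> r (x \<ominus>\<^bsub>P m\<^esub> f x)"
    have diff: "(\<lambda>x. x \<ominus>\<^bsub>P m\<^esub> f x) \<in> mod_hom Ae (P m) (P m)"
      by (rule mod_hom_diff[OF res.lmodule_P mod_hom_id f(1)])
    have g: "?g \<in> mod_hom Ae (P m) (P m)"
      by (rule mod_hom_plus[OF res.lmodule_P f(1) mod_hom_compose[OF diff r(1)]])
    have "?g x \<in> B m" if "x \<in> carrier (P m)" for x
      using f(2) r(2) mod_hom_closed[OF diff that] that by (intro BD(3)) blast+
    moreover have "h ?g z \<in> ?N (Suc k)" if z: "z \<in> B m" for z
    proof -
      have zP: "z \<in> carrier (P m)" using z BD(1) by auto
      have c: "f z \<in> carrier (P m)" "r (z \<ominus>\<^bsub>P m\<^esub> f z) \<in> carrier (P m)"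
        using mod_hom_closed[OF f(1) zP] mod_hom_closed[OF r(1) mod_hom_closed[OF diff zP]] .
      have "h ?g z = h r (h f z)"
        using zP c by (simp add: h_def a_minus_def Pm.M.minus_add Pm.M.a_ac)
      then show ?thesis using step[OF f(3)[OF z]] by simp
    qed
    ultimately show ?case by (intro bexI[OF _ g]) blast
  qed
  moreover obtain k where k: "radical_products k \<subseteq> {\<zero>\<^bsub>A\<^esub>}" by (rule J_nilpotent)
  ultimately obtain f where f: "f \<in> mod_hom Ae (P m) (P m)" "f ` carrier (P m) \<subseteq> B m"
    "\<forall>z\<in>B m. h f z \<in> ?N k" by meson
  have "right_unit \<zero>\<^bsub>A\<^esub> = \<zero>\<^bsub>Ae\<^esub>"
    by (rule additive_zero[OF A.is_abelian_group Ae.is_abelian_group]) (simp_all add: right_unit_add)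
  moreover have "submodule {\<zero>\<^bsub>P m\<^esub>} Ae (P m)" by (rule Pm.submoduleI) auto
  moreover have "right_unit t = right_unit \<zero>\<^bsub>A\<^esub>" if "t \<in> radical_products k" for t
    using that k by auto
  ultimately have N0: "?N k \<subseteq> {\<zero>\<^bsub>P m\<^esub>}"
    using BD(1) by (intro Pm.action_span_subset) (auto simp del: image_subset_iff)
  have "f z = z" if z: "z \<in> B m" for z
  proof -
    have zP: "z \<in> carrier (P m)" using z BD(1) by blast
    have "z \<ominus>\<^bsub>P m\<^esub> f z = \<zero>\<^bsub>P m\<^esub>" using bspec[OF f(3) z] N0 by (auto simp: h_def)
    then show ?thesis using Pm.M.minus_eq_zero_iff[OF zP mod_hom_closed[OF f(1) zP]] by simp
  qed
  then have "retraction_at Ae P d m f"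
    using f by (simp add: retraction_at_def)
  then show thesis by (rule that)
qed

lemma exists_retraction:
  assumes "gldim A < \<infinity>"
  obtains m \<rho> where "retraction_at Ae P d m \<rho>"
proof -
  obtain m p \<rho> where p: "module_quotient Ae (P m) (PJ m) p"
    and \<rho>: "\<rho> \<in> mod_hom A (left_mod (P m)) (left_mod (image_module (P m) p))"
    "\<And>x. x \<in> PJ m \<Longrightarrow> \<rho> x = \<zero>\<^bsub>image_module (P m) p\<^esub>"
    "\<rho> ` carrier (P m) \<subseteq> p ` B m" "\<And>z. z \<in> B m \<Longrightarrow> \<rho> z = (p z :: 'p)"
    by (fact left_linear_retraction[OF assms])
  have "\<exists>\<rho>'\<in>mod_hom Ae (P m) (image_module (P m) p).
      \<rho>' ` carrier (P m) \<subseteq> p ` B m \<and> (\<forall>z\<in>B m. \<rho>' z = p z)"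
    by (rule bimodule_retraction_mod[OF p \<rho>(1) _ \<rho>(3)]) (use \<rho>(2,4) in blast)+
  then obtain \<rho>' where \<rho>': "\<rho>' \<in> mod_hom Ae (P m) (image_module (P m) p)"
    "\<rho>' ` carrier (P m) \<subseteq> p ` B m" "\<forall>z\<in>B m. \<rho>' z = p z"
    by (elim bexE conjE)
  interpret q: module_quotient Ae "P m" "PJ m" p by (rule p)
  have sub_B: "submodule (B m) Ae (P m)"
    by (rule submodule_image[OF res.lmodule_P res.lmodule_P res.d_hom])
  note BD = q.submoduleD[OF sub_B]
  \<comment> \<open>\<open>B m\<close> as a module of its own: lifting along
    \<open>B m \<rightarrow> p (B m)\<close> forces the values of \<open>r\<close> into
    \<open>B m\<close>.\<close>
  let ?V = "P m\<lparr>carrier := B m\<rparr>"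
  have "p \<in> mod_hom Ae ?V (image_module (P m) p)"
    using mod_homD[OF q.p_hom] BD(1) by (intro mod_homI) (auto simp: subset_iff)
  then obtain r where r: "r \<in> mod_hom Ae (P m) ?V" "\<And>x. x \<in> carrier (P m) \<Longrightarrow> p (r x) = \<rho>' x"
    by (rule projective_lifting[OF res.projective q.lmodule_restrict_carrier[OF sub_B] q.lmodule_Q \<rho>'(1)])
      (use \<rho>'(2) in auto)
  have r': "r \<in> mod_hom Ae (P m) (P m)" "r ` carrier (P m) \<subseteq> B m"
    using mod_homD[OF r(1)] BD(1) by (auto intro!: mod_homI)
  have "z \<ominus>\<^bsub>P m\<^esub> r z \<in> action_span (P m) SJ (B m)" if z: "z \<in> B m" for z
  proof -
    have zP: "z \<in> carrier (P m)" using z BD(1) by auto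
    have rz: "r z \<in> B m" using r'(2) zP by auto
    \<comment> \<open>Equality under \<open>p\<close> places the difference in \<open>P J\<close>
      only; being a boundary as well, it lies in \<open>B J\<close>.\<close>
    have "p z = p (r z)" using r(2)[OF zP] bspec[OF \<rho>'(3) z] by simp
    then have "z \<ominus>\<^bsub>P m\<^esub> r z \<in> PJ m" using q.p_eq_iff[OF zP, of "r z"] rz BD(1) by auto
    then show ?thesis using boundary_Int_PJ[OF BD(5)[OF z rz]] by blast
  qed
  then obtain f where "retraction_at Ae P d m f" by (rule bimodule_retraction[OF r'])
  then show thesis by (rule that)
qed

end

section \<open>Finiteness of the Hochschild dimensions\<close>

lemma Sup_enat_finite:
  assumes "\<And>n. n \<ge> m \<Longrightarrow> \<not> Q n"
  shows "Sup {enat n | n. Q n} < \<infinity>"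
proof -
  have "Sup {enat n | n. Q n} \<le> enat m"
    by (rule Sup_least) (use assms in \<open>auto simp: not_less_eq_eq intro: leI\<close>)
  then show ?thesis by (rule le_less_trans) simp
qed

theorem corollary3p3:
  fixes K :: "('k, 'x) ring_scheme" and A :: "('k, 'a, 'y) module_scheme"
  assumes "field K"
    and "assoc_algebra K A"
    and "finite_dimensional K A"
    and "separable_algebra K (quotient_algebra A (jacobson_radical A))"
    and "gldim A < \<infinity>"
  shows "hh_dim K A < \<infinity> \<and> hch_dim K A < \<infinity>"
proof -
  interpret separable_quotient K A
    by (intro separable_quotient.intro fin_dim_algebra.intro fin_dim_algebra_axioms.intro
        separable_quotient_axioms.intro assms)
  \<comment> \<open>Tor and Ext are both computed from this chosen resolution of \<open>AL\<close>,
    so a single retraction settles both dimensions.\<close>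
  obtain P d \<epsilon> where chosen: "chosen_resolution (enveloping_algebra K A) (bimodule_left A) = (P, d, \<epsilon>)"
    by (metis prod_cases3)
  interpret bimodule_resolution K A P d \<epsilon>
    by unfold_locales (rule chosen_resolution[OF lmodule_AL chosen])
  obtain m \<rho> where \<rho>: "retraction_at Ae P d m \<rho>" by (rule exists_retraction[OF assms(5)])
  \<comment> \<open>A retraction in degree \<open>i\<close> kills degree \<open>Suc i\<close>;
    starting from \<open>m\<close>, all degrees from \<open>Suc m\<close> on vanish.\<close>
  have *: "trivial_group (HH_homology K A n) \<and> trivial_group (HH_cohomology K A n)" if n: "n \<ge> Suc m" for n
  proof -
    obtain i where i: "n = Suc i" "m \<le> i" using n by (cases n) auto
    obtain \<rho>' where \<rho>': "retraction_at Ae P d i \<rho>'" using res.retraction_mono[OF \<rho> i(2)] by blast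
    have "trivial_group (HH_homology K A n)"
      using res.tensor_homology_trivial[OF abelian_group_AR _ \<rho>'] AR_smult_closed i(1)
      by (simp add: HH_homology_def Tor_def chosen tensor_map_def)
    moreover have "trivial_group (HH_cohomology K A n)"
      using res.hom_cohomology_trivial[OF lmodule_AL \<rho>'] i(1)
      by (simp add: HH_cohomology_def Ext_def chosen)
    ultimately show ?thesis by blast
  qed
  have "hh_dim K A < \<infinity>"
    unfolding hh_dim_def by (rule Sup_enat_finite[of "Suc m"]) (use * in blast)
  moreover have "hch_dim K A < \<infinity>"
    unfolding hch_dim_def by (rule Sup_enat_finite[of "Suc m"]) (use * in blast)
  ultimately show ?thesis by blast
qed

end
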